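(* Let $q\ge 2$, $d>0$, $\beta>0$, let $r>0$ be an integer and let $L=L(n)$ be any sequence with $L(n)\to\infty$. Then there exists $\varepsilon=\varepsilon(n)\to 0$ such that, with probability $1-o(1)$ as $n\to\infty$, the random graph $\mathbb G=\mathbb G(n,d/n)$ has the following property. There exist pairwise disjoint non-empty sets $S_1,\dots,S_l\subset\{1,\dots,q\}^n$ with $1\le l\le L(n)$ such that (i) $\sum_{i=1}^l\mu_{\mathbb G,\beta}(S_i)>1-\varepsilon$; (ii) each $S_i$ is an $(\varepsilon,r)$-Bethe state of $\mathbb G$; (iii) for every $i=1,\dots,l$ the messages $(\mu_{\mathbb G,\beta,v\to w}[\cdot\,|S_i])_{v\sim w}$ form an $\varepsilon$-Belief Propagation fixed point.
   Context: $\mathbb G(n,p)$ is the Erdős–Rényi random graph on vertex set $[n]=\{1,\dots,n\}$, each pair being an edge independently with probability $p$; write $u\sim v$ if $\{u,v\}$ is an edge and $\partial v$ for the set of neighbours of $v$. For a graph $G$ on $[n]$, $q\ge2$ and $\beta>0$, the Potts antiferromagnet is the probability distribution $\mu_{G,\beta}(\sigma)\propto\exp(-\beta\sum_{\{u,v\}\in E(G)}\mathbf 1\{\sigma_u=\sigma_v\})$ on $\sigma\in\{1,\dots,q\}^n$; the same formula defines the Potts distribution on any finite graph. For $S\subset\{1,\dots,q\}^n$ with $\mu_{G,\beta}(S)>0$, $\mu_{G,\beta}[\cdot|S]$ is the conditional distribution; $\mu_{G,\beta,v}[\cdot|S]$, $\mu_{G,\beta,v,w}[\cdot|S]$, $\mu_{G,\beta,U}[\cdot|S]$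 denote its marginals on the coordinates $v$, $\{v,w\}$, $U$. The total variation distance is $\|p-p'\|_{TV}=\frac12\sum_x|p(x)-p'(x)|$. For a vertex $u$ and $r\ge0$, $\nabla_{u,r}$ is the set of vertices within graph distance $r$ of $u$, and $G[\nabla_{u,r}]$ the induced subgraph. For an edge $\{v,w\}$ and $\omega\in[q]$, the message from $w$ to $v$ is $\mu_{G,\beta,w\to v}[\omega|S]$, the probability that $w$ receives colour $\omega$ under the Potts distribution on the graph $G$ with the edge $\{v,w\}$ removed, conditioned on $S$. Define, for $\sigma\in[q]^{\nabla_{u,r}}$, $\bar\mu_{G,\beta,u,r}[\sigma|S]\propto \mu_{G[\nabla_{u,r}],\beta}(\sigma)\prod_{v\in\nabla_{u,r},\,w\notin\nabla_{u,r},\,v\sim w}\big(1-(1-e^{-\beta})\mu_{G,\beta,w\to v}[\sigma_v|S]\big)$. $S$ is an $(\varepsilon,r)$-Bethe state if $\frac1n\sum_{u=1}^n\|\bar\mu_{G,\beta,u,r}[\cdot|S]-\mu_{G,\beta,\nabla_{u,r}}[\cdot|S]\|_{TV}<\varepsilon$ and $\frac1{n^2}\sum_{1\le v<w\le n}\|\mu_{G,\beta,v,w}[\cdot|S]-\mu_{G,\beta,v}[\cdot|S]\otimes\mu_{G,\beta,w}[\cdot|S]\|_{TV}<\varepsilon$. The messages given $S$ form an $\varepsilon$-Belief Propagation fixed point if $\frac1n\sum_{v\sim w}\sum_{\omega=1}^q\Big|\mu_{G,\beta,v\to w}[\omega|S]-\frac{\prod_{u\in\partial v\setminus w}(1-(1-e^{-\beta})\mu_{G,\beta,u\to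 v}[\omega|S])}{\sum_{\sigma=1}^q\prod_{u\in\partial v\setminus w}(1-(1-e^{-\beta})\mu_{G,\beta,u\to v}[\sigma|S])}\Big|<\varepsilon$ (sum over ordered adjacent pairs). *)

theory Defs
  imports "HOL-Probability.Probability"
begin

(* Vertices are 0..<n, colours are 0..<q (a relabelling of [n], [q]).
   A graph on [n] is a set of 2-element subsets (edges) of {..<n}. *)

definition all_pairs :: "nat \<Rightarrow> nat set set" where
  "all_pairs n = {{u, v} | u v. u < n \<and> v < n \<and> u \<noteq> v}"

definition Gnp :: "nat \<Rightarrow> real \<Rightarrow> nat set set pmf" where
  "Gnp n p = map_pmf (\<lambda>f. {e \<in> all_pairs n. f e})
                     (Pi_pmf (all_pairs n) False (\<lambda>_. bernoulli_pmf p))"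

definition cfg :: "nat set \<Rightarrow> nat \<Rightarrow> (nat \<Rightarrow> nat) set" where
  "cfg V q = PiE V (\<lambda>_. {..<q})"

definition mono_count :: "nat set set \<Rightarrow> (nat \<Rightarrow> nat) \<Rightarrow> nat" where
  "mono_count E \<sigma> = card {e \<in> E. \<exists>u v. e = {u, v} \<and> \<sigma> u = \<sigma> v}"

definition potts_w :: "real \<Rightarrow> nat set set \<Rightarrow> (nat \<Rightarrow> nat) \<Rightarrow> real" where
  "potts_w \<beta> E \<sigma> = exp (- \<beta> * real (mono_count E \<sigma>))"

definition Zw :: "real \<Rightarrow> nat set set \<Rightarrow> (nat \<Rightarrow> nat) set \<Rightarrow> real" where
  "Zw \<beta> E S = (\<Sum>\<sigma>\<in>S. potts_w \<beta> E \<sigma>)"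

definition potts_dist :: "real \<Rightarrow> nat \<Rightarrow> nat set \<Rightarrow> nat set set \<Rightarrow> (nat \<Rightarrow> nat) \<Rightarrow> real" where
  "potts_dist \<beta> q V E \<sigma> = potts_w \<beta> E \<sigma> / Zw \<beta> E (cfg V q)"

definition potts_prob :: "real \<Rightarrow> nat \<Rightarrow> nat \<Rightarrow> nat set set \<Rightarrow> (nat \<Rightarrow> nat) set \<Rightarrow> real" where
  "potts_prob \<beta> q n E S = Zw \<beta> E S / Zw \<beta> E (cfg {..<n} q)"

definition margU :: "real \<Rightarrow> nat set set \<Rightarrow> (nat \<Rightarrow> nat) set \<Rightarrow> nat set \<Rightarrow> (nat \<Rightarrow> nat) \<Rightarrow> real" where
  "margU \<beta> E S U \<tau> = Zw \<beta> E {\<sigma> \<in> S. restrict \<sigma> U = \<tau>} / Zw \<beta> E S"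

definition marg1 :: "real \<Rightarrow> nat set set \<Rightarrow> (nat \<Rightarrow> nat) set \<Rightarrow> nat \<Rightarrow> nat \<Rightarrow> real" where
  "marg1 \<beta> E S v \<omega> = Zw \<beta> E {\<sigma> \<in> S. \<sigma> v = \<omega>} / Zw \<beta> E S"

definition marg2 :: "real \<Rightarrow> nat set set \<Rightarrow> (nat \<Rightarrow> nat) set \<Rightarrow> nat \<Rightarrow> nat \<Rightarrow> nat \<Rightarrow> nat \<Rightarrow> real" where
  "marg2 \<beta> E S v w a b = Zw \<beta> E {\<sigma> \<in> S. \<sigma> v = a \<and> \<sigma> w = b} / Zw \<beta> E S"

text \<open>Message from w to v: marginal of w in the graph with edge {v,w} removed, given S.\<close>
definition msg :: "real \<Rightarrow> nat set set \<Rightarrow> (nat \<Rightarrow> nat) set \<Rightarrow> nat \<Rightarrow> nat \<Rightarrow> nat \<Rightarrow> real" where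
  "msg \<beta> E S w v \<omega> = marg1 \<beta> (E - {{v, w}}) S w \<omega>"

definition tv :: "'a set \<Rightarrow> ('a \<Rightarrow> real) \<Rightarrow> ('a \<Rightarrow> real) \<Rightarrow> real" where
  "tv X p p' = (1/2) * (\<Sum>x\<in>X. \<bar>p x - p' x\<bar>)"

definition adj :: "nat set set \<Rightarrow> (nat \<times> nat) set" where
  "adj E = {(u, v). {u, v} \<in> E}"

definition ball :: "nat set set \<Rightarrow> nat \<Rightarrow> nat \<Rightarrow> nat set" where
  "ball E u r = {v. \<exists>k\<le>r. (u, v) \<in> (adj E) ^^ k}"

definition induced :: "nat set set \<Rightarrow> nat set \<Rightarrow> nat set set" where
  "induced E B = {e \<in> E. e \<subseteq> B}"

definition barmu_num :: "real \<Rightarrow> nat \<Rightarrow> nat \<Rightarrow> nat set set \<Rightarrow> (nat \<Rightarrow> nat) set \<Rightarrow> nat \<Rightarrow> nat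
    \<Rightarrow> (nat \<Rightarrow> nat) \<Rightarrow> real" where
  "barmu_num \<beta> q n E S u r \<tau> =
     potts_dist \<beta> q (ball E u r) (induced E (ball E u r)) \<tau> *
     (\<Prod>v\<in>ball E u r. \<Prod>w\<in>{..<n} - ball E u r.
        if {v, w} \<in> E then 1 - (1 - exp (- \<beta>)) * msg \<beta> E S w v (\<tau> v) else 1)"

definition barmu :: "real \<Rightarrow> nat \<Rightarrow> nat \<Rightarrow> nat set set \<Rightarrow> (nat \<Rightarrow> nat) set \<Rightarrow> nat \<Rightarrow> nat
    \<Rightarrow> (nat \<Rightarrow> nat) \<Rightarrow> real" where
  "barmu \<beta> q n E S u r \<tau> = barmu_num \<beta> q n E S u r \<tau> /
     (\<Sum>\<tau>'\<in>cfg (ball E u r) q. barmu_num \<beta> q n E S u r \<tau>')"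

definition bethe_state :: "real \<Rightarrow> nat \<Rightarrow> nat \<Rightarrow> nat set set \<Rightarrow> (nat \<Rightarrow> nat) set \<Rightarrow> real \<Rightarrow> nat \<Rightarrow> bool" where
  "bethe_state \<beta> q n E S \<epsilon> r \<longleftrightarrow>
     (1 / real n) * (\<Sum>u<n. tv (cfg (ball E u r) q) (barmu \<beta> q n E S u r)
                                 (margU \<beta> E S (ball E u r))) < \<epsilon> \<and>
     (1 / (real n)^2) * (\<Sum>(v, w)\<in>{(v, w). v < w \<and> w < n}.
         tv ({..<q} \<times> {..<q}) (\<lambda>(a, b). marg2 \<beta> E S v w a b)
                               (\<lambda>(a, b). marg1 \<beta> E S v a * marg1 \<beta> E S w b)) < \<epsilon>"

definition bp_prod :: "real \<Rightarrow> nat \<Rightarrow> nat set set \<Rightarrow> (nat \<Rightarrow> nat) set \<Rightarrow> nat \<Rightarrow> nat \<Rightarrow> nat \<Rightarrow> real" where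
  "bp_prod \<beta> n E S v w \<omega> =
     (\<Prod>u\<in>{..<n}. if {u, v} \<in> E \<and> u \<noteq> w then 1 - (1 - exp (- \<beta>)) * msg \<beta> E S u v \<omega> else 1)"

definition bp_fixed_point :: "real \<Rightarrow> nat \<Rightarrow> nat \<Rightarrow> nat set set \<Rightarrow> (nat \<Rightarrow> nat) set \<Rightarrow> real \<Rightarrow> bool" where
  "bp_fixed_point \<beta> q n E S \<epsilon> \<longleftrightarrow>
     (1 / real n) * (\<Sum>v<n. \<Sum>w<n. if {v, w} \<in> E then
        (\<Sum>\<omega><q. \<bar>msg \<beta> E S v w \<omega> -
            bp_prod \<beta> n E S v w \<omega> / (\<Sum>\<sigma><q. bp_prod \<beta> n E S v w \<sigma>)\<bar>) else 0) < \<epsilon>"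

definition good_graph :: "real \<Rightarrow> nat \<Rightarrow> nat \<Rightarrow> nat \<Rightarrow> real \<Rightarrow> real \<Rightarrow> nat set set \<Rightarrow> bool" where
  "good_graph \<beta> q r n Lmax \<epsilon> E \<longleftrightarrow>
     (\<exists>l::nat. \<exists>S :: nat \<Rightarrow> (nat \<Rightarrow> nat) set.
        1 \<le> l \<and> real l \<le> Lmax \<and>
        (\<forall>i<l. S i \<subseteq> cfg {..<n} q \<and> S i \<noteq> {}) \<and>
        (\<forall>i<l. \<forall>j<l. i \<noteq> j \<longrightarrow> S i \<inter> S j = {}) \<and>
        (\<Sum>i<l. potts_prob \<beta> q n E (S i)) > 1 - \<epsilon> \<and>
        (\<forall>i<l. bethe_state \<beta> q n E (S i) \<epsilon> r) \<and>
        (\<forall>i<l. bp_fixed_point \<beta> q n E (S i) \<epsilon>))"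

end

(* Pin the spins of a random number t < T of uniformly random vertices us, chosen independently of
   the graph, and let the S_i be the cells {sigma. sigma = tau on us}; there are at most q^T of them.

   For any weight on configurations the energy E sum_w sum_c P(sigma_w = c | pinned spins)^2 grows
   with the number of pins and stays below n, so for most t a few additional pins hardly change
   the marginals. As the additional pins are themselves uniformly random, the joint law of finitely
   many random spins almost factorises on most cells.

   A ball around a vertex is glued to the rest of the graph by a bounded number of edges. Deleting
   them from G(n,p) costs only a factor odds(p) ~ d/n per edge, so the outer endpoints can be
   summed over all vertices of the remaining graph, for which pinning gives factorisation. A product
   law of the outer spins turns the marginal on the ball and the messages into the Bethe and Belief
   Propagation formulas; the latter is the case of radius 0. Markov's inequality, first over
   graphs and then over cells, yields the theorem for fixed epsilon, and a diagonal argument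
   removes the dependence on epsilon. *)

theory Submission
  imports Defs
begin

section \<open>Pinning\<close>

text \<open>Factorisation holds for uniformly random vertices, whereas the outer endpoints of a
  ball's cut edges are chosen by the graph. Treating every list of pairs as a candidate cut removes
  this dependence: k outer endpoints give n^k lists at price \<open>odds p ^ k\<close> each, so n
  cancels, and the inner endpoints add at most K^k choices. Deleting the edges also changes the
  Gibbs measure, by a factor at most exp(\<beta> K). So the pinning error \<eta> has to beat a
  constant depending on K, which fixes the order of choices: K from the tails of ball sizes and
  degrees, then \<eta>, then T, and n last, to make pins inside a ball rare. T depends on no graph,
  hence q^T is a constant that L eventually exceeds.

  Messages enter because, without cut edges, the ball is independent of the outside; the cut edges
  reweight it by the mean of a product over outer spins, close to a product of one-spin means.
  Restoring all cut edges but one hardly moves the outer spin of the missing edge, so its marginal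
  may be exchanged for the message.\<close>

definition wavg :: "('a \<Rightarrow> real) \<Rightarrow> 'a set \<Rightarrow> ('a \<Rightarrow> real) \<Rightarrow> real" where
  "wavg W S f = (\<Sum>x\<in>S. W x * f x) / (\<Sum>x\<in>S. W x)"

text \<open>A cell is named by a configuration in it rather than by the list of revealed colours, so
  drawing \<tau> from the weight selects each cell with its own mass.\<close>

definition pin :: "('a \<Rightarrow> 'b) set \<Rightarrow> 'a list \<Rightarrow> ('a \<Rightarrow> 'b) \<Rightarrow> ('a \<Rightarrow> 'b) set" where
  "pin \<Omega> us \<tau> = {\<sigma>\<in>\<Omega>. map \<sigma> us = map \<tau> us}"

definition marg :: "(('a \<Rightarrow> 'b) \<Rightarrow> real) \<Rightarrow> ('a \<Rightarrow> 'b) set \<Rightarrow> 'a \<Rightarrow> 'b \<Rightarrow> real" where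
  "marg W S w c = wavg W S (\<lambda>\<sigma>. of_bool (\<sigma> w = c))"

text \<open>\<tau> supplies both the pinned colours on \<open>us\<close> and the newly revealed ones
  on \<open>vs\<close>; averaging over \<tau> in a cell of \<open>us\<close> averages over the
  revelations.\<close>

definition dev :: "('a \<Rightarrow> nat) set \<Rightarrow> (('a \<Rightarrow> nat) \<Rightarrow> real) \<Rightarrow> nat \<Rightarrow> 'a list \<Rightarrow> 'a list \<Rightarrow> 'a
    \<Rightarrow> ('a \<Rightarrow> nat) \<Rightarrow> real" where
  "dev \<Omega> W q us vs w \<tau> = (\<Sum>c<q. \<bar>marg W (pin \<Omega> (us @ vs) \<tau>) w c - marg W (pin \<Omega> us \<tau>) w c\<bar>)"

text \<open>The spins of the list are revealed from its end: the head is compared with its marginal before and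
  after the tail has been revealed.\<close>
fun err :: "('a \<Rightarrow> nat) set \<Rightarrow> (('a \<Rightarrow> nat) \<Rightarrow> real) \<Rightarrow> nat \<Rightarrow> 'a list \<Rightarrow> 'a list
    \<Rightarrow> ('a \<Rightarrow> nat) \<Rightarrow> real" where
  "err \<Omega> W q us [] \<tau> = 0"
| "err \<Omega> W q us (w # ws) \<tau> = err \<Omega> W q us ws \<tau> + wavg W (pin \<Omega> us \<tau>) (dev \<Omega> W q us ws w)"

section \<open>Weighted averages and conditioning\<close>

lemma abs_mult_le_one: "0 \<le> a \<Longrightarrow> a \<le> 1 \<Longrightarrow> \<bar>a * x\<bar> \<le> \<bar>x\<bar>" for a x :: real
  using mult_right_mono[of a 1 "\<bar>x\<bar>"] by (simp add: abs_mult)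

lemma wavg_mono:
  assumes "finite S" "\<And>x. x \<in> S \<Longrightarrow> W x > 0" "\<And>x. x \<in> S \<Longrightarrow> f x \<le> g x"
  shows "wavg W S f \<le> wavg W S g"
  unfolding wavg_def
  by (intro divide_right_mono sum_mono mult_left_mono sum_nonneg) (auto intro: assms less_imp_le)

lemma wavg_nonneg:
  assumes "\<And>x. x \<in> S \<Longrightarrow> W x > 0" "\<And>x. x \<in> S \<Longrightarrow> f x \<ge> 0"
  shows "wavg W S f \<ge> 0"
  unfolding wavg_def
  by (intro divide_nonneg_nonneg sum_nonneg mult_nonneg_nonneg) (auto intro: assms less_imp_le)

lemma wavg_cong:
  assumes "\<And>x. x \<in> S \<Longrightarrow> f x = g x"
  shows "wavg W S f = wavg W S g"
  unfolding wavg_def using assms by (simp cong: sum.cong)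

lemma wavg_diff: "wavg W S (\<lambda>x. f x - g x) = wavg W S f - wavg W S g"
  unfolding wavg_def by (simp add: right_diff_distrib sum_subtractf diff_divide_distrib)

lemma wavg_add: "wavg W S (\<lambda>x. f x + g x) = wavg W S f + wavg W S g"
  unfolding wavg_def by (simp add: distrib_left sum.distrib add_divide_distrib)

lemma wavg_cmult: "wavg W S (\<lambda>x. c * f x) = c * wavg W S f"
  unfolding wavg_def by (simp add: sum_distrib_left mult.left_commute)

lemma wavg_cmult_right: "wavg W S (\<lambda>x. f x * c) = wavg W S f * c"
  using wavg_cmult[of W S c f] by (simp add: mult.commute)

lemma wavg_sum: "wavg W S (\<lambda>x. \<Sum>i\<in>I. f i x) = (\<Sum>i\<in>I. wavg W S (f i))"
proof -
  have "(\<Sum>x\<in>S. W x * (\<Sum>i\<in>I. f i x)) = (\<Sum>i\<in>I. \<Sum>x\<in>S. W x * f i x)"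
    by (simp add: sum_distrib_left sum.swap[of _ I])
  then show ?thesis by (simp add: wavg_def sum_divide_distrib)
qed

lemma wavg_abs_le:
  assumes "\<And>x. x \<in> S \<Longrightarrow> W x > 0"
  shows "\<bar>wavg W S f\<bar> \<le> wavg W S (\<lambda>x. \<bar>f x\<bar>)"
proof -
  have "\<bar>\<Sum>x\<in>S. W x * f x\<bar> \<le> (\<Sum>x\<in>S. W x * \<bar>f x\<bar>)"
    by (rule order_trans[OF sum_abs]) (auto intro!: sum_mono simp: abs_mult assms less_imp_le)
  moreover have "(\<Sum>x\<in>S. W x) \<ge> 0" by (intro sum_nonneg) (auto intro: assms less_imp_le)
  ultimately show ?thesis by (simp add: wavg_def abs_divide divide_right_mono)
qed

lemma wavg_const:
  assumes "finite S" "S \<noteq> {}" "\<And>x. x \<in> S \<Longrightarrow> W x > 0"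
  shows "wavg W S (\<lambda>_. c) = c"
proof -
  have "(\<Sum>x\<in>S. W x) > 0" using assms by (intro sum_pos) auto
  then show ?thesis by (simp add: wavg_def sum_distrib_right[symmetric])
qed

text \<open>Tower property: the inner average is the conditional mean of f given k, and h depends on
  k only, so it can be taken out of each fibre.\<close>

lemma sum_wavg_fibre:
  fixes W f h :: "'a \<Rightarrow> real" and k :: "'a \<Rightarrow> 'b"
  assumes fin: "finite S" and pos: "\<And>x. x \<in> S \<Longrightarrow> W x > 0"
    and h: "\<And>x y. x \<in> S \<Longrightarrow> y \<in> S \<Longrightarrow> k x = k y \<Longrightarrow> h x = h y"
  shows "(\<Sum>x\<in>S. W x * (h x * wavg W {y\<in>S. k y = k x} f)) = (\<Sum>x\<in>S. W x * (h x * f x))"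
proof -
  have *: "(\<Sum>x | x \<in> S \<and> k x = z. W x * (h x * wavg W {y\<in>S. k y = k x} f))
      = (\<Sum>x | x \<in> S \<and> k x = z. W x * (h x * f x))" if z: "z \<in> k ` S" for z
  proof -
    obtain x0 where x0: "x0 \<in> S" "k x0 = z" using z by blast
    let ?F = "{y\<in>S. k y = z}"
    have hx: "h x = h x0" if "x \<in> ?F" for x using that x0 by (intro h) auto
    have Z: "(\<Sum>x\<in>?F. W x) > 0" using fin x0 pos by (intro sum_pos) auto
    have "(\<Sum>x\<in>?F. W x * (h x * wavg W {y\<in>S. k y = k x} f))
        = (\<Sum>x\<in>?F. W x * (h x0 * wavg W ?F f))"
      by (intro sum.cong refl) (auto simp: hx)
    also have "\<dots> = (\<Sum>x\<in>?F. W x) * (h x0 * wavg W ?F f)"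
      by (simp add: sum_distrib_right)
    also have "\<dots> = h x0 * (\<Sum>x\<in>?F. W x * f x)"
      using Z by (simp add: wavg_def)
    also have "\<dots> = (\<Sum>x\<in>?F. W x * (h x * f x))"
      unfolding sum_distrib_left by (intro sum.cong refl) (auto simp: hx)
    finally show ?thesis .
  qed
  have "(\<Sum>z\<in>k ` S. \<Sum>x | x \<in> S \<and> k x = z. W x * (h x * wavg W {y\<in>S. k y = k x} f))
      = (\<Sum>z\<in>k ` S. \<Sum>x | x \<in> S \<and> k x = z. W x * (h x * f x))"
    by (intro sum.cong refl *)
  then show ?thesis by (simp only: sum.group[OF fin finite_imageI[OF fin] subset_refl])
qed

section \<open>Cells and the order of revelation\<close>

lemma pin_subset: "pin \<Omega> us \<tau> \<subseteq> \<Omega>"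
  by (auto simp: pin_def)

lemma pin_self: "\<tau> \<in> \<Omega> \<Longrightarrow> \<tau> \<in> pin \<Omega> us \<tau>"
  by (auto simp: pin_def)

lemma pin_eq: "\<sigma> \<in> pin \<Omega> us \<tau> \<Longrightarrow> pin \<Omega> us \<sigma> = pin \<Omega> us \<tau>"
  by (auto simp: pin_def)

lemma pin_append: "\<sigma> \<in> pin \<Omega> us \<tau> \<Longrightarrow> pin \<Omega> (us @ vs) \<sigma> = {\<rho>\<in>pin \<Omega> us \<tau>. map \<rho> vs = map \<sigma> vs}"
  by (auto simp: pin_def)

text \<open>The weight stays abstract because one bound must serve all graphs on n vertices at once,
  including those left after deleting edges.\<close>

locale weighted_configs =
  fixes \<Omega> :: "(nat \<Rightarrow> nat) set" and W :: "(nat \<Rightarrow> nat) \<Rightarrow> real" and q n :: nat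
  assumes finite_configs: "finite \<Omega>"
    and configs_nonempty: "\<Omega> \<noteq> {}"
    and weight_pos: "\<sigma> \<in> \<Omega> \<Longrightarrow> W \<sigma> > 0"
    and colour_less: "\<sigma> \<in> \<Omega> \<Longrightarrow> u < n \<Longrightarrow> \<sigma> u < q"
begin

lemma finite_pin: "finite (pin \<Omega> us \<tau>)"
  using finite_configs pin_subset by (rule rev_finite_subset)

lemma pin_weight_pos: "\<sigma> \<in> pin \<Omega> us \<tau> \<Longrightarrow> W \<sigma> > 0"
  using weight_pos pin_subset by blast

lemma dev_nonneg: "dev \<Omega> W q us vs w \<tau> \<ge> 0"
  by (simp add: dev_def sum_nonneg)

lemma err_nonneg: "err \<Omega> W q us ws \<tau> \<ge> 0"
  by (induction ws) (auto intro!: add_nonneg_nonneg wavg_nonneg dev_nonneg pin_weight_pos)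

lemma wavg_colour:
  assumes S: "S \<subseteq> \<Omega>" and w: "w < n"
  shows "wavg W S (\<lambda>\<sigma>. h (\<sigma> w)) = (\<Sum>c<q. h c * marg W S w c)"
proof -
  have "wavg W S (\<lambda>\<sigma>. h (\<sigma> w)) = wavg W S (\<lambda>\<sigma>. \<Sum>c<q. h c * of_bool (\<sigma> w = c))"
  proof (rule wavg_cong)
    fix \<sigma> assume "\<sigma> \<in> S"
    then have "\<sigma> w < q" using S w colour_less by auto
    then show "h (\<sigma> w) = (\<Sum>c<q. h c * of_bool (\<sigma> w = c))"
      by (simp add: of_bool_def if_distrib[of "\<lambda>x. _ * x"] sum.delta cong: if_cong)
  qed
  also have "\<dots> = (\<Sum>c<q. h c * marg W S w c)"
    unfolding wavg_sum wavg_cmult marg_def ..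
  finally show ?thesis .
qed

text \<open>The spins of the tail determine all factors but the first. Given them, the conditional
  mean of the first factor differs from its mean in the cell by at most \<open>dev\<close>, and
  factors in [0,1] do not amplify the error already made on the tail.\<close>

lemma wavg_product_err:
  assumes "\<tau> \<in> \<Omega>" and "set ws \<subseteq> {..<n}"
    and "\<And>i c. i < length ws \<Longrightarrow> 0 \<le> h i c \<and> h i c \<le> 1"
  shows "\<bar>wavg W (pin \<Omega> us \<tau>) (\<lambda>\<sigma>. \<Prod>i<length ws. h i (\<sigma> (ws ! i)))
      - (\<Prod>i<length ws. wavg W (pin \<Omega> us \<tau>) (\<lambda>\<sigma>. h i (\<sigma> (ws ! i))))\<bar> \<le> err \<Omega> W q us ws \<tau>"
  using assms(2,3)
proof (induction ws arbitrary: h)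
  case Nil
  have "pin \<Omega> us \<tau> \<noteq> {}" using pin_self assms(1) by blast
  then show ?case using finite_pin pin_weight_pos by (simp add: wavg_const)
next
  case (Cons w ws)
  let ?S = "pin \<Omega> us \<tau>"
  let ?k = "length ws"
  define H where "H \<sigma> = (\<Prod>i<?k. h (Suc i) (\<sigma> (ws ! i)))" for \<sigma>
  define P where "P = (\<Prod>i<?k. wavg W ?S (\<lambda>\<sigma>. h (Suc i) (\<sigma> (ws ! i))))"
  define f where "f \<sigma> = h 0 (\<sigma> w)" for \<sigma> :: "nat \<Rightarrow> nat"
  have w: "w < n" using Cons.prems by simp
  have h0: "0 \<le> h 0 c" "h 0 c \<le> 1" for c using Cons.prems(2)[of 0 c] by auto
  have IH: "\<bar>wavg W ?S H - P\<bar> \<le> err \<Omega> W q us ws \<tau>"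
    unfolding H_def P_def using Cons.prems
    by (intro Cons.IH[of "\<lambda>i. h (Suc i)"]) auto
  have H01: "0 \<le> H \<sigma>" "H \<sigma> \<le> 1" for \<sigma>
    unfolding H_def using Cons.prems(2) by (auto intro!: prod_nonneg prod_le_1)
  have Sne: "?S \<noteq> {}" using pin_self assms(1) by blast
  have Sfin: "finite ?S" by (rule finite_pin)
  have f01: "0 \<le> wavg W ?S f" "wavg W ?S f \<le> 1"
  proof -
    show "0 \<le> wavg W ?S f" by (intro wavg_nonneg) (auto simp: f_def h0 pin_weight_pos)
    have "wavg W ?S f \<le> wavg W ?S (\<lambda>_. 1)"
      by (intro wavg_mono) (auto simp: f_def h0 pin_weight_pos Sfin)
    then show "wavg W ?S f \<le> 1" using Sne Sfin pin_weight_pos by (simp add: wavg_const)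
  qed
  \<comment> \<open>\<open>H\<close> reads only the spins on \<open>ws\<close>, so it is constant on
    the subcells of \<open>us @ ws\<close>, where \<open>f\<close> may be replaced by its
    conditional mean.\<close>
  have tower: "wavg W ?S (\<lambda>\<sigma>. H \<sigma> * wavg W (pin \<Omega> (us @ ws) \<sigma>) f) = wavg W ?S (\<lambda>\<sigma>. H \<sigma> * f \<sigma>)"
  proof -
    have "(\<Sum>\<sigma>\<in>?S. W \<sigma> * (H \<sigma> * wavg W {\<rho>\<in>?S. map \<rho> ws = map \<sigma> ws} f)) = (\<Sum>\<sigma>\<in>?S. W \<sigma> * (H \<sigma> * f \<sigma>))"
    proof (rule sum_wavg_fibre[OF Sfin pin_weight_pos])
      fix x y :: "nat \<Rightarrow> nat" assume "map x ws = map y ws"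
      then have "x (ws ! i) = y (ws ! i)" if "i < ?k" for i
        using that by (metis nth_map)
      then show "H x = H y" by (simp add: H_def)
    qed
    moreover have "(\<Sum>\<sigma>\<in>?S. W \<sigma> * (H \<sigma> * wavg W {\<rho>\<in>?S. map \<rho> ws = map \<sigma> ws} f))
        = (\<Sum>\<sigma>\<in>?S. W \<sigma> * (H \<sigma> * wavg W (pin \<Omega> (us @ ws) \<sigma>) f))"
      by (intro sum.cong refl) (simp add: pin_append)
    ultimately show ?thesis by (simp add: wavg_def)
  qed
  have step: "\<bar>wavg W ?S (\<lambda>\<sigma>. H \<sigma> * f \<sigma>) - wavg W ?S H * wavg W ?S f\<bar> \<le> wavg W ?S (dev \<Omega> W q us ws w)"
  proof -
    have "wavg W ?S (\<lambda>\<sigma>. H \<sigma> * f \<sigma>) - wavg W ?S H * wavg W ?S f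
        = wavg W ?S (\<lambda>\<sigma>. H \<sigma> * (wavg W (pin \<Omega> (us @ ws) \<sigma>) f - wavg W ?S f))"
      by (simp add: right_diff_distrib wavg_diff wavg_cmult_right tower)
    also have "\<bar>\<dots>\<bar> \<le> wavg W ?S (\<lambda>\<sigma>. \<bar>H \<sigma> * (wavg W (pin \<Omega> (us @ ws) \<sigma>) f - wavg W ?S f)\<bar>)"
      by (rule wavg_abs_le) (rule pin_weight_pos)
    also have "\<dots> \<le> wavg W ?S (dev \<Omega> W q us ws w)"
    proof (rule wavg_mono[OF Sfin pin_weight_pos])
      fix \<sigma> assume \<sigma>: "\<sigma> \<in> ?S"
      let ?F = "pin \<Omega> (us @ ws) \<sigma>"
      have eq: "wavg W ?F f - wavg W ?S f = (\<Sum>c<q. h 0 c * (marg W ?F w c - marg W ?S w c))"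
        unfolding f_def by (simp add: wavg_colour[OF pin_subset w] right_diff_distrib sum_subtractf)
      have "\<bar>wavg W ?F f - wavg W ?S f\<bar> = \<bar>\<Sum>c<q. h 0 c * (marg W ?F w c - marg W ?S w c)\<bar>"
        by (simp only: eq)
      also have "\<dots> \<le> (\<Sum>c<q. \<bar>h 0 c * (marg W ?F w c - marg W ?S w c)\<bar>)" by (rule sum_abs)
      also have "\<dots> \<le> dev \<Omega> W q us ws w \<sigma>"
        unfolding dev_def pin_eq[OF \<sigma>] by (intro sum_mono abs_mult_le_one h0)
      finally have d: "\<bar>wavg W ?F f - wavg W ?S f\<bar> \<le> dev \<Omega> W q us ws w \<sigma>" .
      have "\<bar>H \<sigma> * (wavg W ?F f - wavg W ?S f)\<bar> \<le> \<bar>wavg W ?F f - wavg W ?S f\<bar>"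
        by (intro abs_mult_le_one H01)
      with d show "\<bar>H \<sigma> * (wavg W ?F f - wavg W ?S f)\<bar> \<le> dev \<Omega> W q us ws w \<sigma>" by simp
    qed
    finally show ?thesis .
  qed
  have "wavg W ?S f * (wavg W ?S H - P) = wavg W ?S H * wavg W ?S f - P * wavg W ?S f"
    by (simp only: right_diff_distrib mult.commute)
  with abs_mult_le_one[OF f01, of "wavg W ?S H - P"]
  have "\<bar>wavg W ?S H * wavg W ?S f - P * wavg W ?S f\<bar> \<le> \<bar>wavg W ?S H - P\<bar>"
    by (simp only:)
  with IH step have bound: "\<bar>wavg W ?S (\<lambda>\<sigma>. H \<sigma> * f \<sigma>) - P * wavg W ?S f\<bar> \<le> err \<Omega> W q us (w # ws) \<tau>"
    unfolding err.simps by linarith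
  have prod_eq: "(\<Prod>i<length (w # ws). wavg W ?S (\<lambda>\<sigma>. h i (\<sigma> ((w # ws) ! i)))) = P * wavg W ?S f"
    unfolding P_def f_def length_Cons prod.lessThan_Suc_shift by (simp add: mult.commute)
  have fun_eq: "(\<lambda>\<sigma>. \<Prod>i<length (w # ws). h i (\<sigma> ((w # ws) ! i))) = (\<lambda>\<sigma>. H \<sigma> * f \<sigma>)"
    unfolding H_def f_def length_Cons prod.lessThan_Suc_shift by (simp add: mult.commute)
  show ?case unfolding prod_eq fun_eq by (fact bound)
qed

section \<open>Energy of a pinning\<close>

definition energy :: "nat list \<Rightarrow> real" where
  "energy us = wavg W \<Omega> (\<lambda>\<tau>. \<Sum>w<n. \<Sum>c<q. (marg W (pin \<Omega> us \<tau>) w c)\<^sup>2)"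

lemma marg_nonneg: "marg W (pin \<Omega> us \<tau>) w c \<ge> 0"
  unfolding marg_def by (intro wavg_nonneg) (auto intro: pin_weight_pos)

lemma sum_marg:
  assumes "\<tau> \<in> \<Omega>" "w < n"
  shows "(\<Sum>c<q. marg W (pin \<Omega> us \<tau>) w c) = 1"
proof -
  have "pin \<Omega> us \<tau> \<noteq> {}" using pin_self assms(1) by blast
  then show ?thesis
    using wavg_colour[OF pin_subset assms(2), of us \<tau> "\<lambda>_. 1"] finite_pin pin_weight_pos
    by (simp add: wavg_const)
qed

lemma energy_nonneg: "energy us \<ge> 0"
  unfolding energy_def by (intro wavg_nonneg sum_nonneg) (auto intro: weight_pos)

lemma energy_le: "energy us \<le> real n"
proof -
  have "energy us \<le> wavg W \<Omega> (\<lambda>_. real n)"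
    unfolding energy_def
  proof (rule wavg_mono[OF finite_configs weight_pos])
    fix \<tau> assume \<tau>: "\<tau> \<in> \<Omega>"
    have "(\<Sum>c<q. (marg W (pin \<Omega> us \<tau>) w c)\<^sup>2) \<le> 1" if w: "w < n" for w
    proof -
      have "(\<Sum>c<q. (marg W (pin \<Omega> us \<tau>) w c)\<^sup>2) \<le> (\<Sum>c<q. marg W (pin \<Omega> us \<tau>) w c)"
      proof (rule sum_mono)
        fix c assume "c \<in> {..<q}"
        then have "marg W (pin \<Omega> us \<tau>) w c \<le> 1"
          using member_le_sum[of c "{..<q}" "marg W (pin \<Omega> us \<tau>) w"] marg_nonneg sum_marg[OF \<tau> w, of us]
          by simp
        then show "(marg W (pin \<Omega> us \<tau>) w c)\<^sup>2 \<le> marg W (pin \<Omega> us \<tau>) w c"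
          using marg_nonneg[of us \<tau> w c] by (simp add: power2_eq_square mult_left_le)
      qed
      then show ?thesis using sum_marg[OF \<tau> w] by simp
    qed
    then have "(\<Sum>w<n. \<Sum>c<q. (marg W (pin \<Omega> us \<tau>) w c)\<^sup>2) \<le> (\<Sum>w<n. 1)"
      by (intro sum_mono) auto
    then show "(\<Sum>w<n. \<Sum>c<q. (marg W (pin \<Omega> us \<tau>) w c)\<^sup>2) \<le> real n" by simp
  qed
  then show ?thesis using finite_configs configs_nonempty weight_pos by (simp add: wavg_const)
qed

lemma wavg_tower:
  assumes "\<And>x y. x \<in> \<Omega> \<Longrightarrow> y \<in> \<Omega> \<Longrightarrow> map x us = map y us \<Longrightarrow> h x = h y"
  shows "wavg W \<Omega> (\<lambda>\<tau>. h \<tau> * wavg W (pin \<Omega> us \<tau>) f) = wavg W \<Omega> (\<lambda>\<tau>. h \<tau> * f \<tau>)"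
  unfolding wavg_def[of W \<Omega>] pin_def
  by (subst sum_wavg_fibre[OF finite_configs weight_pos, where k = "\<lambda>x. map x us"]) (auto intro: assms)

lemma pin_cong: "map x us = map y us \<Longrightarrow> pin \<Omega> us x = pin \<Omega> us y"
  by (auto simp: pin_def)

text \<open>Pythagoras for the martingale of conditional means: the cross term and the square of the
  coarser mean both have the same average as the coarser mean times f.\<close>

lemma wavg_square_increment:
  "wavg W \<Omega> (\<lambda>\<tau>. (wavg W (pin \<Omega> (us @ vs) \<tau>) f - wavg W (pin \<Omega> us \<tau>) f)\<^sup>2)
    = wavg W \<Omega> (\<lambda>\<tau>. (wavg W (pin \<Omega> (us @ vs) \<tau>) f)\<^sup>2) - wavg W \<Omega> (\<lambda>\<tau>. (wavg W (pin \<Omega> us \<tau>) f)\<^sup>2)"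
proof -
  define P where "P \<tau> = wavg W (pin \<Omega> (us @ vs) \<tau>) f" for \<tau>
  define R where "R \<tau> = wavg W (pin \<Omega> us \<tau>) f" for \<tau>
  have R: "R x = R y" if "map x us = map y us" for x y
    using pin_cong[OF that] by (simp add: R_def)
  have "wavg W \<Omega> (\<lambda>\<tau>. R \<tau> * P \<tau>) = wavg W \<Omega> (\<lambda>\<tau>. R \<tau> * f \<tau>)"
    unfolding P_def by (rule wavg_tower) (auto intro: R)
  moreover have "wavg W \<Omega> (\<lambda>\<tau>. R \<tau> * R \<tau>) = wavg W \<Omega> (\<lambda>\<tau>. R \<tau> * f \<tau>)"
    unfolding R_def[of "_"] by (rule wavg_tower) (auto intro: R[unfolded R_def])
  moreover have "(\<lambda>\<tau>. (P \<tau> - R \<tau>)\<^sup>2) = (\<lambda>\<tau>. ((P \<tau>)\<^sup>2 - 2 * (R \<tau> * P \<tau>)) + R \<tau> * R \<tau>)"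
    by (auto simp: power2_eq_square algebra_simps)
  ultimately have "wavg W \<Omega> (\<lambda>\<tau>. (P \<tau> - R \<tau>)\<^sup>2)
      = wavg W \<Omega> (\<lambda>\<tau>. (P \<tau>)\<^sup>2) - wavg W \<Omega> (\<lambda>\<tau>. R \<tau> * R \<tau>)"
    by (simp add: wavg_add wavg_diff wavg_cmult)
  then show ?thesis by (simp add: P_def R_def power2_eq_square)
qed

lemma energy_increment:
  "energy (us @ vs) - energy us
    = (\<Sum>w<n. \<Sum>c<q. wavg W \<Omega> (\<lambda>\<tau>. (marg W (pin \<Omega> (us @ vs) \<tau>) w c - marg W (pin \<Omega> us \<tau>) w c)\<^sup>2))"
  unfolding energy_def wavg_sum marg_def wavg_square_increment
  by (simp add: sum_subtractf)

text \<open>Passes from absolute values to squares by \<bar>x\<bar> \<le> l x^2 + 1/l, which keeps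
  the bound linear in the energy increment, so that increments for different numbers of pins can be
  added and telescoped. The parameter l is fixed later.\<close>

lemma sum_dev_le:
  assumes l: "l > 0"
  shows "(\<Sum>w<n. wavg W \<Omega> (dev \<Omega> W q us vs w))
    \<le> l * (energy (us @ vs) - energy us) + real n * (real q / l)"
proof -
  have amgm: "\<bar>x\<bar> \<le> l * x\<^sup>2 + 1 / l" for x :: real
  proof -
    have "0 \<le> (l * \<bar>x\<bar> - 1)\<^sup>2 + l * \<bar>x\<bar>" using l by simp
    also have "\<dots> = l * (l * x\<^sup>2 + 1 / l - \<bar>x\<bar>)"
      using l by (simp add: power2_eq_square algebra_simps)
    finally show ?thesis using l by (simp add: zero_le_mult_iff)
  qed
  have "wavg W \<Omega> (dev \<Omega> W q us vs w)
      \<le> l * (\<Sum>c<q. wavg W \<Omega> (\<lambda>\<tau>. (marg W (pin \<Omega> (us @ vs) \<tau>) w c - marg W (pin \<Omega> us \<tau>) w c)\<^sup>2)) + real q / l" for w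
  proof -
    have "wavg W \<Omega> (dev \<Omega> W q us vs w) \<le> wavg W \<Omega> (\<lambda>\<tau>. l * (\<Sum>c<q. (marg W (pin \<Omega> (us @ vs) \<tau>) w c - marg W (pin \<Omega> us \<tau>) w c)\<^sup>2) + real q / l)"
    proof (rule wavg_mono[OF finite_configs weight_pos])
      fix \<tau> assume "\<tau> \<in> \<Omega>"
      have "dev \<Omega> W q us vs w \<tau> \<le> (\<Sum>c<q. l * (marg W (pin \<Omega> (us @ vs) \<tau>) w c - marg W (pin \<Omega> us \<tau>) w c)\<^sup>2 + 1 / l)"
        unfolding dev_def by (intro sum_mono amgm)
      then show "dev \<Omega> W q us vs w \<tau> \<le> l * (\<Sum>c<q. (marg W (pin \<Omega> (us @ vs) \<tau>) w c - marg W (pin \<Omega> us \<tau>) w c)\<^sup>2) + real q / l"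
        by (simp add: sum.distrib sum_distrib_left)
    qed
    also have "\<dots> = l * (\<Sum>c<q. wavg W \<Omega> (\<lambda>\<tau>. (marg W (pin \<Omega> (us @ vs) \<tau>) w c - marg W (pin \<Omega> us \<tau>) w c)\<^sup>2)) + real q / l"
      using finite_configs configs_nonempty weight_pos
      by (simp add: wavg_add wavg_cmult wavg_sum wavg_const)
    finally show ?thesis .
  qed
  then have "(\<Sum>w<n. wavg W \<Omega> (dev \<Omega> W q us vs w))
     \<le> (\<Sum>w<n. l * (\<Sum>c<q. wavg W \<Omega> (\<lambda>\<tau>. (marg W (pin \<Omega> (us @ vs) \<tau>) w c - marg W (pin \<Omega> us \<tau>) w c)\<^sup>2)) + real q / l)"
    by (intro sum_mono)
  then show ?thesis by (simp add: energy_increment sum.distrib sum_distrib_left)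
qed

end

section \<open>Uniformly random lists of vertices\<close>

definition tuples :: "nat \<Rightarrow> nat \<Rightarrow> nat list set" where
  "tuples n k = {xs. set xs \<subseteq> {..<n} \<and> length xs = k}"

lemma finite_tuples: "finite (tuples n k)"
  unfolding tuples_def by (rule finite_lists_length_eq) simp

lemma card_tuples: "card (tuples n k) = n ^ k"
  unfolding tuples_def using card_lists_length_eq[of "{..<n}" k] by simp

lemma tuples_0: "tuples n 0 = {[]}"
  by (auto simp: tuples_def)

lemma sum_tuples_append:
  "(\<Sum>xs\<in>tuples n (j + k). f xs) = (\<Sum>us\<in>tuples n j. \<Sum>vs\<in>tuples n k. f (us @ vs))"
proof -
  have "(\<Sum>us\<in>tuples n j. \<Sum>vs\<in>tuples n k. f (us @ vs)) = (\<Sum>(us, vs)\<in>tuples n j \<times> tuples n k. f (us @ vs))"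
    by (rule sum.cartesian_product)
  also have "\<dots> = (\<Sum>xs\<in>tuples n (j + k). f xs)"
    by (rule sum.reindex_bij_witness[where i = "\<lambda>xs. (take j xs, drop j xs)" and j = "\<lambda>(us, vs). us @ vs"])
       (auto simp: tuples_def dest: in_set_takeD in_set_dropD)
  finally show ?thesis by simp
qed

lemma sum_tuples_Suc:
  "(\<Sum>xs\<in>tuples n (Suc k). f xs) = (\<Sum>vs\<in>tuples n k. \<Sum>w<n. f (w # vs))"
proof -
  have "(\<Sum>vs\<in>tuples n k. \<Sum>w<n. f (w # vs)) = (\<Sum>(vs, w)\<in>tuples n k \<times> {..<n}. f (w # vs))"
    by (rule sum.cartesian_product)
  also have "\<dots> = (\<Sum>xs\<in>tuples n (Suc k). f xs)"
    by (rule sum.reindex_bij_witness[where i = "\<lambda>xs. (tl xs, hd xs)" and j = "\<lambda>(vs, w). w # vs"])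
       (auto simp: tuples_def length_Suc_conv)
  finally show ?thesis by simp
qed

definition tmean :: "nat \<Rightarrow> nat \<Rightarrow> (nat list \<Rightarrow> real) \<Rightarrow> real" where
  "tmean n k f = (\<Sum>xs\<in>tuples n k. f xs) / real n ^ k"

lemma tmean_0: "tmean n 0 f = f []"
  by (simp add: tmean_def tuples_0)

lemma tmean_mono: "(\<And>xs. xs \<in> tuples n k \<Longrightarrow> f xs \<le> g xs) \<Longrightarrow> tmean n k f \<le> tmean n k g"
  unfolding tmean_def by (intro divide_right_mono sum_mono) auto

text \<open>Lists may repeat entries, so a uniform list of length j + k consists of two independent
  uniform lists. This is what allows further revealed vertices to be read as a longer list of
  pins.\<close>

lemma tmean_append: "tmean n (j + k) f = tmean n j (\<lambda>us. tmean n k (\<lambda>vs. f (us @ vs)))"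
  by (simp add: tmean_def sum_tuples_append power_add sum_divide_distrib[symmetric] divide_divide_eq_left mult.commute)

lemma tmean_Suc: "tmean n (Suc k) f = tmean n k (\<lambda>vs. (\<Sum>w<n. f (w # vs)) / real n)"
  by (simp add: tmean_def sum_tuples_Suc sum_divide_distrib[symmetric])

lemma tmean_add: "tmean n k (\<lambda>xs. f xs + g xs) = tmean n k f + tmean n k g"
  by (simp add: tmean_def sum.distrib add_divide_distrib)

lemma tmean_diff: "tmean n k (\<lambda>xs. f xs - g xs) = tmean n k f - tmean n k g"
  by (simp add: tmean_def sum_subtractf diff_divide_distrib)

lemma tmean_cmult: "tmean n k (\<lambda>xs. c * f xs) = c * tmean n k f"
  by (simp add: tmean_def sum_distrib_left)

lemma tmean_divide: "tmean n k (\<lambda>xs. f xs / c) = tmean n k f / c"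
  using tmean_cmult[of n k "1 / c" f] by simp

lemma tmean_const: "n > 0 \<Longrightarrow> tmean n k (\<lambda>_. c) = c"
  by (simp add: tmean_def card_tuples)

lemma tmean_nonneg: "(\<And>xs. xs \<in> tuples n k \<Longrightarrow> f xs \<ge> 0) \<Longrightarrow> tmean n k f \<ge> 0"
  unfolding tmean_def by (intro divide_nonneg_nonneg sum_nonneg) auto

section \<open>Mean error over random pins\<close>

context weighted_configs
begin

definition menergy :: "nat \<Rightarrow> real" where
  "menergy t = tmean n t energy / real n"

lemma menergy_bounds: "0 \<le> menergy t" "menergy t \<le> 1"
proof -
  show "0 \<le> menergy t" unfolding menergy_def by (intro divide_nonneg_nonneg tmean_nonneg energy_nonneg) auto
  show "menergy t \<le> 1"
  proof (cases "n > 0")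
    case True
    have "tmean n t energy \<le> tmean n t (\<lambda>_. real n)" by (intro tmean_mono energy_le)
    with True show ?thesis by (simp add: menergy_def tmean_const)
  next
    case False
    then have "real n = 0" by simp
    then show ?thesis unfolding menergy_def by (simp only: div_by_0 zero_le_one)
  qed
qed

definition merr :: "nat \<Rightarrow> nat \<Rightarrow> real" where
  "merr t k = tmean n t (\<lambda>us. tmean n k (\<lambda>ws. wavg W \<Omega> (err \<Omega> W q us ws)))"

text \<open>The tail of the random list acts as k further pins, so the deviation at its uniform head
  is paid for by the growth of the mean energy from t to t + k pins.\<close>

lemma merr_Suc:
  assumes l: "l > 0" and n: "n > 0"
  shows "merr t (Suc k) \<le> merr t k + l * (menergy (t + k) - menergy t) + real q / l"
proof -
  have e: "wavg W \<Omega> (err \<Omega> W q us (w # ws)) = wavg W \<Omega> (err \<Omega> W q us ws) + wavg W \<Omega> (dev \<Omega> W q us ws w)" for us w ws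
  proof -
    have "wavg W \<Omega> (\<lambda>\<tau>. wavg W (pin \<Omega> us \<tau>) (dev \<Omega> W q us ws w)) = wavg W \<Omega> (dev \<Omega> W q us ws w)"
      using wavg_tower[of us "\<lambda>_. 1" "dev \<Omega> W q us ws w"] by simp
    then show ?thesis by (simp add: wavg_add cong: wavg_cong)
  qed
  have "(\<Sum>w<n. wavg W \<Omega> (err \<Omega> W q us (w # ws))) / real n
      \<le> wavg W \<Omega> (err \<Omega> W q us ws) + (l / real n * (energy (us @ ws) - energy us) + real q / l)" for us ws
  proof -
    have "(\<Sum>w<n. wavg W \<Omega> (err \<Omega> W q us (w # ws)))
        \<le> real n * wavg W \<Omega> (err \<Omega> W q us ws) + (l * (energy (us @ ws) - energy us) + real n * (real q / l))"
      unfolding e using sum_dev_le[OF l, of us ws] by (simp add: sum.distrib)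
    then have "(\<Sum>w<n. wavg W \<Omega> (err \<Omega> W q us (w # ws))) / real n
        \<le> (real n * wavg W \<Omega> (err \<Omega> W q us ws) + (l * (energy (us @ ws) - energy us) + real n * (real q / l))) / real n"
      by (rule divide_right_mono) simp
    also have "\<dots> = wavg W \<Omega> (err \<Omega> W q us ws) + (l / real n * (energy (us @ ws) - energy us) + real q / l)"
      using n l by (simp add: field_simps)
    finally show ?thesis .
  qed
  then have "merr t (Suc k) \<le> tmean n t (\<lambda>us. tmean n k (\<lambda>ws. wavg W \<Omega> (err \<Omega> W q us ws)
      + (l / real n * (energy (us @ ws) - energy us) + real q / l)))"
    unfolding merr_def tmean_Suc by (intro tmean_mono)
  also have "\<dots> = merr t k + l / real n * (tmean n (t + k) energy - tmean n t energy) + real q / l"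
    using n by (simp add: merr_def tmean_add tmean_diff tmean_cmult tmean_const tmean_append tmean_divide)
  also have "\<dots> = merr t k + l * (menergy (t + k) - menergy t) + real q / l"
    by (simp add: menergy_def diff_divide_distrib right_diff_distrib)
  finally show ?thesis .
qed

text \<open>Moving k up by one adds a sum that telescopes in t and is at most 1, because
  \<open>menergy\<close> lies in [0,1].\<close>

lemma sum_menergy_increment: "(\<Sum>t<T. menergy (t + k) - menergy t) \<le> real k"
proof (induction k)
  case (Suc k)
  have "(\<Sum>t<T. menergy (t + Suc k) - menergy t)
      = (\<Sum>t<T. menergy (t + k) - menergy t) + (\<Sum>t<T. menergy (Suc t + k) - menergy (t + k))"
    by (simp add: sum.distrib[symmetric])
  also have "(\<Sum>t<T. menergy (Suc t + k) - menergy (t + k)) = menergy (T + k) - menergy (0 + k)"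
    by (rule sum_lessThan_telescope)
  finally show ?case using Suc menergy_bounds(2)[of "T + k"] menergy_bounds(1)[of k] by simp
qed simp

text \<open>Going from k to k + 1 costs at most l k for the energy and T q / l for the
  linearisation; the former add up to at most l k^2.\<close>

lemma sum_merr_le:
  assumes "l > 0" and "n > 0"
  shows "(\<Sum>t<T. merr t k) \<le> l * (real k)\<^sup>2 + real T * (real k * real q / l)"
proof (induction k)
  case 0
  have "merr t 0 = 0" for t
    using assms by (simp add: merr_def tmean_0 wavg_def tmean_const)
  then show ?case by simp
next
  case (Suc k)
  have "(\<Sum>t<T. merr t (Suc k)) \<le> (\<Sum>t<T. merr t k + l * (menergy (t + k) - menergy t) + real q / l)"
    by (intro sum_mono merr_Suc assms)
  also have "\<dots> = (\<Sum>t<T. merr t k) + l * (\<Sum>t<T. menergy (t + k) - menergy t) + real T * (real q / l)"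
    by (simp add: sum.distrib sum_distrib_left)
  also have "\<dots> \<le> (l * (real k)\<^sup>2 + real T * (real k * real q / l)) + l * real k + real T * (real q / l)"
    using assms by (intro add_mono Suc mult_left_mono sum_menergy_increment) auto
  also have "\<dots> \<le> l * (real (Suc k))\<^sup>2 + real T * (real (Suc k) * real q / l)"
    using assms by (simp add: power2_eq_square field_simps)
  finally show ?case .
qed

end

text \<open>T is fixed before n, the configurations and the weight. This bounds the number of cells
  independently of the graph and permits use on graphs with deleted edges.\<close>

theorem pinning:
  fixes q K :: nat and \<eta> :: real
  assumes "\<eta> > 0"
  shows "\<exists>T>0. \<forall>n>0. \<forall>\<Omega> W k. weighted_configs \<Omega> W q n \<longrightarrow> k \<le> K \<longrightarrow>
    (\<Sum>t<T. tmean n t (\<lambda>us. tmean n k (\<lambda>ws. wavg W \<Omega> (err \<Omega> W q us ws)))) / real T \<le> \<eta>"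
proof -
  \<comment> \<open>Divided by T, the error is at most l K^2 / T + K q / l: \<open>l\<close> brings
    the second term below \<eta>/2, then T the first. The summand 1 keeps \<open>l\<close> positive
    even if K q = 0.\<close>
  define l where "l = 2 * (real K * real q + 1) / \<eta>"
  have l: "l > 0" using assms by (simp add: l_def add_nonneg_pos)
  define T where "T = nat \<lceil>2 * l * (real K)\<^sup>2 / \<eta>\<rceil> + 1"
  have T: "T > 0" by (simp add: T_def)
  have T': "2 * l * (real K)\<^sup>2 / \<eta> \<le> real T" unfolding T_def by linarith
  have b1: "l * (real K)\<^sup>2 / real T \<le> \<eta> / 2"
    using T' T assms by (simp add: field_simps)
  have "real K * real q \<le> \<eta> / 2 * l" using assms by (simp add: l_def)
  then have b2: "real K * real q / l \<le> \<eta> / 2" using l by (simp only: pos_divide_le_eq)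
  have "(\<Sum>t<T. tmean n t (\<lambda>us. tmean n k (\<lambda>ws. wavg W \<Omega> (err \<Omega> W q us ws)))) / real T \<le> \<eta>"
    if n: "n > 0" and w: "weighted_configs \<Omega> W q n" and k: "k \<le> K" for n \<Omega> W k
  proof -
    interpret weighted_configs \<Omega> W q n by (fact w)
    have "(\<Sum>t<T. merr t k) \<le> l * (real k)\<^sup>2 + real T * (real k * real q / l)"
      by (rule sum_merr_le[OF l n])
    also have "\<dots> \<le> l * (real K)\<^sup>2 + real T * (real K * real q / l)"
      using k l by (intro add_mono mult_left_mono divide_right_mono mult_right_mono power_mono) auto
    finally have "(\<Sum>t<T. merr t k) / real T \<le> (l * (real K)\<^sup>2 + real T * (real K * real q / l)) / real T"
      by (rule divide_right_mono) simp
    also have "\<dots> = l * (real K)\<^sup>2 / real T + real K * real q / l"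
      using T by (simp add: add_divide_distrib)
    also have "\<dots> \<le> \<eta>" using add_mono[OF b1 b2] by simp
    finally show ?thesis by (simp add: merr_def)
  qed
  with T show ?thesis by blast
qed

section \<open>Cutting out a set of vertices\<close>

definition edge_factor :: "real \<Rightarrow> nat \<Rightarrow> nat \<Rightarrow> real" where
  "edge_factor \<beta> a b = (if a = b then exp (- \<beta>) else 1)"

lemma edge_factor_bounds: "\<beta> \<ge> 0 \<Longrightarrow> exp (- \<beta>) \<le> edge_factor \<beta> a b"
    "\<beta> \<ge> 0 \<Longrightarrow> edge_factor \<beta> a b \<le> 1" "0 < edge_factor \<beta> a b"
  by (auto simp: edge_factor_def)

lemma finite_all_pairs: "finite (all_pairs n)"
proof (rule finite_subset)
  show "all_pairs n \<subseteq> Pow {..<n}" by (auto simp: all_pairs_def)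
qed simp

lemma finite_cfg: "finite V \<Longrightarrow> finite (cfg V q)"
  unfolding cfg_def by (intro finite_PiE) auto

lemma cfg_nonempty: "q > 0 \<Longrightarrow> cfg V q \<noteq> {}"
  unfolding cfg_def by (auto simp: PiE_eq_empty_iff)

lemma potts_w_pos: "potts_w \<beta> E \<sigma> > 0"
  by (simp add: potts_w_def)

lemma potts_w_le_1: "\<beta> \<ge> 0 \<Longrightarrow> potts_w \<beta> E \<sigma> \<le> 1"
  by (simp add: potts_w_def)

lemma potts_w_empty: "potts_w \<beta> {} \<sigma> = 1"
  by (simp add: potts_w_def mono_count_def)

lemma potts_w_Un:
  assumes "finite E" "finite F" "E \<inter> F = {}"
  shows "potts_w \<beta> (E \<union> F) \<sigma> = potts_w \<beta> E \<sigma> * potts_w \<beta> F \<sigma>"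
proof -
  have "{e \<in> E \<union> F. \<exists>u v. e = {u, v} \<and> \<sigma> u = \<sigma> v}
      = {e \<in> E. \<exists>u v. e = {u, v} \<and> \<sigma> u = \<sigma> v} \<union> {e \<in> F. \<exists>u v. e = {u, v} \<and> \<sigma> u = \<sigma> v}"
    by auto
  then have "mono_count (E \<union> F) \<sigma> = mono_count E \<sigma> + mono_count F \<sigma>"
    unfolding mono_count_def using assms by (simp only:) (rule card_Un_disjoint, auto)
  then show ?thesis by (simp add: potts_w_def exp_add[symmetric] algebra_simps)
qed

lemma potts_w_cong:
  assumes "\<And>e x. e \<in> E \<Longrightarrow> x \<in> e \<Longrightarrow> \<sigma> x = \<tau> x"
  shows "potts_w \<beta> E \<sigma> = potts_w \<beta> E \<tau>"
proof -
  have "(\<exists>u v. e = {u, v} \<and> \<sigma> u = \<sigma> v) \<longleftrightarrow> (\<exists>u v. e = {u, v} \<and> \<tau> u = \<tau> v)" if "e \<in> E" for e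
    using assms[OF that] by (metis insertCI)
  then have "{e \<in> E. \<exists>u v. e = {u, v} \<and> \<sigma> u = \<sigma> v} = {e \<in> E. \<exists>u v. e = {u, v} \<and> \<tau> u = \<tau> v}"
    by blast
  then show ?thesis by (simp add: potts_w_def mono_count_def)
qed

lemma potts_w_edge: "potts_w \<beta> {{u, v}} \<sigma> = edge_factor \<beta> (\<sigma> u) (\<sigma> v)"
proof -
  have "{e \<in> {{u, v}}. \<exists>a b. e = {a, b} \<and> \<sigma> a = \<sigma> b} = (if \<sigma> u = \<sigma> v then {{u, v}} else {})"
    by (auto simp: doubleton_eq_iff)
  then show ?thesis by (simp add: potts_w_def mono_count_def edge_factor_def)
qed

text \<open>Injectivity prevents two indices from describing the same unordered edge, which
  \<open>potts_w\<close> would count only once.\<close>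

lemma potts_w_edges:
  assumes "finite I" and "inj_on (\<lambda>i. {a i, b i}) I"
  shows "potts_w \<beta> ((\<lambda>i. {a i, b i}) ` I) \<sigma> = (\<Prod>i\<in>I. edge_factor \<beta> (\<sigma> (a i)) (\<sigma> (b i)))"
  using assms
proof (induction I)
  case (insert x I)
  have "{{a x, b x}} \<inter> (\<lambda>i. {a i, b i}) ` I = {}" using insert.prems insert.hyps by auto
  then have "potts_w \<beta> ({{a x, b x}} \<union> (\<lambda>i. {a i, b i}) ` I) \<sigma>
      = potts_w \<beta> {{a x, b x}} \<sigma> * potts_w \<beta> ((\<lambda>i. {a i, b i}) ` I) \<sigma>"
    using insert.hyps by (intro potts_w_Un) auto
  with insert show ?case by (simp add: potts_w_edge)
qed (simp add: potts_w_empty)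

lemma weighted_configs_potts:
  assumes "q > 0"
  shows "weighted_configs (cfg {..<n} q) (potts_w \<beta> E) q n"
proof
  show "finite (cfg {..<n} q)" by (simp add: finite_cfg)
  show "cfg {..<n} q \<noteq> {}" using assms by (rule cfg_nonempty)
  show "0 < potts_w \<beta> E \<sigma>" for \<sigma> by (rule potts_w_pos)
  show "\<sigma> u < q" if "\<sigma> \<in> cfg {..<n} q" "u < n" for \<sigma> u
    using that by (auto simp: cfg_def)
qed

lemma Zw_Collect: "finite S \<Longrightarrow> Zw \<beta> E {\<sigma>\<in>S. P \<sigma>} = (\<Sum>\<sigma>\<in>S. potts_w \<beta> E \<sigma> * of_bool (P \<sigma>))"
  unfolding Zw_def by (simp add: of_bool_def sum.inter_filter if_distrib[of "\<lambda>x. _ * x"] cong: if_cong)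

text \<open>With normalisations X for M and Y for N, the difference at t is (\<phi> M - \<phi> N) /
  Y + \<phi> M (Y - X) / (X Y). Summing the second part over t cancels X, so a lower bound for N
  alone suffices and M need only be positive.\<close>

lemma normalized_tv_bound:
  fixes \<phi> N M :: "'a \<Rightarrow> real"
  assumes fin: "finite T" and ne: "T \<noteq> {}" and \<phi>: "\<And>t. t \<in> T \<Longrightarrow> \<phi> t > 0"
    and m: "m > 0" and N: "\<And>t. t \<in> T \<Longrightarrow> N t \<ge> m" and M: "\<And>t. t \<in> T \<Longrightarrow> M t > 0"
    and D: "\<And>t. t \<in> T \<Longrightarrow> \<bar>N t - M t\<bar> \<le> D"
  shows "(\<Sum>t\<in>T. \<bar>\<phi> t * M t / (\<Sum>s\<in>T. \<phi> s * M s) - \<phi> t * N t / (\<Sum>s\<in>T. \<phi> s * N s)\<bar>) \<le> 2 * D / m"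
proof -
  define X where "X = (\<Sum>s\<in>T. \<phi> s * M s)"
  define Y where "Y = (\<Sum>s\<in>T. \<phi> s * N s)"
  define F where "F = (\<Sum>s\<in>T. \<phi> s)"
  have F: "F > 0" unfolding F_def using fin ne \<phi> by (intro sum_pos) auto
  have X: "X > 0" unfolding X_def using fin ne \<phi> M by (intro sum_pos) auto
  have Ym: "Y \<ge> m * F"
    unfolding Y_def F_def sum_distrib_left using N \<phi>
    by (intro sum_mono) (metis mult.commute mult_left_mono less_imp_le)
  then have Y: "Y > 0" using m F by (meson mult_pos_pos less_le_trans)
  have D0: "D \<ge> 0" using ne D by (meson abs_ge_zero all_not_in_conv order_trans)
  have S: "(\<Sum>t\<in>T. \<bar>\<phi> t * M t - \<phi> t * N t\<bar>) \<le> D * F"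
    unfolding F_def sum_distrib_left
  proof (rule sum_mono)
    fix t assume t: "t \<in> T"
    have "\<bar>\<phi> t * M t - \<phi> t * N t\<bar> = \<phi> t * \<bar>N t - M t\<bar>"
      using \<phi>[OF t] by (simp add: right_diff_distrib[symmetric] abs_mult abs_minus_commute)
    also have "\<dots> \<le> \<phi> t * D" using \<phi>[OF t] D[OF t] by (intro mult_left_mono) auto
    finally show "\<bar>\<phi> t * M t - \<phi> t * N t\<bar> \<le> D * \<phi> t" by (simp add: mult.commute)
  qed
  have XY: "\<bar>Y - X\<bar> \<le> D * F"
  proof -
    have "\<bar>Y - X\<bar> = \<bar>\<Sum>t\<in>T. \<phi> t * M t - \<phi> t * N t\<bar>"
      unfolding X_def Y_def by (simp add: sum_subtractf abs_minus_commute)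
    also have "\<dots> \<le> (\<Sum>t\<in>T. \<bar>\<phi> t * M t - \<phi> t * N t\<bar>)" by (rule sum_abs)
    finally show ?thesis using S by simp
  qed
  have "(\<Sum>t\<in>T. \<bar>\<phi> t * M t / X - \<phi> t * N t / Y\<bar>)
      \<le> (\<Sum>t\<in>T. \<bar>\<phi> t * M t - \<phi> t * N t\<bar> / Y + \<phi> t * M t * (\<bar>Y - X\<bar> / (X * Y)))"
  proof (rule sum_mono)
    fix t assume t: "t \<in> T"
    have "\<phi> t * M t / X - \<phi> t * N t / Y = (\<phi> t * M t - \<phi> t * N t) / Y + \<phi> t * M t * ((Y - X) / (X * Y))"
      using X Y by (simp add: field_simps)
    also have "\<bar>\<dots>\<bar> \<le> \<bar>(\<phi> t * M t - \<phi> t * N t) / Y\<bar> + \<bar>\<phi> t * M t * ((Y - X) / (X * Y))\<bar>"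
      by (rule abs_triangle_ineq)
    also have "\<dots> = \<bar>\<phi> t * M t - \<phi> t * N t\<bar> / Y + \<phi> t * M t * (\<bar>Y - X\<bar> / (X * Y))"
      using X Y \<phi>[OF t] M[OF t] by (simp add: abs_mult)
    finally show "\<bar>\<phi> t * M t / X - \<phi> t * N t / Y\<bar>
      \<le> \<bar>\<phi> t * M t - \<phi> t * N t\<bar> / Y + \<phi> t * M t * (\<bar>Y - X\<bar> / (X * Y))" .
  qed
  also have "\<dots> = (\<Sum>t\<in>T. \<bar>\<phi> t * M t - \<phi> t * N t\<bar>) / Y + X * (\<bar>Y - X\<bar> / (X * Y))"
    by (simp add: sum.distrib sum_divide_distrib X_def sum_distrib_right)
  also have "\<dots> = ((\<Sum>t\<in>T. \<bar>\<phi> t * M t - \<phi> t * N t\<bar>) + \<bar>Y - X\<bar>) / Y"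
    using X Y by (simp add: add_divide_distrib)
  also have "\<dots> \<le> (2 * (D * F)) / Y"
    using S XY Y by (intro divide_right_mono) auto
  also have "\<dots> \<le> (2 * (D * F)) / (m * F)"
    using Ym Y m F D0 by (intro divide_left_mono) auto
  also have "\<dots> = 2 * D / m" using F by simp
  finally show ?thesis unfolding X_def Y_def .
qed

lemma normalized_sum_le_1:
  fixes x :: "'a \<Rightarrow> real"
  assumes "\<And>t. t \<in> T \<Longrightarrow> x t \<ge> 0"
  shows "(\<Sum>t\<in>T. x t / (\<Sum>s\<in>T. x s)) \<le> 1"
  by (simp add: sum_divide_distrib[symmetric] divide_le_eq_1 sum_nonneg assms)

text \<open>B is the inside and \<open>es\<close> lists the edges leaving it, oriented outwards; a
  list of edges rather than a set of outer vertices, since two cut edges may share one. The pins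
  avoid B, so recolouring B never leaves the cell.\<close>

locale vertex_cut =
  fixes n q :: nat and \<beta> :: real and E :: "nat set set" and B :: "nat set"
    and es :: "(nat \<times> nat) list" and us :: "nat list" and \<tau>0 :: "nat \<Rightarrow> nat"
  assumes q: "q > 0" and beta: "\<beta> > 0" and E: "E \<subseteq> all_pairs n" and B: "B \<subseteq> {..<n}"
    and dist: "distinct es"
    and set_es: "set es = {(v, w). v \<in> B \<and> w \<in> {..<n} - B \<and> {v, w} \<in> E}"
    and us: "set us \<inter> B = {}" and \<tau>0: "\<tau>0 \<in> cfg {..<n} q"
begin

section \<open>Independence of inside and outside\<close>

abbreviation "k \<equiv> length es"
abbreviation "near i \<equiv> fst (es ! i)"
abbreviation "far i \<equiv> snd (es ! i)"

definition cut_edge :: "nat \<Rightarrow> nat set" where "cut_edge i = {near i, far i}"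
definition "E0 = E - cut_edge ` {..<k}"
definition "S = pin (cfg {..<n} q) us \<tau>0"
definition "W0 = potts_w \<beta> E0"
definition "\<phi> = potts_w \<beta> (induced E B)"
definition "fibre \<tau> = {\<sigma>\<in>S. restrict \<sigma> B = \<tau>}"

sublocale weighted_configs "cfg {..<n} q" W0 q n
  unfolding W0_def using q by (rule weighted_configs_potts)

lemma finite_S: "finite S"
  unfolding S_def by (rule finite_pin)

lemma W0_pos: "W0 \<sigma> > 0"
  by (simp add: W0_def potts_w_pos)

lemma es_nth: "i < k \<Longrightarrow> near i \<in> B \<and> far i < n \<and> far i \<notin> B \<and> cut_edge i \<in> E"
  using nth_mem[of i es] set_es by (auto simp: cut_edge_def split: prod.splits)

text \<open>Exactly one end lies in B, so the unordered edge determines its orientation.\<close>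

lemma inj_cut_edge: "inj_on cut_edge {..<k}"
proof (rule inj_onI)
  fix i j assume ij: "i \<in> {..<k}" "j \<in> {..<k}" "cut_edge i = cut_edge j"
  then have "near i = near j \<and> far i = far j"
    using es_nth[of i] es_nth[of j] by (auto simp: cut_edge_def doubleton_eq_iff)
  then have "es ! i = es ! j" by (simp add: prod_eq_iff)
  with ij dist show "i = j" by (simp add: nth_eq_iff_index_eq)
qed

lemma finite_E: "finite E"
  using E finite_all_pairs by (rule finite_subset)

definition "rest = E0 - induced E B"

text \<open>An edge with both ends in B is induced and one with a single end in B is a cut edge, so
  no remaining edge touches B.\<close>

lemma rest_outside: "e \<in> rest \<Longrightarrow> x \<in> e \<Longrightarrow> x \<notin> B"
proof
  assume e: "e \<in> rest" and x: "x \<in> e" "x \<in> B"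
  have eE: "e \<in> E" "e \<notin> induced E B" "e \<notin> cut_edge ` {..<k}" using e by (auto simp: rest_def E0_def)
  then obtain y where y: "e = {x, y}" "y < n" using E x(1) by (auto simp: all_pairs_def)
  show False
  proof (cases "y \<in> B")
    case True
    then show False using eE x y by (auto simp: induced_def)
  next
    case False
    then have "(x, y) \<in> set es" using x y eE by (auto simp: set_es)
    then obtain i where "i < k" "es ! i = (x, y)" by (auto simp: in_set_conv_nth)
    then have "e \<in> cut_edge ` {..<k}" using y by (auto simp: cut_edge_def intro!: image_eqI[of _ _ i])
    then show False using eE by simp
  qed
qed

text \<open>Edges inside B are kept exactly, cycles included; the weight splits since only edges
  across the boundary were removed.\<close>

lemma W0_eq: "W0 \<sigma> = \<phi> \<sigma> * potts_w \<beta> rest \<sigma>"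
proof -
  have "induced E B \<subseteq> E0"
    using es_nth by (auto simp: E0_def induced_def cut_edge_def)
  then have "E0 = induced E B \<union> rest" by (auto simp: rest_def)
  moreover have "potts_w \<beta> (induced E B \<union> rest) \<sigma> = \<phi> \<sigma> * potts_w \<beta> rest \<sigma>"
    unfolding \<phi>_def using finite_E by (intro potts_w_Un) (auto simp: rest_def E0_def induced_def)
  ultimately show ?thesis by (simp add: W0_def)
qed

lemma \<phi>_restrict: "restrict \<sigma> B = \<tau> \<Longrightarrow> \<phi> \<sigma> = \<phi> \<tau>"
  unfolding \<phi>_def by (intro potts_w_cong) (auto simp: induced_def)

definition off_B :: "((nat \<Rightarrow> nat) \<Rightarrow> real) \<Rightarrow> bool" where
  "off_B h \<longleftrightarrow> (\<forall>\<sigma> \<sigma>'. (\<forall>x. x \<notin> B \<longrightarrow> \<sigma> x = \<sigma>' x) \<longrightarrow> h \<sigma> = h \<sigma>')"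

lemma off_BD: "off_B h \<Longrightarrow> (\<And>x. x \<notin> B \<Longrightarrow> \<sigma> x = \<sigma>' x) \<Longrightarrow> h \<sigma> = h \<sigma>'"
  unfolding off_B_def by blast

definition "outer_sum \<tau> h = (\<Sum>\<sigma>\<in>fibre \<tau>. potts_w \<beta> rest \<sigma> * h \<sigma>)"

lemma override_fibre:
  assumes "\<sigma> \<in> fibre \<tau>" "\<tau>' \<in> cfg B q"
  shows "override_on \<sigma> \<tau>' B \<in> fibre \<tau>'"
proof -
  have \<sigma>: "\<sigma> \<in> cfg {..<n} q" "map \<sigma> us = map \<tau>0 us" using assms by (auto simp: fibre_def S_def pin_def)
  have "override_on \<sigma> \<tau>' B \<in> cfg {..<n} q"
    using \<sigma>(1) assms(2) B unfolding cfg_def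
    by (intro PiE_I) (auto simp: override_on_def PiE_iff extensional_def)
  moreover have "map (override_on \<sigma> \<tau>' B) us = map \<sigma> us"
    using us by (auto simp: override_on_def)
  moreover have "restrict (override_on \<sigma> \<tau>' B) B = \<tau>'"
    using assms(2) by (auto simp: override_on_def cfg_def PiE_iff extensional_def restrict_def fun_eq_iff)
  ultimately show ?thesis using \<sigma> by (simp add: fibre_def S_def pin_def)
qed

lemma override_fibre_inverse:
  assumes "\<sigma> \<in> fibre \<tau>"
  shows "override_on (override_on \<sigma> \<tau>' B) \<tau> B = \<sigma>"
proof
  fix x
  have "restrict \<sigma> B x = \<tau> x" using assms by (auto simp: fibre_def)
  then show "override_on (override_on \<sigma> \<tau>' B) \<tau> B x = \<sigma> x"
    by (auto simp: override_on_def)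
qed

text \<open>Recolouring B is a bijection between fibres that changes neither the weight of
  \<open>rest\<close> nor h: without the cut edges the spins on B are independent of the
  others.\<close>

lemma outer_sum_eq:
  assumes h: "off_B h" and "\<tau> \<in> cfg B q" "\<tau>' \<in> cfg B q"
  shows "outer_sum \<tau> h = outer_sum \<tau>' h"
  unfolding outer_sum_def
proof (rule sum.reindex_bij_witness[where i = "\<lambda>\<sigma>. override_on \<sigma> \<tau> B" and j = "\<lambda>\<sigma>. override_on \<sigma> \<tau>' B"])
  fix \<sigma> assume \<sigma>: "\<sigma> \<in> fibre \<tau>"
  have "potts_w \<beta> rest (override_on \<sigma> \<tau>' B) = potts_w \<beta> rest \<sigma>"
    using rest_outside by (intro potts_w_cong) (auto simp: override_on_def)
  moreover have "h (override_on \<sigma> \<tau>' B) = h \<sigma>"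
    by (rule off_BD[OF h]) (auto simp: override_on_def)
  ultimately show "potts_w \<beta> rest (override_on \<sigma> \<tau>' B) * h (override_on \<sigma> \<tau>' B) = potts_w \<beta> rest \<sigma> * h \<sigma>"
    by simp
qed (auto intro: override_fibre override_fibre_inverse assms)

lemma sum_fibres: "(\<Sum>\<sigma>\<in>S. f \<sigma>) = (\<Sum>\<tau>\<in>cfg B q. \<Sum>\<sigma>\<in>fibre \<tau>. f \<sigma>)"
proof -
  have "(\<lambda>\<sigma>. restrict \<sigma> B) ` S \<subseteq> cfg B q"
    using B by (auto simp: S_def pin_def cfg_def PiE_iff)
  moreover have "finite (cfg B q)" using B finite_subset by (intro finite_cfg) blast
  ultimately show ?thesis unfolding fibre_def by (simp only: sum.group[OF finite_S])
qed

text \<open>An arbitrary reference colouring of B; \<open>outer_sum\<close> takes the same value at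
  any other one for functions satisfying \<open>off_B\<close>.\<close>

definition "\<tau>B = restrict \<tau>0 B"

lemma \<tau>B: "\<tau>B \<in> cfg B q"
  using \<tau>0 B by (auto simp: \<tau>B_def cfg_def PiE_iff)

definition "A = outer_sum \<tau>B (\<lambda>_. 1)"

lemma A_pos: "A > 0"
proof -
  have "\<tau>0 \<in> fibre \<tau>B" using \<tau>0 by (auto simp: fibre_def S_def pin_def \<tau>B_def)
  then show ?thesis unfolding A_def outer_sum_def using finite_S
    by (intro sum_pos) (auto simp: potts_w_pos fibre_def)
qed

lemma finite_cfg_B: "finite (cfg B q)"
  using B finite_subset by (intro finite_cfg) blast

lemma sum_\<phi>_pos: "(\<Sum>\<tau>\<in>cfg B q. \<phi> \<tau>) > 0"
  using finite_cfg_B \<tau>B by (intro sum_pos) (auto simp: \<phi>_def potts_w_pos)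

lemma fibre_sum_raw:
  assumes h: "off_B h" and \<tau>: "\<tau> \<in> cfg B q"
  shows "(\<Sum>\<sigma>\<in>fibre \<tau>. W0 \<sigma> * h \<sigma>) = \<phi> \<tau> * outer_sum \<tau>B h"
proof -
  have "(\<Sum>\<sigma>\<in>fibre \<tau>. W0 \<sigma> * h \<sigma>) = (\<Sum>\<sigma>\<in>fibre \<tau>. \<phi> \<tau> * (potts_w \<beta> rest \<sigma> * h \<sigma>))"
    using \<phi>_restrict by (intro sum.cong refl) (auto simp: W0_eq fibre_def)
  also have "\<dots> = \<phi> \<tau> * outer_sum \<tau> h" by (simp add: outer_sum_def sum_distrib_left)
  finally show ?thesis using outer_sum_eq[OF h \<tau> \<tau>B] by simp
qed

text \<open>By independence, the mean over one fibre equals the mean over the whole cell, and it is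
  for cells that pinning gives factorisation.\<close>

lemma outer_sum_wavg:
  assumes h: "off_B h"
  shows "outer_sum \<tau>B h = A * wavg W0 S h"
proof -
  have 1: "off_B (\<lambda>_. 1)" by (simp add: off_B_def)
  have "(\<Sum>\<sigma>\<in>S. W0 \<sigma> * h \<sigma>) = (\<Sum>\<tau>\<in>cfg B q. \<phi> \<tau>) * outer_sum \<tau>B h"
    unfolding sum_fibres sum_distrib_right by (intro sum.cong refl fibre_sum_raw h)
  moreover have "(\<Sum>\<sigma>\<in>S. W0 \<sigma>) = (\<Sum>\<tau>\<in>cfg B q. \<phi> \<tau>) * A"
    unfolding sum_fibres sum_distrib_right A_def using fibre_sum_raw[OF 1] by (intro sum.cong refl) auto
  ultimately show ?thesis using A_pos sum_\<phi>_pos by (simp add: wavg_def)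
qed

definition "joined J = E0 \<union> cut_edge ` J"

lemma potts_w_joined:
  assumes J: "J \<subseteq> {..<k}"
  shows "potts_w \<beta> (joined J) \<sigma> = W0 \<sigma> * (\<Prod>i\<in>J. edge_factor \<beta> (\<sigma> (near i)) (\<sigma> (far i)))"
proof -
  have fin: "finite J" using J finite_subset by blast
  have "potts_w \<beta> (E0 \<union> cut_edge ` J) \<sigma> = potts_w \<beta> E0 \<sigma> * potts_w \<beta> (cut_edge ` J) \<sigma>"
    using fin finite_E J by (intro potts_w_Un) (auto simp: E0_def)
  also have "potts_w \<beta> (cut_edge ` J) \<sigma> = (\<Prod>i\<in>J. edge_factor \<beta> (\<sigma> (near i)) (\<sigma> (far i)))"
    using potts_w_edges[OF fin, of near far \<beta> \<sigma>] inj_on_subset[OF inj_cut_edge J]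
    by (simp add: cut_edge_def[abs_def])
  finally show ?thesis by (simp add: joined_def W0_def)
qed

text \<open>Up to a constant, \<open>\<phi> \<tau> * N J \<tau>\<close> is the weight of the colouring \<open>\<tau>\<close> of \<open>B\<close> when only the cut edges in
  \<open>J\<close> are present. Below, \<open>\<Gamma>\<close> and \<open>M\<close> are its product approximations by marginals without the cut
  edges and by messages; \<open>J = {..<k} - {j}\<close> gives the messages along the edge \<open>j\<close>.\<close>
definition "factors J \<tau> \<sigma> = (\<Prod>i\<in>J. edge_factor \<beta> (\<tau> (near i)) (\<sigma> (far i)))"
definition "N J \<tau> = wavg W0 S (factors J \<tau>)"

text \<open>On a fibre the inner ends of the cut edges carry the fixed colours of \<tau>, so
  restoring the edges in J multiplies the weight by a function of the outer spins alone.\<close>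

lemma sum_fibre_joined:
  assumes J: "J \<subseteq> {..<k}" and h: "off_B h" and \<tau>: "\<tau> \<in> cfg B q"
  shows "(\<Sum>\<sigma>\<in>fibre \<tau>. potts_w \<beta> (joined J) \<sigma> * h \<sigma>) = A * (\<phi> \<tau> * wavg W0 S (\<lambda>\<sigma>. factors J \<tau> \<sigma> * h \<sigma>))"
proof -
  have off: "off_B (\<lambda>\<sigma>. factors J \<tau> \<sigma> * h \<sigma>)"
    unfolding off_B_def
  proof (intro allI impI)
    fix \<sigma> \<sigma>' :: "nat \<Rightarrow> nat" assume eq: "\<forall>x. x \<notin> B \<longrightarrow> \<sigma> x = \<sigma>' x"
    have "\<sigma> (far i) = \<sigma>' (far i)" if "i \<in> J" for i
      using es_nth[of i] that J eq by blast
    then have "factors J \<tau> \<sigma> = factors J \<tau> \<sigma>'" unfolding factors_def by (intro prod.cong) auto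
    moreover have "h \<sigma> = h \<sigma>'" using eq by (intro off_BD[OF h]) auto
    ultimately show "factors J \<tau> \<sigma> * h \<sigma> = factors J \<tau> \<sigma>' * h \<sigma>'" by simp
  qed
  have "potts_w \<beta> (joined J) \<sigma> * h \<sigma> = W0 \<sigma> * (factors J \<tau> \<sigma> * h \<sigma>)" if "\<sigma> \<in> fibre \<tau>" for \<sigma>
  proof -
    have "\<sigma> (near i) = \<tau> (near i)" if "i \<in> J" for i
    proof -
      have "near i \<in> B" using es_nth that J by blast
      moreover have "restrict \<sigma> B = \<tau>" using \<open>\<sigma> \<in> fibre \<tau>\<close> by (simp add: fibre_def)
      ultimately show ?thesis by auto
    qed
    then have "(\<Prod>i\<in>J. edge_factor \<beta> (\<sigma> (near i)) (\<sigma> (far i))) = factors J \<tau> \<sigma>"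
      unfolding factors_def by (intro prod.cong) auto
    then show ?thesis by (simp add: potts_w_joined[OF J] mult.assoc)
  qed
  then have "(\<Sum>\<sigma>\<in>fibre \<tau>. potts_w \<beta> (joined J) \<sigma> * h \<sigma>) = (\<Sum>\<sigma>\<in>fibre \<tau>. W0 \<sigma> * (factors J \<tau> \<sigma> * h \<sigma>))"
    by (rule sum.cong[OF refl])
  also have "\<dots> = \<phi> \<tau> * outer_sum \<tau>B (\<lambda>\<sigma>. factors J \<tau> \<sigma> * h \<sigma>)" by (rule fibre_sum_raw[OF off \<tau>])
  finally show ?thesis by (simp add: outer_sum_wavg[OF off])
qed

lemma off_B_1: "off_B (\<lambda>_. 1)"
  by (simp add: off_B_def)

lemma Zw_fibre_joined:
  assumes "J \<subseteq> {..<k}" "\<tau> \<in> cfg B q"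
  shows "Zw \<beta> (joined J) {\<sigma>\<in>S. restrict \<sigma> B = \<tau>} = A * (\<phi> \<tau> * N J \<tau>)"
  using sum_fibre_joined[OF assms(1) off_B_1 assms(2)] by (simp add: Zw_def fibre_def[symmetric] N_def)

lemma Zw_joined:
  assumes "J \<subseteq> {..<k}"
  shows "Zw \<beta> (joined J) S = A * (\<Sum>\<tau>\<in>cfg B q. \<phi> \<tau> * N J \<tau>)"
proof -
  have "Zw \<beta> (joined J) S = (\<Sum>\<tau>\<in>cfg B q. Zw \<beta> (joined J) {\<sigma>\<in>S. restrict \<sigma> B = \<tau>})"
    unfolding Zw_def fibre_def[symmetric] by (rule sum_fibres)
  then show ?thesis by (simp add: Zw_fibre_joined assms sum_distrib_left)
qed

lemma margU_joined:
  assumes "J \<subseteq> {..<k}" "\<tau> \<in> cfg B q"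
  shows "margU \<beta> (joined J) S B \<tau> = \<phi> \<tau> * N J \<tau> / (\<Sum>\<tau>\<in>cfg B q. \<phi> \<tau> * N J \<tau>)"
  unfolding margU_def using Zw_fibre_joined[OF assms] Zw_joined[OF assms(1)] A_pos by simp

section \<open>Factorising the outer spins\<close>

definition "\<delta> = err (cfg {..<n} q) W0 q us (map snd es) \<tau>0"
definition "p i c = marg W0 S (far i) c"
text \<open>The product of edge factors when all k cut edges are monochromatic, its worst case; it
  bounds all denominators from below.\<close>

definition "m = exp (- \<beta> * real k)"

lemma m_pos: "m > 0" by (simp add: m_def)

lemma S_nonempty: "S \<noteq> {}"
  using \<tau>0 by (auto simp: S_def pin_def)

lemma factors_ge: "J \<subseteq> {..<k} \<Longrightarrow> factors J \<tau> \<sigma> \<ge> m"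
proof -
  assume J: "J \<subseteq> {..<k}"
  have "m \<le> exp (- \<beta>) ^ card J"
    using card_mono[OF _ J] beta by (simp add: m_def exp_of_nat_mult[symmetric] mult.commute)
  also have "\<dots> = (\<Prod>i\<in>J. exp (- \<beta>))" by simp
  also have "\<dots> \<le> factors J \<tau> \<sigma>"
    unfolding factors_def using beta by (intro prod_mono) (auto simp: edge_factor_bounds)
  finally show ?thesis .
qed

lemma N_ge: "J \<subseteq> {..<k} \<Longrightarrow> N J \<tau> \<ge> m"
proof -
  assume J: "J \<subseteq> {..<k}"
  have "wavg W0 S (\<lambda>_. m) \<le> N J \<tau>"
    unfolding N_def using J by (intro wavg_mono finite_S factors_ge W0_pos)
  then show ?thesis using finite_S S_nonempty W0_pos by (simp add: wavg_const)
qed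

lemma wavg_edge_factor:
  "wavg W0 S (\<lambda>\<sigma>. edge_factor \<beta> c (\<sigma> (far i))) = 1 - (1 - exp (- \<beta>)) * p i c"
proof -
  have "edge_factor \<beta> c b = 1 - (1 - exp (- \<beta>)) * of_bool (b = c)" for b
    by (simp add: edge_factor_def)
  then show ?thesis
    using finite_S S_nonempty W0_pos by (simp add: wavg_diff wavg_cmult wavg_const p_def marg_def)
qed

definition "\<Gamma> J \<tau> = (\<Prod>i\<in>J. 1 - (1 - exp (- \<beta>)) * p i (\<tau> (near i)))"

lemma product_err:
  assumes "\<And>i c. 0 \<le> h i c \<and> h i c \<le> 1"
  shows "\<bar>wavg W0 S (\<lambda>\<sigma>. \<Prod>i<k. h i (\<sigma> (far i))) - (\<Prod>i<k. wavg W0 S (\<lambda>\<sigma>. h i (\<sigma> (far i))))\<bar> \<le> \<delta>"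
proof -
  have "set (map snd es) \<subseteq> {..<n}" using set_es by auto
  from wavg_product_err[OF \<tau>0 this, of h us] assms
  have *: "\<bar>wavg W0 S (\<lambda>\<sigma>. \<Prod>i<k. h i (\<sigma> (map snd es ! i))) - (\<Prod>i<k. wavg W0 S (\<lambda>\<sigma>. h i (\<sigma> (map snd es ! i))))\<bar> \<le> \<delta>"
    by (simp only: S_def[symmetric] \<delta>_def length_map simp_thms)
  have 1: "(\<Prod>i<k. h i (\<sigma> (map snd es ! i))) = (\<Prod>i<k. h i (\<sigma> (far i)))" for \<sigma>
    by (intro prod.cong refl) simp
  have 2: "(\<Prod>i<k. wavg W0 S (\<lambda>\<sigma>. h i (\<sigma> (map snd es ! i)))) = (\<Prod>i<k. wavg W0 S (\<lambda>\<sigma>. h i (\<sigma> (far i))))"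
    by (intro prod.cong refl) simp
  show ?thesis using * unfolding 1 2 .
qed

text \<open>Positions outside J are padded with the factor 1, so that the single error \<delta> of
  the full list of outer vertices serves every J.\<close>

lemma N_approx:
  assumes J: "J \<subseteq> {..<k}"
  shows "\<bar>N J \<tau> - \<Gamma> J \<tau>\<bar> \<le> \<delta>"
proof -
  define h where "h i c = (if i \<in> J then edge_factor \<beta> (\<tau> (near i)) c else 1)" for i c
  have restr: "(\<Prod>i<k. if i \<in> J then f i else 1) = (\<Prod>i\<in>J. f i)" for f :: "nat \<Rightarrow> real"
    using J by (simp add: prod.inter_restrict[symmetric] Int_absorb1)
  have 1: "(\<Prod>i<k. h i (\<sigma> (far i))) = factors J \<tau> \<sigma>" for \<sigma>
    unfolding h_def factors_def by (rule restr)
  have "(\<Prod>i<k. wavg W0 S (\<lambda>\<sigma>. h i (\<sigma> (far i)))) = (\<Prod>i<k. if i \<in> J then 1 - (1 - exp (- \<beta>)) * p i (\<tau> (near i)) else 1)"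
    using finite_S S_nonempty W0_pos by (intro prod.cong refl) (simp add: h_def wavg_edge_factor wavg_const)
  also have "\<dots> = \<Gamma> J \<tau>" unfolding \<Gamma>_def by (rule restr)
  finally have 2: "(\<Prod>i<k. wavg W0 S (\<lambda>\<sigma>. h i (\<sigma> (far i)))) = \<Gamma> J \<tau>" .
  have "0 \<le> h i c \<and> h i c \<le> 1" for i c
    using beta by (auto simp: h_def edge_factor_bounds less_imp_le)
  from product_err[of h, OF this] show ?thesis unfolding 1 2 N_def by simp
qed

text \<open>The position of the missing edge j is free to carry the indicator of the spin at its
  outer end.\<close>

lemma N_joint_approx:
  assumes j: "j < k" and J: "J = {..<k} - {j}"
  shows "\<bar>wavg W0 S (\<lambda>\<sigma>. factors J \<tau> \<sigma> * of_bool (\<sigma> (far j) = c)) - \<Gamma> J \<tau> * p j c\<bar> \<le> \<delta>"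
proof -
  define h where "h i b = (if i = j then of_bool (b = c) else edge_factor \<beta> (\<tau> (near i)) b)" for i b
  have 1: "(\<Prod>i<k. h i (\<sigma> (far i))) = factors J \<tau> \<sigma> * of_bool (\<sigma> (far j) = c)" for \<sigma>
  proof -
    have "(\<Prod>i<k. h i (\<sigma> (far i))) = h j (\<sigma> (far j)) * (\<Prod>i\<in>J. h i (\<sigma> (far i)))"
      unfolding J using j by (intro prod.remove) auto
    also have "(\<Prod>i\<in>J. h i (\<sigma> (far i))) = factors J \<tau> \<sigma>"
      unfolding factors_def by (intro prod.cong refl) (auto simp: h_def J)
    finally show ?thesis by (simp add: h_def)
  qed
  have 2: "(\<Prod>i<k. wavg W0 S (\<lambda>\<sigma>. h i (\<sigma> (far i)))) = \<Gamma> J \<tau> * p j c"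
  proof -
    have "(\<Prod>i<k. wavg W0 S (\<lambda>\<sigma>. h i (\<sigma> (far i))))
        = wavg W0 S (\<lambda>\<sigma>. h j (\<sigma> (far j))) * (\<Prod>i\<in>J. wavg W0 S (\<lambda>\<sigma>. h i (\<sigma> (far i))))"
      unfolding J using j by (intro prod.remove) auto
    also have "(\<Prod>i\<in>J. wavg W0 S (\<lambda>\<sigma>. h i (\<sigma> (far i)))) = \<Gamma> J \<tau>"
      unfolding \<Gamma>_def by (intro prod.cong refl) (auto simp: h_def J wavg_edge_factor)
    finally show ?thesis by (simp add: h_def p_def marg_def)
  qed
  have "0 \<le> h i c \<and> h i c \<le> 1" for i c
    using beta by (auto simp: h_def edge_factor_bounds less_imp_le)
  from product_err[of h, OF this] show ?thesis unfolding 1 2 .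
qed

lemma p_bounds: "0 \<le> p i c" "p i c \<le> 1"
proof -
  show "0 \<le> p i c" unfolding p_def S_def by (rule marg_nonneg)
  have "p i c \<le> wavg W0 S (\<lambda>_. 1)" unfolding p_def marg_def by (intro wavg_mono finite_S W0_pos) auto
  then show "p i c \<le> 1" using finite_S S_nonempty W0_pos by (simp add: wavg_const)
qed

lemma joined_all: "joined {..<k} = E"
  using es_nth by (auto simp: joined_def E0_def)

lemma joined_remove: "j < k \<Longrightarrow> joined ({..<k} - {j}) = E - {cut_edge j}"
proof -
  assume j: "j < k"
  have "cut_edge i \<noteq> cut_edge j" if "i < k" "i \<noteq> j" for i
    using inj_onD[OF inj_cut_edge, of i j] that j by auto
  then show ?thesis using es_nth j by (auto simp: joined_def E0_def)
qed

definition "message i c = msg \<beta> E S (far i) (near i) c"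

lemma \<delta>_nonneg: "\<delta> \<ge> 0"
  unfolding \<delta>_def by (rule err_nonneg)

text \<open>Restoring the other cut edges reweights the cell by a quantity almost uncorrelated with
  the spin at \<open>far j\<close>, so this spin keeps almost the same law.\<close>

lemma message_approx:
  assumes j: "j < k"
  shows "\<bar>message j c - p j c\<bar> \<le> 2 * \<delta> / m"
proof -
  define J where "J = {..<k} - {j}"
  have J: "J \<subseteq> {..<k}" by (auto simp: J_def)
  let ?h = "\<lambda>\<sigma>. of_bool (\<sigma> (far j) = c) :: real"
  let ?x = "\<lambda>\<tau>. wavg W0 S (\<lambda>\<sigma>. factors J \<tau> \<sigma> * ?h \<sigma>)"
  define num where "num = (\<Sum>\<tau>\<in>cfg B q. \<phi> \<tau> * ?x \<tau>)"
  define den where "den = (\<Sum>\<tau>\<in>cfg B q. \<phi> \<tau> * N J \<tau>)"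
  define F where "F = (\<Sum>\<tau>\<in>cfg B q. \<phi> \<tau>)"
  have F: "F > 0" unfolding F_def by (rule sum_\<phi>_pos)
  have h: "off_B ?h" using es_nth[OF j] by (auto simp: off_B_def)
  have "Zw \<beta> (joined J) {\<sigma>\<in>S. \<sigma> (far j) = c} = (\<Sum>\<sigma>\<in>S. potts_w \<beta> (joined J) \<sigma> * ?h \<sigma>)"
    by (rule Zw_Collect[OF finite_S])
  also have "\<dots> = A * num"
    unfolding sum_fibres num_def sum_distrib_left by (intro sum.cong refl sum_fibre_joined J h)
  finally have n: "Zw \<beta> (joined J) {\<sigma>\<in>S. \<sigma> (far j) = c} = A * num" .
  have d: "Zw \<beta> (joined J) S = A * den" unfolding den_def by (rule Zw_joined[OF J])
  have "message j c = num / den"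
    using n d A_pos joined_remove[OF j]
    by (simp add: message_def msg_def marg1_def J_def[symmetric] cut_edge_def)
  moreover have den: "den \<ge> m * F"
    unfolding den_def F_def sum_distrib_left using N_ge[OF J]
    by (intro sum_mono) (simp add: mult.commute[of m] mult_left_mono \<phi>_def potts_w_pos less_imp_le)
  \<comment> \<open>Both sides are compared term by term with
    \<open>\<Gamma> J \<tau> * p j c\<close>, each at cost \<delta>; this is the origin of the
    factor 2.\<close>
  moreover have "\<bar>num - p j c * den\<bar> \<le> 2 * \<delta> * F"
  proof -
    have "num - p j c * den = (\<Sum>\<tau>\<in>cfg B q. \<phi> \<tau> * (?x \<tau> - p j c * N J \<tau>))"
      unfolding num_def den_def by (simp add: sum_distrib_left sum_subtractf algebra_simps)
    then have "\<bar>num - p j c * den\<bar> \<le> (\<Sum>\<tau>\<in>cfg B q. \<bar>\<phi> \<tau> * (?x \<tau> - p j c * N J \<tau>)\<bar>)"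
      by (simp only: sum_abs)
    also have "\<dots> \<le> (\<Sum>\<tau>\<in>cfg B q. 2 * \<delta> * \<phi> \<tau>)"
    proof (rule sum_mono)
      fix \<tau>
      have a: "\<bar>?x \<tau> - \<Gamma> J \<tau> * p j c\<bar> \<le> \<delta>" by (rule N_joint_approx[OF j J_def])
      have "\<bar>p j c * (N J \<tau> - \<Gamma> J \<tau>)\<bar> \<le> \<bar>N J \<tau> - \<Gamma> J \<tau>\<bar>" by (intro abs_mult_le_one p_bounds)
      also have "\<dots> \<le> \<delta>" by (rule N_approx[OF J])
      finally have b: "\<bar>p j c * N J \<tau> - \<Gamma> J \<tau> * p j c\<bar> \<le> \<delta>" by (simp add: algebra_simps)
      have "\<bar>?x \<tau> - p j c * N J \<tau>\<bar> \<le> 2 * \<delta>" using a b by linarith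
      then show "\<bar>\<phi> \<tau> * (?x \<tau> - p j c * N J \<tau>)\<bar> \<le> 2 * \<delta> * \<phi> \<tau>"
        using potts_w_pos[of \<beta> "induced E B" \<tau>] by (simp add: abs_mult \<phi>_def mult.commute)
    qed
    finally show ?thesis by (simp add: F_def sum_distrib_left)
  qed
  moreover have "m * F > 0" using m_pos F by simp
  ultimately have a: "message j c = num / den" "m * F \<le> den" "\<bar>num - p j c * den\<bar> \<le> 2 * \<delta> * F" "0 < m * F"
    by simp_all
  show ?thesis
  proof -
    have "den > 0" using a by linarith
    have "message j c - p j c = (num - p j c * den) / den"
      unfolding a(1) diff_divide_distrib using \<open>den > 0\<close> by simp
    then have "\<bar>message j c - p j c\<bar> = \<bar>num - p j c * den\<bar> / den"
      using \<open>den > 0\<close> by (simp only: abs_divide abs_of_pos)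
    also have "\<dots> \<le> (2 * \<delta> * F) / den" using a(3) \<open>den > 0\<close> by (intro divide_right_mono) auto
    also have "\<dots> \<le> (2 * \<delta> * F) / (m * F)"
      using a \<open>den > 0\<close> \<delta>_nonneg F by (intro divide_left_mono) auto
    also have "\<dots> = 2 * \<delta> / m" using F by simp
    finally show ?thesis .
  qed
qed

definition "M J \<tau> = (\<Prod>i\<in>J. 1 - (1 - exp (- \<beta>)) * message i (\<tau> (near i)))"

lemma message_bounds: "0 \<le> message i c" "message i c \<le> 1"
proof -
  have le: "Zw \<beta> F {\<sigma>\<in>S. P \<sigma>} \<le> Zw \<beta> F S" for F P
    unfolding Zw_def using finite_S by (intro sum_mono2) (auto simp: potts_w_pos less_imp_le)
  have nonneg: "0 \<le> Zw \<beta> F X" for F X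
    unfolding Zw_def by (intro sum_nonneg less_imp_le potts_w_pos)
  show "0 \<le> message i c" 
    unfolding message_def msg_def marg1_def by (intro divide_nonneg_nonneg nonneg)
  show "message i c \<le> 1"
    unfolding message_def msg_def marg1_def by (rule divide_le_eq_1[THEN iffD2]) (metis le nonneg less_le)
qed

lemma damped_bounds:
  assumes "0 \<le> x" "x \<le> 1"
  shows "0 < 1 - (1 - exp (- \<beta>)) * x" "1 - (1 - exp (- \<beta>)) * x \<le> 1"
proof -
  have e: "0 < 1 - exp (- \<beta>)" using beta by simp
  have "(1 - exp (- \<beta>)) * x \<le> (1 - exp (- \<beta>)) * 1" using assms e by (intro mult_left_mono) auto
  also have "\<dots> < 1" by simp
  finally show "0 < 1 - (1 - exp (- \<beta>)) * x" by simp
  show "1 - (1 - exp (- \<beta>)) * x \<le> 1" using assms e by simp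
qed

lemma M_pos: "M J \<tau> > 0"
  unfolding M_def by (intro prod_pos damped_bounds message_bounds ballI)

text \<open>One \<delta> for passing from \<open>N\<close> to \<open>\<Gamma>\<close>, and
  \<open>2 * \<delta> / m\<close> for each of at most k marginals exchanged for a message.\<close>

definition "D = \<delta> * (1 + 2 * real k / m)"

lemma NM: 
  assumes J: "J \<subseteq> {..<k}"
  shows "\<bar>N J \<tau> - M J \<tau>\<bar> \<le> D"
proof -
  have fin: "finite J" using J finite_subset by blast
  have "norm (\<Gamma> J \<tau> - M J \<tau>) \<le> (\<Sum>i\<in>J. norm ((1 - (1 - exp (- \<beta>)) * p i (\<tau> (near i))) - (1 - (1 - exp (- \<beta>)) * message i (\<tau> (near i)))))"
    unfolding \<Gamma>_def M_def
  proof (rule norm_prod_diff)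
    fix i
    show "norm (1 - (1 - exp (- \<beta>)) * p i (\<tau> (near i))) \<le> 1"
      using damped_bounds[OF p_bounds, of i "\<tau> (near i)"] by simp
    show "norm (1 - (1 - exp (- \<beta>)) * message i (\<tau> (near i))) \<le> 1"
      using damped_bounds[OF message_bounds, of i "\<tau> (near i)"] by simp
  qed
  also have "\<dots> \<le> (\<Sum>i\<in>J. 2 * \<delta> / m)"
  proof (rule sum_mono)
    fix i assume i: "i \<in> J"
    have "norm ((1 - (1 - exp (- \<beta>)) * p i (\<tau> (near i))) - (1 - (1 - exp (- \<beta>)) * message i (\<tau> (near i))))
       = \<bar>(1 - exp (- \<beta>)) * (message i (\<tau> (near i)) - p i (\<tau> (near i)))\<bar>"
      by (simp add: algebra_simps)
    also have "\<dots> \<le> \<bar>message i (\<tau> (near i)) - p i (\<tau> (near i))\<bar>"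
      using beta by (intro abs_mult_le_one) auto
    also have "\<dots> \<le> 2 * \<delta> / m" using i J by (intro message_approx) auto
    finally show "norm ((1 - (1 - exp (- \<beta>)) * p i (\<tau> (near i))) - (1 - (1 - exp (- \<beta>)) * message i (\<tau> (near i)))) \<le> 2 * \<delta> / m" .
  qed
  also have "\<dots> \<le> real k * (2 * \<delta> / m)"
  proof -
    have "card J \<le> k" using card_mono[OF _ J] by simp
    then show ?thesis using \<delta>_nonneg m_pos by (simp only: sum_constant of_nat_le_iff) (intro mult_right_mono, auto)
  qed
  finally have "\<bar>\<Gamma> J \<tau> - M J \<tau>\<bar> \<le> real k * (2 * \<delta> / m)" by simp
  moreover have "D = \<delta> + real k * (2 * \<delta> / m)" by (simp add: D_def algebra_simps)
  ultimately show ?thesis using N_approx[OF J, of \<tau>] by linarith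
qed

text \<open>With all cut edges in J this concerns the marginal on B in the true graph; with one edge
  missing it concerns the law behind a message sent out of B.\<close>

lemma tv_joined:
  assumes J: "J \<subseteq> {..<k}"
  shows "(\<Sum>\<tau>\<in>cfg B q. \<bar>\<phi> \<tau> * M J \<tau> / (\<Sum>\<tau>\<in>cfg B q. \<phi> \<tau> * M J \<tau>) - margU \<beta> (joined J) S B \<tau>\<bar>) \<le> 2 * D / m"
proof -
  have "(\<Sum>\<tau>\<in>cfg B q. \<bar>\<phi> \<tau> * M J \<tau> / (\<Sum>\<tau>\<in>cfg B q. \<phi> \<tau> * M J \<tau>) - margU \<beta> (joined J) S B \<tau>\<bar>)
    = (\<Sum>\<tau>\<in>cfg B q. \<bar>\<phi> \<tau> * M J \<tau> / (\<Sum>\<tau>\<in>cfg B q. \<phi> \<tau> * M J \<tau>) - \<phi> \<tau> * N J \<tau> / (\<Sum>\<tau>\<in>cfg B q. \<phi> \<tau> * N J \<tau>)\<bar>)"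
    by (intro sum.cong refl) (simp add: margU_joined[OF J])
  also have "\<dots> \<le> 2 * D / m"
    using finite_cfg_B \<tau>B by (intro normalized_tv_bound m_pos N_ge NM M_pos J) (auto simp: \<phi>_def potts_w_pos)
  finally show ?thesis .
qed

end

section \<open>Bethe and Belief Propagation formulas\<close>

context vertex_cut
begin

lemma prod_es:
  fixes g :: "nat \<Rightarrow> nat \<Rightarrow> real"
  shows "(\<Prod>v\<in>B. \<Prod>w\<in>{..<n} - B. if {v, w} \<in> E then g v w else 1) = (\<Prod>i<k. g (near i) (far i))"
proof -
  have finB: "finite B" using B finite_subset by blast
  have "(\<Prod>v\<in>B. \<Prod>w\<in>{..<n} - B. if {v, w} \<in> E then g v w else 1)
      = (\<Prod>x\<in>B \<times> ({..<n} - B). if {fst x, snd x} \<in> E then g (fst x) (snd x) else 1)"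
    unfolding prod.cartesian_product by (simp add: case_prod_unfold)
  also have "\<dots> = (\<Prod>x\<in>{x \<in> B \<times> ({..<n} - B). {fst x, snd x} \<in> E}. g (fst x) (snd x))"
    using finB by (intro prod.inter_filter[symmetric]) auto
  also have "{x \<in> B \<times> ({..<n} - B). {fst x, snd x} \<in> E} = set es"
    unfolding set_es by auto
  also have "(\<Prod>x\<in>set es. g (fst x) (snd x)) = (\<Prod>i<k. g (near i) (far i))"
    by (rule prod.reindex_bij_betw[symmetric]) (rule bij_betw_nth[OF dist refl refl])
  finally show ?thesis .
qed

text \<open>The partition function inside \<open>potts_dist\<close> cancels on normalising, which
  leaves the product form of \<open>tv_joined\<close> with every cut edge present. The factor 1/2 in
  \<open>tv\<close> halves the bound.\<close>

lemma barmu_bound: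
  assumes ball: "B = ball E u r"
  shows "tv (cfg B q) (barmu \<beta> q n E S u r) (margU \<beta> E S B) \<le> D / m"
proof -
  define C where "C = Zw \<beta> (induced E B) (cfg B q)"
  have C: "C > 0"
    unfolding C_def Zw_def using sum_\<phi>_pos by (simp add: \<phi>_def)
  let ?J = "{..<k}"
  have num: "barmu_num \<beta> q n E S u r \<tau> = \<phi> \<tau> * M ?J \<tau> / C" for \<tau>
    unfolding barmu_num_def ball[symmetric] prod_es[of "\<lambda>v w. 1 - (1 - exp (- \<beta>)) * msg \<beta> E S w v (\<tau> v)"]
    by (simp add: potts_dist_def C_def[symmetric] \<phi>_def[symmetric] M_def message_def)
  have "barmu \<beta> q n E S u r \<tau> = \<phi> \<tau> * M ?J \<tau> / (\<Sum>\<tau>\<in>cfg B q. \<phi> \<tau> * M ?J \<tau>)" for \<tau>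
    unfolding barmu_def num ball[symmetric] using C by (simp add: sum_divide_distrib[symmetric])
  then show ?thesis
    using tv_joined[of ?J] by (simp add: tv_def joined_all mult.commute)
qed

text \<open>A message from v is the marginal of v after removal of the edge j. For a single vertex
  the inner weight is 1, so the approximation in \<open>tv_joined\<close> over the other edges is
  the update rule itself.\<close>

lemma bp_bound:
  assumes v: "B = {v}" and j: "j < k"
  shows "(\<Sum>\<omega><q. \<bar>msg \<beta> E S v (far j) \<omega> - bp_prod \<beta> n E S v (far j) \<omega> / (\<Sum>\<sigma><q. bp_prod \<beta> n E S v (far j) \<sigma>)\<bar>)
    \<le> 2 * D / m"
proof -
  define J where "J = {..<k} - {j}"
  have J: "J \<subseteq> {..<k}" by (auto simp: J_def)
  define c where "c \<omega> = restrict (\<lambda>_. \<omega>) {v}" for \<omega> :: nat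
  have near: "near i = v" if "i < k" for i using es_nth[OF that] v by simp
  have no_loop: "{v} \<notin> E" using E by (auto simp: all_pairs_def doubleton_eq_iff)
  have \<phi>1: "\<phi> \<tau> = 1" for \<tau>
  proof -
    have "e = {v}" if "e \<in> E" "e \<subseteq> {v}" for e
      using that E by (auto simp: all_pairs_def)
    then have "induced E B = {}" using no_loop unfolding induced_def v by blast
    then show ?thesis by (simp add: \<phi>_def potts_w_empty)
  qed
  have reindex: "(\<Sum>\<tau>\<in>cfg B q. f \<tau>) = (\<Sum>\<omega><q. f (c \<omega>))" for f :: "(nat \<Rightarrow> nat) \<Rightarrow> real"
  proof (rule sum.reindex_bij_witness[where i = c and j = "\<lambda>\<tau>. \<tau> v"])
    fix \<tau> assume "\<tau> \<in> cfg B q"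
    then show "c (\<tau> v) = \<tau>" "\<tau> v \<in> {..<q}"
      by (auto simp: v c_def cfg_def PiE_iff extensional_def fun_eq_iff)
    then show "f (c (\<tau> v)) = f \<tau>" by simp
  qed (auto simp: v c_def cfg_def)
  \<comment> \<open>With one inner vertex, distinct cut edges have distinct outer ends; those other
    than j run through the neighbours over which the update rule multiplies.\<close>
  have "bij_betw far J {u \<in> {..<n}. {u, v} \<in> E \<and> u \<noteq> far j}"
  proof (rule bij_betw_imageI)
    show inj: "inj_on far J"
    proof (rule inj_onI)
      fix a b assume ab: "a \<in> J" "b \<in> J" "far a = far b"
      then have "es ! a = es ! b" using near[of a] near[of b] by (auto simp: J_def prod_eq_iff)
      then show "a = b" using ab dist by (simp add: nth_eq_iff_index_eq J_def)
    qed
    show "far ` J = {u \<in> {..<n}. {u, v} \<in> E \<and> u \<noteq> far j}"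
    proof (intro equalityI subsetI)
      fix x assume "x \<in> far ` J"
      then obtain i where i: "i < k" "i \<noteq> j" "x = far i" by (auto simp: J_def)
      have "far i \<noteq> far j"
      proof
        assume "far i = far j"
        then have "es ! i = es ! j" using near[of i] near[of j] i j by (auto simp: prod_eq_iff)
        then show False using i j dist by (simp add: nth_eq_iff_index_eq)
      qed
      then show "x \<in> {u \<in> {..<n}. {u, v} \<in> E \<and> u \<noteq> far j}"
        using es_nth[of i] near[of i] i by (auto simp: cut_edge_def insert_commute)
    next
      fix x assume x: "x \<in> {u \<in> {..<n}. {u, v} \<in> E \<and> u \<noteq> far j}"
      then have "x \<noteq> v" using no_loop by auto
      then have "(v, x) \<in> set es" using x by (auto simp: set_es v insert_commute)
      then obtain i where "i < k" "es ! i = (v, x)" by (auto simp: in_set_conv_nth)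
      then show "x \<in> far ` J" using x by (intro image_eqI[of _ _ i]) (auto simp: J_def)
    qed
  qed
  then have bp: "bp_prod \<beta> n E S v (far j) \<omega> = M J (c \<omega>)" for \<omega>
  proof -
    assume bij: "bij_betw far J {u \<in> {..<n}. {u, v} \<in> E \<and> u \<noteq> far j}"
    have "bp_prod \<beta> n E S v (far j) \<omega> = (\<Prod>u\<in>{u \<in> {..<n}. {u, v} \<in> E \<and> u \<noteq> far j}. 1 - (1 - exp (- \<beta>)) * msg \<beta> E S u v \<omega>)"
      unfolding bp_prod_def by (rule prod.inter_filter[symmetric]) simp
    also have "\<dots> = (\<Prod>i\<in>J. 1 - (1 - exp (- \<beta>)) * msg \<beta> E S (far i) v \<omega>)"
      by (rule prod.reindex_bij_betw[OF bij, symmetric])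
    also have "\<dots> = M J (c \<omega>)"
      unfolding M_def message_def by (intro prod.cong refl) (auto simp: J_def near c_def)
    finally show ?thesis .
  qed
  have "{\<sigma>\<in>S. restrict \<sigma> B = c \<omega>} = {\<sigma>\<in>S. \<sigma> v = \<omega>}" for \<omega>
    by (auto simp: v c_def restrict_def fun_eq_iff)
  then have ms: "margU \<beta> (joined J) S B (c \<omega>) = msg \<beta> E S v (far j) \<omega>" for \<omega>
    unfolding J_def joined_remove[OF j]
    by (simp add: margU_def msg_def marg1_def cut_edge_def near[OF j] insert_commute)
  show ?thesis
    using tv_joined[OF J] unfolding reindex \<phi>1 mult_1_left bp[symmetric] ms
    by (simp add: abs_minus_commute)
qed

end

section \<open>The random graph\<close>

definition graph_weight :: "nat \<Rightarrow> real \<Rightarrow> nat set set \<Rightarrow> real" where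
  "graph_weight n p E = p ^ card E * (1 - p) ^ (card (all_pairs n) - card E)"

definition graph_mean :: "nat \<Rightarrow> real \<Rightarrow> (nat set set \<Rightarrow> real) \<Rightarrow> real" where
  "graph_mean n p f = (\<Sum>E\<in>Pow (all_pairs n). graph_weight n p E * f E)"

text \<open>Passing from indicator families to edge sets is injective on the support, where families
  are False off \<open>all_pairs\<close>, so no probabilities are merged.\<close>

lemma pmf_Gnp:
  assumes p: "0 < p" "p < 1" and E: "E \<subseteq> all_pairs n"
  shows "pmf (Gnp n p) E = graph_weight n p E"
proof -
  let ?A = "all_pairs n"
  let ?M = "Pi_pmf ?A False (\<lambda>_. bernoulli_pmf p)"
  let ?h = "\<lambda>f. {e \<in> ?A. f e}"
  have fin: "finite ?A" by (rule finite_all_pairs)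
  have pM: "pmf ?M (\<lambda>e. e \<in> E) = graph_weight n p E"
  proof -
    have "pmf ?M (\<lambda>e. e \<in> E) = (\<Prod>e\<in>?A. pmf (bernoulli_pmf p) (e \<in> E))"
      using E fin by (subst pmf_Pi) auto
    also have "\<dots> = (\<Prod>e\<in>?A. if e \<in> E then p else 1 - p)"
      using p by (intro prod.cong refl) auto
    also have "\<dots> = p ^ card (?A \<inter> E) * (1 - p) ^ card (?A - E)"
      using fin by (simp add: prod.If_cases Diff_eq)
    also have "\<dots> = graph_weight n p E"
      using E fin by (simp add: graph_weight_def Int_absorb1 card_Diff_subset finite_subset)
    finally show ?thesis .
  qed
  have "graph_weight n p E > 0" using p by (simp add: graph_weight_def)
  then have "(\<lambda>e. e \<in> E) \<in> set_pmf ?M" using pM by (simp add: set_pmf_iff)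
  moreover have "inj_on ?h (set_pmf ?M)"
  proof (rule inj_onI)
    fix f g assume fg: "f \<in> set_pmf ?M" "g \<in> set_pmf ?M" "?h f = ?h g"
    have "f e = g e" for e
    proof (cases "e \<in> ?A")
      case True then show ?thesis using fg(3) by blast
    next
      case False
      have "\<not> f e" "\<not> g e" using fg(1,2) False fin by (auto simp: set_Pi_pmf PiE_dflt_def)
      then show ?thesis by simp
    qed
    then show "f = g" by blast
  qed
  ultimately have "pmf (map_pmf ?h ?M) (?h (\<lambda>e. e \<in> E)) = pmf ?M (\<lambda>e. e \<in> E)"
    by (intro pmf_map_inj)
  moreover have "?h (\<lambda>e. e \<in> E) = E" using E by auto
  ultimately show ?thesis by (simp add: Gnp_def pM)
qed

lemma prob_Gnp:
  assumes p: "0 < p" "p < 1"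
  shows "measure_pmf.prob (Gnp n p) X = graph_mean n p (\<lambda>E. of_bool (E \<in> X))"
proof -
  have sub: "set_pmf (Gnp n p) \<subseteq> Pow (all_pairs n)" by (auto simp: Gnp_def)
  have "measure_pmf.prob (Gnp n p) X = measure_pmf.prob (Gnp n p) (X \<inter> Pow (all_pairs n))"
    using sub by (intro measure_prob_cong_0) (auto simp: set_pmf_iff)
  also have "\<dots> = (\<Sum>E\<in>X \<inter> Pow (all_pairs n). pmf (Gnp n p) E)"
    by (intro measure_measure_pmf_finite) (simp add: finite_all_pairs)
  also have "\<dots> = (\<Sum>E\<in>Pow (all_pairs n) \<inter> X. graph_weight n p E)"
    using pmf_Gnp[OF p] by (intro sum.cong) auto
  also have "\<dots> = (\<Sum>E\<in>Pow (all_pairs n). if E \<in> X then graph_weight n p E else 0)"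
    by (intro sum.inter_restrict) (simp add: finite_all_pairs)
  also have "\<dots> = graph_mean n p (\<lambda>E. of_bool (E \<in> X))"
    unfolding graph_mean_def by (intro sum.cong refl) simp
  finally show ?thesis .
qed

lemma graph_mean_const: "0 < p \<Longrightarrow> p < 1 \<Longrightarrow> graph_mean n p (\<lambda>_. c) = c"
  using prob_Gnp[of p n UNIV] by (simp add: graph_mean_def sum_distrib_right[symmetric])

lemma graph_weight_nonneg: "0 < p \<Longrightarrow> p < 1 \<Longrightarrow> graph_weight n p E \<ge> 0"
  by (simp add: graph_weight_def)

lemma graph_mean_mono:
  assumes "0 < p" "p < 1" "\<And>E. E \<subseteq> all_pairs n \<Longrightarrow> f E \<le> g E"
  shows "graph_mean n p f \<le> graph_mean n p g"
  unfolding graph_mean_def using assms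
  by (intro sum_mono mult_left_mono graph_weight_nonneg) auto

lemma graph_mean_nonneg:
  assumes "0 < p" "p < 1" "\<And>E. E \<subseteq> all_pairs n \<Longrightarrow> f E \<ge> 0"
  shows "graph_mean n p f \<ge> 0"
  unfolding graph_mean_def using assms
  by (intro sum_nonneg mult_nonneg_nonneg graph_weight_nonneg) auto

lemma graph_mean_add: "graph_mean n p (\<lambda>E. f E + g E) = graph_mean n p f + graph_mean n p g"
  by (simp add: graph_mean_def distrib_left sum.distrib)

lemma graph_mean_cmult: "graph_mean n p (\<lambda>E. c * f E) = c * graph_mean n p f"
  by (simp add: graph_mean_def sum_distrib_left mult.left_commute)

lemma graph_mean_sum: "graph_mean n p (\<lambda>E. \<Sum>i\<in>I. f i E) = (\<Sum>i\<in>I. graph_mean n p (f i))"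
  unfolding graph_mean_def sum_distrib_left by (rule sum.swap)

section \<open>Deletion of edges\<close>

definition odds :: "real \<Rightarrow> real" where "odds p = p / (1 - p)"

text \<open>Removing F is injective on the graphs containing F and changes the weight by exactly
  \<open>odds p ^ card F\<close>. Only an inequality results, since the image consists of the graphs
  disjoint from F.\<close>

lemma graph_mean_delete_edges:
  assumes p: "0 < p" "p < 1" and F: "F \<subseteq> all_pairs n" and f: "\<And>E. E \<subseteq> all_pairs n \<Longrightarrow> f E \<ge> 0"
  shows "graph_mean n p (\<lambda>E. of_bool (F \<subseteq> E) * f (E - F)) \<le> odds p ^ card F * graph_mean n p f"
proof -
  let ?A = "all_pairs n"
  have finA: "finite ?A" by (rule finite_all_pairs)
  have w: "graph_weight n p E = odds p ^ card F * graph_weight n p (E - F)" if E: "E \<subseteq> ?A" "F \<subseteq> E" for E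
  proof -
    have fin: "finite E" "finite F" by (rule finite_subset[OF E(1) finA], rule finite_subset[OF F finA])
    define a b where "a = card (E - F)" and "b = card ?A - card E"
    have c: "card E = a + card F"
      using card_Diff_subset[OF fin(2) E(2)] card_mono[OF fin(1) E(2)] by (simp add: a_def)
    have "card E \<le> card ?A" using E finA by (intro card_mono)
    then have d: "card ?A - a = b + card F" using c by (simp add: b_def)
    have "odds p ^ card F * (p ^ a * (1 - p) ^ (b + card F)) = p ^ (a + card F) * (1 - p) ^ b"
      using p by (simp add: odds_def power_add power_divide)
    then show ?thesis
      unfolding graph_weight_def a_def[symmetric] b_def[symmetric] d by (simp only: c)
  qed
  have "graph_mean n p (\<lambda>E. of_bool (F \<subseteq> E) * f (E - F))
      = (\<Sum>E\<in>Pow ?A. if F \<subseteq> E then odds p ^ card F * (graph_weight n p (E - F) * f (E - F)) else 0)"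
    unfolding graph_mean_def by (intro sum.cong refl) (auto simp: w)
  also have "\<dots> = (\<Sum>E\<in>{E \<in> Pow ?A. F \<subseteq> E}. odds p ^ card F * (graph_weight n p (E - F) * f (E - F)))"
    using finA by (intro sum.inter_filter[symmetric]) simp
  also have "\<dots> = odds p ^ card F * (\<Sum>E\<in>{E \<in> Pow ?A. F \<subseteq> E}. graph_weight n p (E - F) * f (E - F))"
    by (simp add: sum_distrib_left)
  also have "(\<Sum>E\<in>{E \<in> Pow ?A. F \<subseteq> E}. graph_weight n p (E - F) * f (E - F))
      = (\<Sum>E\<in>(\<lambda>E. E - F) ` {E \<in> Pow ?A. F \<subseteq> E}. graph_weight n p E * f E)"
  proof (subst sum.reindex)
    show "inj_on (\<lambda>E. E - F) {E \<in> Pow ?A. F \<subseteq> E}" by (rule inj_onI) blast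
  qed (simp add: o_def)
  also have "odds p ^ card F * \<dots> \<le> odds p ^ card F * graph_mean n p f"
    unfolding graph_mean_def
  proof (intro mult_left_mono sum_mono2)
    show "finite (Pow ?A)" using finA by simp
    show "0 \<le> graph_weight n p b * f b" if "b \<in> Pow ?A - (\<lambda>E. E - F) ` {E \<in> Pow ?A. F \<subseteq> E}" for b
      using that p by (intro mult_nonneg_nonneg graph_weight_nonneg f) auto
    show "0 \<le> odds p ^ card F" using p by (simp add: odds_def)
  qed auto
  finally show ?thesis .
qed

text \<open>Admits every e, because the applications take \<open>{v, w}\<close> without excluding v
  = w; a set that is not a pair lies in no graph.\<close>

lemma graph_mean_delete_edge:
  assumes p: "0 < p" "p < 1" and f: "\<And>E. E \<subseteq> all_pairs n \<Longrightarrow> f E \<ge> 0"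
  shows "graph_mean n p (\<lambda>E. of_bool (e \<in> E) * f (E - {e})) \<le> odds p * graph_mean n p f"
proof (cases "e \<in> all_pairs n")
  case True
  then show ?thesis using graph_mean_delete_edges[OF p, of "{e}" n f] f by simp
next
  case False
  then have "graph_mean n p (\<lambda>E. of_bool (e \<in> E) * f (E - {e})) = 0"
    unfolding graph_mean_def by (intro sum.neutral) auto
  then show ?thesis using p graph_mean_nonneg[OF p f] by (simp add: odds_def)
qed

section \<open>Balls and their boundaries\<close>

lemma ball_0: "ball E u 0 = {u}"
  by (auto simp: ball_def)

lemma ball_mono: "r \<le> s \<Longrightarrow> ball E u r \<subseteq> ball E u s"
  unfolding ball_def by (auto intro: order_trans)

lemma ball_Suc: "ball E u (Suc r) = ball E u r \<union> {w. \<exists>v\<in>ball E u r. {v, w} \<in> E}"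
proof (intro equalityI subsetI)
  fix w assume "w \<in> ball E u (Suc r)"
  then obtain j where j: "j \<le> Suc r" "(u, w) \<in> adj E ^^ j" by (auto simp: ball_def)
  show "w \<in> ball E u r \<union> {w. \<exists>v\<in>ball E u r. {v, w} \<in> E}"
  proof (cases "j \<le> r")
    case True then show ?thesis using j by (auto simp: ball_def)
  next
    case False
    then have "j = Suc r" using j by simp
    then obtain v where "(u, v) \<in> adj E ^^ r" "(v, w) \<in> adj E" using j by auto
    then show ?thesis by (auto simp: ball_def adj_def)
  qed
next
  fix w assume "w \<in> ball E u r \<union> {w. \<exists>v\<in>ball E u r. {v, w} \<in> E}"
  then consider "w \<in> ball E u r" | v where "v \<in> ball E u r" "{v, w} \<in> E" by blast
  then show "w \<in> ball E u (Suc r)"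
  proof cases
    case 1 then show ?thesis using ball_mono[of r "Suc r"] by auto
  next
    case (2 v)
    then obtain j where "j \<le> r" "(u, v) \<in> adj E ^^ j" by (auto simp: ball_def)
    then have "Suc j \<le> Suc r" "(u, w) \<in> adj E ^^ Suc j" using 2 by (auto simp: adj_def)
    then show ?thesis unfolding ball_def by blast
  qed
qed

lemma ball_subset:
  assumes "E \<subseteq> all_pairs n" "u < n"
  shows "ball E u r \<subseteq> {..<n}"
proof (induction r)
  case (Suc r)
  have "w < n" if "{v, w} \<in> E" for v w
    using that assms(1) by (auto simp: all_pairs_def doubleton_eq_iff)
  with Suc show ?case by (auto simp: ball_Suc)
qed (simp add: ball_0 assms)

text \<open>A walk of length at most r from u visits only vertices of the ball, so it never uses an
  edge with an end outside.\<close>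

lemma ball_delete:
  assumes F: "\<And>e. e \<in> F \<Longrightarrow> \<not> e \<subseteq> ball E u r"
  shows "ball (E - F) u r = ball E u r"
proof -
  have "ball (E - F) u s = ball E u s" if "s \<le> r" for s
    using that
  proof (induction s)
    case (Suc s)
    have IH: "ball (E - F) u s = ball E u s" using Suc by simp
    have "{v, w} \<notin> F" if "v \<in> ball E u s" "{v, w} \<in> E" for v w
    proof
      assume "{v, w} \<in> F"
      moreover have "w \<in> ball E u (Suc s)" using that by (auto simp: ball_Suc)
      ultimately show False using F[of "{v, w}"] that ball_mono[OF Suc.prems, of E u] ball_mono[of s r E u] Suc.prems
        by auto
    qed
    then show ?case unfolding ball_Suc IH by blast
  qed (simp add: ball_0)
  then show ?thesis by simp
qed

lemma ball_delete_exit: "w \<notin> ball E u r \<Longrightarrow> ball (E - {{v, w}}) u r = ball E u r"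
  by (rule ball_delete) auto

definition cut_pairs :: "nat \<Rightarrow> nat set set \<Rightarrow> nat set \<Rightarrow> (nat \<times> nat) set" where
  "cut_pairs n E B = {(v, w). v \<in> B \<and> w \<in> {..<n} - B \<and> {v, w} \<in> E}"

text \<open>A shortest path from \<open>u\<close> to \<open>v\<close> does not use the edge to a vertex \<open>w\<close> outside the ball, so this edge
  may be deleted first.\<close>
lemma graph_mean_exit:
  assumes p: "0 < p" "p < 1"
  shows "graph_mean n p (\<lambda>E. of_bool (v \<in> ball E u r \<and> w \<notin> ball E u r \<and> {v, w} \<in> E))
    \<le> odds p * graph_mean n p (\<lambda>E. of_bool (v \<in> ball E u r))"
proof -
  have "graph_mean n p (\<lambda>E. of_bool (v \<in> ball E u r \<and> w \<notin> ball E u r \<and> {v, w} \<in> E))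
    \<le> graph_mean n p (\<lambda>E. of_bool ({v, w} \<in> E) * of_bool (v \<in> ball (E - {{v, w}}) u r))"
    by (intro graph_mean_mono p) (auto simp: ball_delete_exit)
  also have "\<dots> \<le> odds p * graph_mean n p (\<lambda>E. of_bool (v \<in> ball E u r))"
    by (rule graph_mean_delete_edge[OF p]) simp
  finally show ?thesis .
qed

lemma card_eq_sum_of_bool: "B \<subseteq> {..<n :: nat} \<Longrightarrow> real (card B) = (\<Sum>v<n. of_bool (v \<in> B))"
proof -
  assume B: "B \<subseteq> {..<n}"
  have "(\<Sum>v\<in>{..<n} \<inter> B. 1) = (\<Sum>v<n. if v \<in> B then 1 else 0 :: real)"
    by (rule sum.inter_restrict) simp
  moreover have "{..<n} \<inter> B = B" using B by blast
  ultimately show ?thesis unfolding of_bool_def by (simp only: card_eq_sum of_nat_sum of_nat_1)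
qed

lemma card_cut_pairs:
  assumes "B \<subseteq> {..<n}"
  shows "real (card (cut_pairs n E B)) = (\<Sum>w<n. \<Sum>v<n. of_bool (v \<in> B \<and> w \<notin> B \<and> {v, w} \<in> E))"
proof -
  have "(\<Sum>w<n. \<Sum>v<n. of_bool (v \<in> B \<and> w \<notin> B \<and> {v, w} \<in> E))
      = (\<Sum>v<n. \<Sum>w<n. of_bool (v \<in> B \<and> w \<notin> B \<and> {v, w} \<in> E))"
    by (rule sum.swap)
  also have "\<dots> = (\<Sum>x\<in>{..<n} \<times> {..<n}. if fst x \<in> B \<and> snd x \<notin> B \<and> {fst x, snd x} \<in> E then 1 else 0)"
    unfolding sum.cartesian_product by (simp add: case_prod_unfold of_bool_def)
  also have "\<dots> = (\<Sum>x\<in>{x \<in> {..<n} \<times> {..<n}. fst x \<in> B \<and> snd x \<notin> B \<and> {fst x, snd x} \<in> E}. 1)"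
    by (rule sum.inter_filter[symmetric]) simp
  also have "{x \<in> {..<n} \<times> {..<n}. fst x \<in> B \<and> snd x \<notin> B \<and> {fst x, snd x} \<in> E} = cut_pairs n E B"
    using assms by (auto simp: cut_pairs_def)
  also have "(\<Sum>x\<in>cut_pairs n E B. 1) = real (card (cut_pairs n E B))" by simp
  finally show ?thesis by (rule sym)
qed

text \<open>For each vertex of the ball there are at most n candidates for an exit, and each costs a
  factor \<open>odds p\<close> while the event of belonging to the ball is kept.\<close>

lemma mean_cut_pairs:
  assumes p: "0 < p" "p < 1" and u: "u < n"
  shows "graph_mean n p (\<lambda>E. real (card (cut_pairs n E (ball E u r))))
    \<le> real n * odds p * graph_mean n p (\<lambda>E. real (card (ball E u r)))"
proof -
  have "graph_mean n p (\<lambda>E. real (card (cut_pairs n E (ball E u r))))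
    = graph_mean n p (\<lambda>E. \<Sum>w<n. \<Sum>v<n. of_bool (v \<in> ball E u r \<and> w \<notin> ball E u r \<and> {v, w} \<in> E))"
    unfolding graph_mean_def using u by (intro sum.cong refl) (simp add: card_cut_pairs ball_subset)
  also have "\<dots> = (\<Sum>w<n. \<Sum>v<n. graph_mean n p (\<lambda>E. of_bool (v \<in> ball E u r \<and> w \<notin> ball E u r \<and> {v, w} \<in> E)))"
    by (simp only: graph_mean_sum)
  also have "\<dots> \<le> (\<Sum>w<n. \<Sum>v<n. odds p * graph_mean n p (\<lambda>E. of_bool (v \<in> ball E u r)))"
    by (intro sum_mono graph_mean_exit p)
  also have "\<dots> = real n * odds p * graph_mean n p (\<lambda>E. \<Sum>v<n. of_bool (v \<in> ball E u r))"
    unfolding graph_mean_sum by (simp add: sum_distrib_left mult.assoc)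
  also have "graph_mean n p (\<lambda>E. \<Sum>v<n. of_bool (v \<in> ball E u r)) = graph_mean n p (\<lambda>E. real (card (ball E u r)))"
    unfolding graph_mean_def using u by (intro sum.cong refl) (simp add: card_eq_sum_of_bool[symmetric] ball_subset del: sum_of_bool_eq)
  finally show ?thesis .
qed

lemma finite_cut_pairs: "B \<subseteq> {..<n} \<Longrightarrow> finite (cut_pairs n E B)"
  by (rule finite_subset[of _ "{..<n} \<times> {..<n}"]) (auto simp: cut_pairs_def)

text \<open>Every vertex of the next layer is the outer end of a cut pair, so one more layer
  multiplies the mean size by at most 1 + c.\<close>

lemma mean_ball:
  assumes p: "0 < p" "p < 1" and u: "u < n" and c: "real n * odds p \<le> c"
  shows "graph_mean n p (\<lambda>E. real (card (ball E u r))) \<le> (1 + c) ^ r"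
proof (induction r)
  case 0
  show ?case using p by (simp add: ball_0 graph_mean_const)
next
  case (Suc r)
  have c0: "c \<ge> 0" using p by (intro order_trans[OF _ c]) (simp add: odds_def)
  have "real (card (ball E u (Suc r))) \<le> real (card (ball E u r)) + real (card (cut_pairs n E (ball E u r)))"
    if E: "E \<subseteq> all_pairs n" for E
  proof -
    have sub: "ball E u r \<subseteq> {..<n}" "ball E u (Suc r) \<subseteq> {..<n}" by (rule ball_subset[OF E u])+
    have "ball E u (Suc r) \<subseteq> ball E u r \<union> snd ` cut_pairs n E (ball E u r)"
    proof
      fix w assume w: "w \<in> ball E u (Suc r)"
      then consider "w \<in> ball E u r" | v where "w \<notin> ball E u r" "v \<in> ball E u r" "{v, w} \<in> E"
        unfolding ball_Suc by blast
      then show "w \<in> ball E u r \<union> snd ` cut_pairs n E (ball E u r)"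
      proof cases
        case (2 v)
        then have "(v, w) \<in> cut_pairs n E (ball E u r)" using w sub by (auto simp: cut_pairs_def)
        then show ?thesis by force
      qed simp
    qed
    then have "card (ball E u (Suc r)) \<le> card (ball E u r \<union> snd ` cut_pairs n E (ball E u r))"
      using sub finite_cut_pairs by (intro card_mono) (auto intro: finite_subset)
    also have "\<dots> \<le> card (ball E u r) + card (snd ` cut_pairs n E (ball E u r))" by (rule card_Un_le)
    also have "\<dots> \<le> card (ball E u r) + card (cut_pairs n E (ball E u r))"
      using finite_cut_pairs[OF sub(1)] by (intro add_left_mono card_image_le)
    finally show ?thesis by linarith
  qed
  then have "graph_mean n p (\<lambda>E. real (card (ball E u (Suc r))))
    \<le> graph_mean n p (\<lambda>E. real (card (ball E u r)) + real (card (cut_pairs n E (ball E u r))))"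
    by (intro graph_mean_mono p)
  also have "\<dots> \<le> graph_mean n p (\<lambda>E. real (card (ball E u r))) + c * graph_mean n p (\<lambda>E. real (card (ball E u r)))"
    unfolding graph_mean_add
    using mean_cut_pairs[OF p u, of r] mult_right_mono[OF c, of "graph_mean n p (\<lambda>E. real (card (ball E u r)))"]
      graph_mean_nonneg[OF p, of n "\<lambda>E. real (card (ball E u r))"] by linarith
  also have "\<dots> = (1 + c) * graph_mean n p (\<lambda>E. real (card (ball E u r)))" by (simp add: algebra_simps)
  also have "\<dots> \<le> (1 + c) * (1 + c) ^ r" using Suc c0 by (intro mult_left_mono) auto
  finally show ?case by simp
qed

definition small_cut :: "nat \<Rightarrow> nat \<Rightarrow> nat set set \<Rightarrow> nat \<Rightarrow> nat \<Rightarrow> bool" where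
  "small_cut K n E u r \<longleftrightarrow> card (ball E u r) \<le> K \<and> card (cut_pairs n E (ball E u r)) \<le> K"

text \<open>Markov's inequality for ball size plus cut size, whose means are at most (1 + c)^r and c
  (1 + c)^r.\<close>

lemma mean_not_small_cut:
  assumes p: "0 < p" "p < 1" and u: "u < n" and c: "real n * odds p \<le> c" and K: "K > 0"
  shows "graph_mean n p (\<lambda>E. of_bool (\<not> small_cut K n E u r)) \<le> (1 + c) ^ Suc r / real K"
proof -
  have c0: "c \<ge> 0" using p by (intro order_trans[OF _ c]) (simp add: odds_def)
  have "of_bool (\<not> small_cut K n E u r)
     \<le> (1 / real K) * (real (card (ball E u r)) + real (card (cut_pairs n E (ball E u r))))" for E
    using K by (auto simp: small_cut_def field_simps)
  then have "graph_mean n p (\<lambda>E. of_bool (\<not> small_cut K n E u r))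
    \<le> graph_mean n p (\<lambda>E. (1 / real K) * (real (card (ball E u r)) + real (card (cut_pairs n E (ball E u r)))))"
    by (intro graph_mean_mono p)
  also have "\<dots> \<le> (1 / real K) * ((1 + c) ^ r + c * (1 + c) ^ r)"
    unfolding graph_mean_cmult graph_mean_add
  proof (intro mult_left_mono add_mono mean_ball p u c)
    have "graph_mean n p (\<lambda>E. real (card (cut_pairs n E (ball E u r))))
      \<le> real n * odds p * graph_mean n p (\<lambda>E. real (card (ball E u r)))"
      by (rule mean_cut_pairs[OF p u])
    also have "\<dots> \<le> c * (1 + c) ^ r"
      using p u c c0 by (intro mult_mono mean_ball graph_mean_nonneg) auto
    finally show "graph_mean n p (\<lambda>E. real (card (cut_pairs n E (ball E u r)))) \<le> c * (1 + c) ^ r" .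
  qed simp
  finally show ?thesis by (simp add: algebra_simps add_divide_distrib)
qed

section \<open>Degrees\<close>

definition vertex_degree :: "nat \<Rightarrow> nat set set \<Rightarrow> nat \<Rightarrow> nat" where
  "vertex_degree n E v = card {w. w < n \<and> {v, w} \<in> E}"

lemma vertex_degree_eq_sum: "real (vertex_degree n E v) = (\<Sum>w<n. of_bool ({v, w} \<in> E))"
proof -
  have "{w. w < n \<and> {v, w} \<in> E} \<subseteq> {..<n}" by auto
  from card_eq_sum_of_bool[OF this] show ?thesis
    unfolding vertex_degree_def by (simp only: mem_Collect_eq) (auto intro!: sum.cong)
qed

lemma vertex_degree_cut_pairs:
  assumes "E \<subseteq> all_pairs n"
  shows "card (cut_pairs n E (ball E v 0)) = vertex_degree n E v"
proof -
  have nl: "{v} \<notin> E" using assms by (auto simp: all_pairs_def doubleton_eq_iff)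
  then have "cut_pairs n E (ball E v 0) = Pair v ` {w. w < n \<and> {v, w} \<in> E}"
    by (auto simp: cut_pairs_def ball_0)
  then show ?thesis by (simp add: vertex_degree_def card_image inj_on_def)
qed

lemma vertex_degree_delete: "vertex_degree n E v \<le> Suc (vertex_degree n (E - {{v, w}}) v)"
proof -
  have fin: "finite {x. x < n \<and> {v, x} \<in> E - {{v, w}}}" by simp
  have "{x. x < n \<and> {v, x} \<in> E} \<subseteq> insert w {x. x < n \<and> {v, x} \<in> E - {{v, w}}}"
    by (auto simp: doubleton_eq_iff)
  then have "vertex_degree n E v \<le> card (insert w {x. x < n \<and> {v, x} \<in> E - {{v, w}}})"
    unfolding vertex_degree_def by (intro card_mono) auto
  also have "\<dots> \<le> Suc (vertex_degree n (E - {{v, w}}) v)"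
    unfolding vertex_degree_def card_insert_if[OF fin] by simp
  finally show ?thesis .
qed

text \<open>The Belief Propagation condition sums over adjacent pairs, so an exceptional vertex
  costs its degree and not merely 1. Splitting the degree into single edges and deleting each of
  them leaves n \<open>odds p\<close> times the probability of degree at least K, itself at most c /
  K.\<close>

lemma mean_large_degree:
  assumes p: "0 < p" "p < 1" and c: "real n * odds p \<le> c" and K: "K > 0"
  shows "graph_mean n p (\<lambda>E. real (vertex_degree n E v) * of_bool (vertex_degree n E v > K)) \<le> c\<^sup>2 / real K"
proof -
  have o0: "odds p \<ge> 0" using p by (simp add: odds_def)
  have c0: "c \<ge> 0" using o0 by (intro order_trans[OF _ c]) simp
  have deg: "graph_mean n p (\<lambda>E. real (vertex_degree n E v)) \<le> c"
  proof -
    have "graph_mean n p (\<lambda>E. real (vertex_degree n E v)) = (\<Sum>w<n. graph_mean n p (\<lambda>E. of_bool ({v, w} \<in> E)))"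
      by (simp only: vertex_degree_eq_sum graph_mean_sum)
    also have "\<dots> \<le> (\<Sum>w<n. odds p)"
    proof (rule sum_mono)
      fix w
      show "graph_mean n p (\<lambda>E. of_bool ({v, w} \<in> E)) \<le> odds p"
        using graph_mean_delete_edge[OF p, of n "\<lambda>_. 1" "{v, w}"] p by (simp add: graph_mean_const)
    qed
    finally show ?thesis using c by simp
  qed
  have "graph_mean n p (\<lambda>E. real (vertex_degree n E v) * of_bool (vertex_degree n E v > K))
    \<le> graph_mean n p (\<lambda>E. \<Sum>w<n. of_bool ({v, w} \<in> E) * of_bool (vertex_degree n (E - {{v, w}}) v \<ge> K))"
  proof (intro graph_mean_mono p)
    fix E
    have "real (vertex_degree n E v) * of_bool (vertex_degree n E v > K) = (\<Sum>w<n. of_bool ({v, w} \<in> E) * of_bool (vertex_degree n E v > K))"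
      by (simp only: vertex_degree_eq_sum sum_distrib_right)
    also have "\<dots> \<le> (\<Sum>w<n. of_bool ({v, w} \<in> E) * of_bool (vertex_degree n (E - {{v, w}}) v \<ge> K))"
    proof (rule sum_mono)
      fix w
      show "of_bool ({v, w} \<in> E) * of_bool (vertex_degree n E v > K)
        \<le> (of_bool ({v, w} \<in> E) * of_bool (vertex_degree n (E - {{v, w}}) v \<ge> K) :: real)"
        using vertex_degree_delete[of n E v w] by (auto simp: of_bool_def)
    qed
    finally show "real (vertex_degree n E v) * of_bool (vertex_degree n E v > K)
      \<le> (\<Sum>w<n. of_bool ({v, w} \<in> E) * of_bool (vertex_degree n (E - {{v, w}}) v \<ge> K))" .
  qed
  also have "\<dots> = (\<Sum>w<n. graph_mean n p (\<lambda>E. of_bool ({v, w} \<in> E) * of_bool (vertex_degree n (E - {{v, w}}) v \<ge> K)))"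
    by (rule graph_mean_sum)
  also have "\<dots> \<le> (\<Sum>w<n. odds p * graph_mean n p (\<lambda>E. of_bool (vertex_degree n E v \<ge> K)))"
    by (intro sum_mono graph_mean_delete_edge[OF p, where f = "\<lambda>E. of_bool (vertex_degree n E v \<ge> K)"]) simp
  also have "\<dots> = real n * odds p * graph_mean n p (\<lambda>E. of_bool (vertex_degree n E v \<ge> K))" by simp
  also have "\<dots> \<le> c * (c / real K)"
  proof (intro mult_mono c c0 graph_mean_nonneg p)
    have "graph_mean n p (\<lambda>E. of_bool (vertex_degree n E v \<ge> K)) \<le> graph_mean n p (\<lambda>E. (1 / real K) * real (vertex_degree n E v))"
      using K by (intro graph_mean_mono p) (auto simp: field_simps)
    also have "\<dots> = graph_mean n p (\<lambda>E. real (vertex_degree n E v)) / real K" unfolding graph_mean_cmult by simp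
    also have "\<dots> \<le> c / real K" using deg by (rule divide_right_mono) simp
    finally show "graph_mean n p (\<lambda>E. of_bool (vertex_degree n E v \<ge> K)) \<le> c / real K" .
  qed simp
  finally show ?thesis by (simp add: power2_eq_square)
qed

section \<open>Averaging over graphs and pins\<close>

text \<open>The number of pins is averaged too, because the energy increments are controlled only
  when summed over t.\<close>

definition tavg :: "nat \<Rightarrow> nat \<Rightarrow> (nat list \<Rightarrow> real) \<Rightarrow> real" where
  "tavg T n f = (\<Sum>t<T. tmean n t f) / real T"

lemma tavg_mono:
  assumes "\<And>t us. t < T \<Longrightarrow> us \<in> tuples n t \<Longrightarrow> f us \<le> g us"
  shows "tavg T n f \<le> tavg T n g"
  unfolding tavg_def using assms by (intro divide_right_mono sum_mono tmean_mono) auto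

lemma tavg_add: "tavg T n (\<lambda>us. f us + g us) = tavg T n f + tavg T n g"
  by (simp add: tavg_def tmean_add sum.distrib add_divide_distrib)

lemma tavg_cmult: "tavg T n (\<lambda>us. c * f us) = c * tavg T n f"
  by (simp add: tavg_def tmean_cmult sum_distrib_left)

lemma tavg_const: "T > 0 \<Longrightarrow> n > 0 \<Longrightarrow> tavg T n (\<lambda>_. c) = c"
  by (simp add: tavg_def tmean_const)

lemma tavg_nonneg: "(\<And>us. f us \<ge> 0) \<Longrightarrow> tavg T n f \<ge> 0"
  unfolding tavg_def by (intro divide_nonneg_nonneg sum_nonneg tmean_nonneg) auto

lemma tmean_sum: "tmean n k (\<lambda>us. \<Sum>i\<in>I. f i us) = (\<Sum>i\<in>I. tmean n k (f i))"
  unfolding tmean_def sum_divide_distrib[symmetric] by (simp only: sum.swap[of _ I])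

lemma tavg_sum: "tavg T n (\<lambda>us. \<Sum>i\<in>I. f i us) = (\<Sum>i\<in>I. tavg T n (f i))"
  unfolding tavg_def sum_divide_distrib[symmetric] tmean_sum by (simp only: sum.swap[of _ I])

lemma tmean_tavg: "tmean m k (\<lambda>ws. tavg T n (F ws)) = tavg T n (\<lambda>us. tmean m k (\<lambda>ws. F ws us))"
proof -
  have "tavg T n (\<lambda>us. tmean m k (\<lambda>ws. F ws us)) = tavg T n (\<lambda>us. (1 / real m ^ k) * (\<Sum>ws\<in>tuples m k. F ws us))"
    by (simp add: tmean_def)
  then show ?thesis unfolding tavg_cmult tavg_sum by (simp add: tmean_def)
qed

text \<open>Replaces the mean over random pins by one choice of pins for a given graph.\<close>

lemma tavg_attained:
  assumes "T > 0" "n > 0"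
  shows "\<exists>t<T. \<exists>us\<in>tuples n t. f us \<le> tavg T n f"
proof (rule ccontr)
  assume "\<not> ?thesis"
  then have gt: "f us > tavg T n f" if "t < T" "us \<in> tuples n t" for t us
    using that by (auto simp: not_le)
  have "tmean n t f > tavg T n f" if t: "t < T" for t
  proof -
    have "card (tuples n t) > 0" using assms by (simp add: card_tuples)
    then have "(\<Sum>us\<in>tuples n t. tavg T n f) < (\<Sum>us\<in>tuples n t. f us)"
      using gt[OF t] by (intro sum_strict_mono finite_tuples) auto
    then show ?thesis using assms by (simp add: tmean_def card_tuples field_simps)
  qed
  then have "(\<Sum>t<T. tavg T n f) < (\<Sum>t<T. tmean n t f)"
    using assms by (intro sum_strict_mono) auto
  then show False using assms by (simp add: tavg_def)
qed

text \<open>Union bound over the entries: each of them falls into B with probability card B /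
  n.\<close>

lemma tmean_hit:
  assumes B: "B \<subseteq> {..<n}" and n: "n > 0"
  shows "tmean n t (\<lambda>us. of_bool (set us \<inter> B \<noteq> {})) \<le> real t * real (card B) / real n"
proof (induction t)
  case 0
  show ?case by (simp add: tmean_0)
next
  case (Suc t)
  have "tmean n (Suc t) (\<lambda>us. of_bool (set us \<inter> B \<noteq> {}))
      \<le> tmean n t (\<lambda>us. of_bool (set us \<inter> B \<noteq> {}) + real (card B) / real n)"
    unfolding tmean_Suc
  proof (rule tmean_mono)
    fix us
    have "(\<Sum>w<n. of_bool (set (w # us) \<inter> B \<noteq> {})) \<le> (\<Sum>w<n. of_bool (set us \<inter> B \<noteq> {}) + (of_bool (w \<in> B) :: real))"
      by (intro sum_mono) (auto simp: of_bool_def)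
    also have "\<dots> = real n * of_bool (set us \<inter> B \<noteq> {}) + real (card B)"
      by (simp only: sum.distrib card_eq_sum_of_bool[OF B]) simp
    finally have "(\<Sum>w<n. of_bool (set (w # us) \<inter> B \<noteq> {})) / real n
      \<le> (real n * of_bool (set us \<inter> B \<noteq> {}) + real (card B)) / real n"
      by (rule divide_right_mono) simp
    also have "\<dots> = of_bool (set us \<inter> B \<noteq> {}) + real (card B) / real n"
      using n by (simp add: add_divide_distrib)
    finally show "(\<Sum>w<n. of_bool (set (w # us) \<inter> B \<noteq> {})) / real n
      \<le> of_bool (set us \<inter> B \<noteq> {}) + real (card B) / real n" .
  qed
  also have "\<dots> = tmean n t (\<lambda>us. of_bool (set us \<inter> B \<noteq> {})) + real (card B) / real n"
    using n by (simp add: tmean_add tmean_const)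
  also have "\<dots> \<le> real (Suc t) * real (card B) / real n"
    using Suc by (simp add: add_divide_distrib algebra_simps)
  finally show ?case .
qed

lemma tavg_hit:
  assumes B: "B \<subseteq> {..<n}" and n: "n > 0" and T: "T > 0"
  shows "tavg T n (\<lambda>us. of_bool (set us \<inter> B \<noteq> {})) \<le> real T * real (card B) / real n"
proof -
  have "(\<Sum>t<T. tmean n t (\<lambda>us. of_bool (set us \<inter> B \<noteq> {}))) \<le> (\<Sum>t<T. real T * real (card B) / real n)"
  proof (rule sum_mono)
    fix t assume "t \<in> {..<T}"
    then have "real t * real (card B) / real n \<le> real T * real (card B) / real n"
      by (intro divide_right_mono mult_right_mono) auto
    with tmean_hit[OF B n, of t]
    show "tmean n t (\<lambda>us. of_bool (set us \<inter> B \<noteq> {})) \<le> real T * real (card B) / real n" by linarith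
  qed
  then show ?thesis using T by (simp add: tavg_def divide_le_eq mult.commute)
qed

section \<open>Lists of cut edges\<close>

definition pair_edges :: "(nat \<times> nat) list \<Rightarrow> nat set set" where
  "pair_edges l = (\<lambda>(v, w). {v, w}) ` set l"

text \<open>The order only decides how \<open>err\<close> reveals the outer spins. Any fixed order
  will do, since the sum that bounds the error runs over all lists.\<close>

definition cut_list :: "nat \<Rightarrow> nat set set \<Rightarrow> nat set \<Rightarrow> (nat \<times> nat) list" where
  "cut_list n E B = (SOME l. distinct l \<and> set l = cut_pairs n E B)"

lemma cut_list:
  assumes "B \<subseteq> {..<n}"
  shows "distinct (cut_list n E B)" "set (cut_list n E B) = cut_pairs n E B"
  using someI_ex[OF finite_distinct_list[OF finite_cut_pairs[OF assms, of E], THEN ex_forward], of "\<lambda>l. distinct l \<and> set l = cut_pairs n E B"]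
  unfolding cut_list_def by auto

lemma length_cut_list:
  assumes "B \<subseteq> {..<n}"
  shows "length (cut_list n E B) = card (cut_pairs n E B)"
  using distinct_card[OF cut_list(1)[OF assms, of E]] cut_list(2)[OF assms, of E] by simp

text \<open>Listed pairs have exactly one end in B, so distinct pairs give distinct edges and the
  exponent of \<open>odds p\<close> is the length of the list.\<close>

lemma pair_edges_cut_list:
  assumes "B \<subseteq> {..<n}"
  shows "pair_edges (cut_list n E B) \<subseteq> E" "card (pair_edges (cut_list n E B)) = length (cut_list n E B)"
    "\<And>e. e \<in> pair_edges (cut_list n E B) \<Longrightarrow> \<not> e \<subseteq> B"
proof -
  have "inj_on (\<lambda>(v, w). {v, w}) (cut_pairs n E B)"
    by (rule inj_onI) (auto simp: cut_pairs_def doubleton_eq_iff)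
  then show "card (pair_edges (cut_list n E B)) = length (cut_list n E B)"
    unfolding pair_edges_def cut_list(2)[OF assms] length_cut_list[OF assms] by (rule card_image)
qed (auto simp: pair_edges_def cut_list(2)[OF assms] cut_pairs_def)

definition pin_err :: "nat \<Rightarrow> nat \<Rightarrow> real \<Rightarrow> nat set set \<Rightarrow> nat list \<Rightarrow> nat list \<Rightarrow> (nat \<Rightarrow> nat) \<Rightarrow> real" where
  "pin_err n q \<beta> E us ws = err (cfg {..<n} q) (potts_w \<beta> E) q us ws"

text \<open>The error \<delta> of \<open>vertex_cut\<close> for the ball around u, hence computed in
  the graph without the cut edges.\<close>

definition local_err :: "nat \<Rightarrow> nat \<Rightarrow> real \<Rightarrow> nat set set \<Rightarrow> nat \<Rightarrow> nat \<Rightarrow> nat list \<Rightarrow> (nat \<Rightarrow> nat) \<Rightarrow> real" where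
  "local_err n q \<beta> E u r us = (let l = cut_list n E (ball E u r) in
     pin_err n q \<beta> (E - pair_edges l) us (map snd l))"

text \<open>Mean over \<tau> drawn from the Potts measure of E. The function f may refer to another
  graph, which is the mismatch that \<open>gmean_delete_edges\<close> repairs.\<close>

definition gmean :: "nat \<Rightarrow> nat \<Rightarrow> real \<Rightarrow> nat set set \<Rightarrow> ((nat \<Rightarrow> nat) \<Rightarrow> real) \<Rightarrow> real" where
  "gmean n q \<beta> E f = wavg (potts_w \<beta> E) (cfg {..<n} q) f"

lemma pin_err_nonneg: "q > 0 \<Longrightarrow> pin_err n q \<beta> E us ws \<tau> \<ge> 0"
  unfolding pin_err_def by (rule weighted_configs.err_nonneg[OF weighted_configs_potts])

lemma local_err_nonneg: "q > 0 \<Longrightarrow> local_err n q \<beta> E u r us \<tau> \<ge> 0"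
  unfolding local_err_def Let_def by (rule pin_err_nonneg)

lemma gmean_nonneg: "(\<And>\<tau>. \<tau> \<in> cfg {..<n} q \<Longrightarrow> f \<tau> \<ge> 0) \<Longrightarrow> gmean n q \<beta> E f \<ge> 0"
  unfolding gmean_def by (intro wavg_nonneg) (auto simp: potts_w_pos)

text \<open>Pinning needs \<tau> drawn from the same graph in which the error is computed. Dropping
  F does not decrease any weight, and it increases the partition function by at most exp(\<beta> K),
  as each edge has a factor of at least exp(-\<beta>).\<close>

lemma gmean_delete_edges:
  assumes \<beta>: "\<beta> \<ge> 0" and q: "q > 0" and E: "finite E" and F: "F \<subseteq> E" "card F \<le> K"
    and f: "\<And>\<tau>. \<tau> \<in> cfg {..<n} q \<Longrightarrow> f \<tau> \<ge> 0"
  shows "gmean n q \<beta> E f \<le> exp (\<beta> * real K) * gmean n q \<beta> (E - F) f"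
proof -
  let ?\<Omega> = "cfg {..<n} q"
  have finF: "finite F" using E F finite_subset by blast
  have split: "potts_w \<beta> E \<tau> = potts_w \<beta> (E - F) \<tau> * potts_w \<beta> F \<tau>" for \<tau>
  proof -
    have "potts_w \<beta> ((E - F) \<union> F) \<tau> = potts_w \<beta> (E - F) \<tau> * potts_w \<beta> F \<tau>"
      using E finF by (intro potts_w_Un) auto
    moreover have "(E - F) \<union> F = E" using F by auto
    ultimately show ?thesis by simp
  qed
  have lower: "potts_w \<beta> F \<tau> \<ge> exp (- (\<beta> * real K))" for \<tau>
  proof -
    have "mono_count F \<tau> \<le> card F" unfolding mono_count_def using finF by (intro card_mono) auto
    then have "real (mono_count F \<tau>) \<le> real K" using F by simp
    then have "\<beta> * real (mono_count F \<tau>) \<le> \<beta> * real K" using \<beta> by (intro mult_left_mono)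
    then show ?thesis by (simp add: potts_w_def)
  qed
  have num: "(\<Sum>\<tau>\<in>?\<Omega>. potts_w \<beta> E \<tau> * f \<tau>) \<le> (\<Sum>\<tau>\<in>?\<Omega>. potts_w \<beta> (E - F) \<tau> * f \<tau>)"
  proof (intro sum_mono mult_right_mono f)
    fix \<tau>
    show "potts_w \<beta> E \<tau> \<le> potts_w \<beta> (E - F) \<tau>"
      unfolding split using mult_left_mono[OF potts_w_le_1[OF \<beta>], of "potts_w \<beta> (E - F) \<tau>" F \<tau>]
        potts_w_pos[of \<beta> "E - F" \<tau>] by simp
  qed
  have den: "(\<Sum>\<tau>\<in>?\<Omega>. potts_w \<beta> E \<tau>) \<ge> exp (- (\<beta> * real K)) * (\<Sum>\<tau>\<in>?\<Omega>. potts_w \<beta> (E - F) \<tau>)"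
    unfolding sum_distrib_left split using lower potts_w_pos
    by (intro sum_mono) (simp add: mult.commute mult_left_mono less_imp_le)
  have pos: "(\<Sum>\<tau>\<in>?\<Omega>. potts_w \<beta> (E - F) \<tau>) > 0"
    using cfg_nonempty[OF q] by (intro sum_pos) (auto simp: finite_cfg potts_w_pos)
  have num0: "(\<Sum>\<tau>\<in>?\<Omega>. potts_w \<beta> (E - F) \<tau> * f \<tau>) \<ge> 0"
    using f by (intro sum_nonneg mult_nonneg_nonneg) (auto simp: potts_w_pos less_imp_le)
  have "gmean n q \<beta> E f \<le> (\<Sum>\<tau>\<in>?\<Omega>. potts_w \<beta> (E - F) \<tau> * f \<tau>) / (exp (- (\<beta> * real K)) * (\<Sum>\<tau>\<in>?\<Omega>. potts_w \<beta> (E - F) \<tau>))"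
    unfolding gmean_def wavg_def using num den pos num0 by (intro frac_le) auto
  also have "\<dots> = exp (\<beta> * real K) * gmean n q \<beta> (E - F) f"
    by (simp add: gmean_def wavg_def exp_minus field_simps)
  finally show ?thesis .
qed

section \<open>Summing over all candidate cuts\<close>

definition pair_lists :: "nat \<Rightarrow> nat \<Rightarrow> (nat \<times> nat) list set" where
  "pair_lists n K = {l. length l \<le> K \<and> set l \<subseteq> {..<n} \<times> {..<n} \<and> pair_edges l \<subseteq> all_pairs n \<and> card (pair_edges l) = length l}"

lemma finite_pair_lists: "finite (pair_lists n K)"
proof (rule finite_subset)
  show "pair_lists n K \<subseteq> {l. set l \<subseteq> {..<n} \<times> {..<n} \<and> length l \<le> K}" by (auto simp: pair_lists_def)
  show "finite {l. set l \<subseteq> {..<n} \<times> {..<n} \<and> length l \<le> K}" by (rule finite_lists_length_le) simp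
qed

text \<open>The indicator survives the deletion of the cut edges and leaves at most \<open>K ^ k\<close> choices for \<open>k\<close> inner
  endpoints, while the outer endpoints stay unrestricted.\<close>
definition small_ball_err :: "nat \<Rightarrow> nat \<Rightarrow> nat \<Rightarrow> real \<Rightarrow> nat \<Rightarrow> nat \<Rightarrow> nat list \<Rightarrow> nat set set \<Rightarrow> (nat \<times> nat) list \<Rightarrow> real" where
  "small_ball_err K n q \<beta> u r us E l =
     of_bool (card (ball E u r) \<le> K \<and> fst ` set l \<subseteq> ball E u r) * gmean n q \<beta> E (pin_err n q \<beta> E us (map snd l))"

lemma small_ball_err_nonneg: "q > 0 \<Longrightarrow> small_ball_err K n q \<beta> u r us E l \<ge> 0"
  unfolding small_ball_err_def by (intro mult_nonneg_nonneg gmean_nonneg pin_err_nonneg) auto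

text \<open>The actual cut list is one of the candidates, and its deletion leaves the ball
  unchanged, so its term carries the error; all other terms are nonnegative.\<close>

lemma local_err_le_sum:
  assumes \<beta>: "\<beta> \<ge> 0" and q: "q > 0" and E: "E \<subseteq> all_pairs n" and u: "u < n"
  shows "of_bool (small_cut K n E u r) * gmean n q \<beta> E (local_err n q \<beta> E u r us)
    \<le> exp (\<beta> * real K) * (\<Sum>l\<in>pair_lists n K. of_bool (pair_edges l \<subseteq> E) * small_ball_err K n q \<beta> u r us (E - pair_edges l) l)"
proof (cases "small_cut K n E u r")
  case True
  define B where "B = ball E u r"
  define l where "l = cut_list n E B"
  have B: "B \<subseteq> {..<n}" unfolding B_def by (rule ball_subset[OF E u])
  have small: "card B \<le> K" "length l \<le> K"
    using True length_cut_list[OF B] by (auto simp: small_cut_def B_def l_def)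
  note pe = pair_edges_cut_list[OF B, where E = E, folded l_def]
  have fE: "finite E" using E finite_all_pairs finite_subset by blast
  have l: "l \<in> pair_lists n K"
    using small pe E B cut_list(2)[OF B, of E] by (auto simp: pair_lists_def l_def cut_pairs_def)
  have ball: "ball (E - pair_edges l) u r = B"
    using pe(3) unfolding B_def by (intro ball_delete)
  have "fst ` set l \<subseteq> B" using cut_list(2)[OF B, of E] by (auto simp: l_def cut_pairs_def)
  then have s: "small_ball_err K n q \<beta> u r us (E - pair_edges l) l
      = gmean n q \<beta> (E - pair_edges l) (pin_err n q \<beta> (E - pair_edges l) us (map snd l))"
    using small by (simp add: small_ball_err_def ball)
  have "gmean n q \<beta> E (local_err n q \<beta> E u r us)
      \<le> exp (\<beta> * real K) * gmean n q \<beta> (E - pair_edges l) (local_err n q \<beta> E u r us)"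
    using pe small by (intro gmean_delete_edges \<beta> q fE local_err_nonneg) auto
  also have loc: "local_err n q \<beta> E u r us = pin_err n q \<beta> (E - pair_edges l) us (map snd l)"
    by (simp add: local_err_def l_def B_def Let_def)
  also have "gmean n q \<beta> (E - pair_edges l) (pin_err n q \<beta> (E - pair_edges l) us (map snd l))
      = of_bool (pair_edges l \<subseteq> E) * small_ball_err K n q \<beta> u r us (E - pair_edges l) l"
    using pe(1) s by simp
  also have "\<dots> \<le> (\<Sum>l\<in>pair_lists n K. of_bool (pair_edges l \<subseteq> E) * small_ball_err K n q \<beta> u r us (E - pair_edges l) l)"
    using l by (intro member_le_sum finite_pair_lists mult_nonneg_nonneg small_ball_err_nonneg[OF q]) auto
  finally show ?thesis using True by (simp add: loc)
next
  case False
  have "(\<Sum>l\<in>pair_lists n K. of_bool (pair_edges l \<subseteq> E) * small_ball_err K n q \<beta> u r us (E - pair_edges l) l) \<ge> 0"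
    by (intro sum_nonneg mult_nonneg_nonneg small_ball_err_nonneg[OF q]) auto
  with False show ?thesis by simp
qed

text \<open>For length k the inner ends have at most K^k choices and the outer ends run over all n^k
  tuples. Since n a \<le> c, the powers of n cancel and leave at most (c K)^k times the mean of g
  over uniform tuples.\<close>

lemma sum_pair_lists_le:
  fixes g :: "nat list \<Rightarrow> real" and a :: real
  assumes B: "B \<subseteq> {..<n}" "card B \<le> K" and g: "\<And>ws. g ws \<ge> 0" and a: "a \<ge> 0" "real n * a \<le> c"
    and avg: "\<And>k. k \<le> K \<Longrightarrow> tmean n k g \<le> \<eta>" and n: "n > 0"
  shows "(\<Sum>l\<in>pair_lists n K. a ^ length l * (of_bool (fst ` set l \<subseteq> B) * g (map snd l))) \<le> (\<Sum>k\<le>K. (c * real K) ^ k) * \<eta>"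
proof -
  have finB: "finite B" using B finite_subset by blast
  define X where "X k = {vs. set vs \<subseteq> B \<and> length vs = k}" for k
  have finX: "finite (X k)" and cardX: "card (X k) = card B ^ k" for k
    unfolding X_def using finite_lists_length_eq[OF finB] card_lists_length_eq[OF finB] by auto
  define Y where "Y k = {l. length l = k \<and> set l \<subseteq> B \<times> {..<n}}" for k
  have finY: "finite (Y k)" for k
    unfolding Y_def using finite_lists_length_eq[of "B \<times> {..<n}" k] finB by (simp add: conj_commute)
  have Ysum: "(\<Sum>l\<in>Y k. g (map snd l)) = real (card B) ^ k * (\<Sum>ws\<in>tuples n k. g ws)" for k
  proof -
    have "(\<Sum>l\<in>Y k. g (map snd l)) = (\<Sum>(vs, ws)\<in>X k \<times> tuples n k. g ws)"
    proof (rule sum.reindex_bij_witness[where j = "\<lambda>l. (map fst l, map snd l)" and i = "\<lambda>(vs, ws). zip vs ws"])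
      fix l assume "l \<in> Y k"
      then show "(map fst l, map snd l) \<in> X k \<times> tuples n k" by (auto simp: X_def Y_def tuples_def)
    next
      fix b assume "b \<in> X k \<times> tuples n k"
      then show "(case b of (vs, ws) \<Rightarrow> zip vs ws) \<in> Y k"
        by (auto simp: X_def Y_def tuples_def dest: set_zip_leftD set_zip_rightD)
    qed (auto simp: X_def Y_def tuples_def zip_map_fst_snd)
    also have "\<dots> = (\<Sum>vs\<in>X k. \<Sum>ws\<in>tuples n k. g ws)" by (rule sum.cartesian_product[symmetric])
    finally show ?thesis by (simp add: cardX)
  qed
  have "(\<Sum>l\<in>pair_lists n K. a ^ length l * (of_bool (fst ` set l \<subseteq> B) * g (map snd l)))
      \<le> (\<Sum>l\<in>(\<Union>k\<in>{..K}. Y k). a ^ length l * g (map snd l))"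
  proof -
    have "(\<Sum>l\<in>pair_lists n K. a ^ length l * (of_bool (fst ` set l \<subseteq> B) * g (map snd l)))
        = (\<Sum>l\<in>{l \<in> pair_lists n K. fst ` set l \<subseteq> B}. a ^ length l * g (map snd l))"
      by (subst sum.inter_filter[OF finite_pair_lists]) (auto intro!: sum.cong)
    also have "\<dots> \<le> (\<Sum>l\<in>(\<Union>k\<in>{..K}. Y k). a ^ length l * g (map snd l))"
    proof (rule sum_mono2)
      show "finite (\<Union>k\<in>{..K}. Y k)" using finY by blast
    next
      show "{l \<in> pair_lists n K. fst ` set l \<subseteq> B} \<subseteq> (\<Union>k\<in>{..K}. Y k)"
      proof
        fix l assume l: "l \<in> {l \<in> pair_lists n K. fst ` set l \<subseteq> B}"
        have "x \<in> B \<times> {..<n}" if x: "x \<in> set l" for x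
        proof -
          have "fst x \<in> B" "x \<in> {..<n} \<times> {..<n}" using l x by (auto simp: pair_lists_def)
          then show ?thesis by (simp add: mem_Times_iff)
        qed
        then show "l \<in> (\<Union>k\<in>{..K}. Y k)" using l unfolding Y_def pair_lists_def by blast
      qed
    qed (use a g in auto)
    finally show ?thesis .
  qed
  also have "\<dots> = (\<Sum>k\<le>K. \<Sum>l\<in>Y k. a ^ length l * g (map snd l))"
    by (rule sum.UNION_disjoint) (auto simp: finY, auto simp: Y_def)
  also have "\<dots> = (\<Sum>k\<le>K. a ^ k * (\<Sum>l\<in>Y k. g (map snd l)))"
    unfolding sum_distrib_left by (intro sum.cong refl) (auto simp: Y_def)
  also have "\<dots> = (\<Sum>k\<le>K. (real n * a * real (card B)) ^ k * tmean n k g)"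
    unfolding Ysum tmean_def using n by (intro sum.cong refl) (simp add: power_mult_distrib)
  also have "\<dots> \<le> (\<Sum>k\<le>K. (c * real K) ^ k * \<eta>)"
  proof (rule sum_mono)
    fix k assume k: "k \<in> {..K}"
    have c0: "0 \<le> c" using a by (intro order_trans[OF _ a(2)]) simp
    have "real n * a * real (card B) \<le> c * real K" using a c0 B by (intro mult_mono) auto
    then have "(real n * a * real (card B)) ^ k \<le> (c * real K) ^ k" using a by (intro power_mono) auto
    moreover have "tmean n k g \<le> \<eta>" using k by (intro avg) simp
    moreover have "tmean n k g \<ge> 0" by (intro tmean_nonneg g)
    moreover have "0 \<le> (c * real K) ^ k" using c0 by simp
    ultimately show "(real n * a * real (card B)) ^ k * tmean n k g \<le> (c * real K) ^ k * \<eta>"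
      by (intro mult_mono)
  qed
  finally show ?thesis by (simp add: sum_distrib_right)
qed

text \<open>Once the candidate edges are deleted, the bound no longer requires the graph to contain
  them. For each fixed graph the outer ends are then free, and the assumed pinning bound applies
  because it holds for every E.\<close>

lemma mean_local_err:
  assumes p: "0 < p" "p < 1" and c: "real n * odds p \<le> c" and \<beta>: "\<beta> \<ge> 0" and q: "q > 0" and u: "u < n" and T: "T > 0"
    and pinning: "\<And>E k. k \<le> K \<Longrightarrow> tavg T n (\<lambda>us. tmean n k (\<lambda>ws. gmean n q \<beta> E (pin_err n q \<beta> E us ws))) \<le> \<eta>"
    and \<eta>: "\<eta> \<ge> 0"
  shows "graph_mean n p (\<lambda>E. tavg T n (\<lambda>us. of_bool (small_cut K n E u r) * gmean n q \<beta> E (local_err n q \<beta> E u r us)))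
    \<le> exp (\<beta> * real K) * ((\<Sum>k\<le>K. (c * real K) ^ k) * \<eta>)"
proof -
  have n: "n > 0" using u by simp
  have o0: "odds p \<ge> 0" using p by (simp add: odds_def)
  have c0: "c \<ge> 0" using o0 by (intro order_trans[OF _ c]) simp
  let ?F = "small_ball_err K n q \<beta> u r"
  define h where "h E l = tavg T n (\<lambda>us. ?F us E l)" for E l
  have h0: "h E l \<ge> 0" for E l unfolding h_def by (intro tavg_nonneg small_ball_err_nonneg q)
  have "graph_mean n p (\<lambda>E. tavg T n (\<lambda>us. of_bool (small_cut K n E u r) * gmean n q \<beta> E (local_err n q \<beta> E u r us)))
    \<le> graph_mean n p (\<lambda>E. tavg T n (\<lambda>us. exp (\<beta> * real K) * (\<Sum>l\<in>pair_lists n K. of_bool (pair_edges l \<subseteq> E) * ?F us (E - pair_edges l) l)))"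
    by (intro graph_mean_mono p tavg_mono local_err_le_sum \<beta> q u)
  also have "\<dots> = exp (\<beta> * real K) * (\<Sum>l\<in>pair_lists n K. graph_mean n p (\<lambda>E. of_bool (pair_edges l \<subseteq> E) * h (E - pair_edges l) l))"
    unfolding tavg_cmult tavg_sum graph_mean_cmult graph_mean_sum h_def ..
  also have "\<dots> \<le> exp (\<beta> * real K) * (\<Sum>l\<in>pair_lists n K. odds p ^ length l * graph_mean n p (\<lambda>E. h E l))"
  proof (intro mult_left_mono sum_mono)
    fix l assume "l \<in> pair_lists n K"
    then have "pair_edges l \<subseteq> all_pairs n" "card (pair_edges l) = length l" by (auto simp: pair_lists_def)
    then show "graph_mean n p (\<lambda>E. of_bool (pair_edges l \<subseteq> E) * h (E - pair_edges l) l) \<le> odds p ^ length l * graph_mean n p (\<lambda>E. h E l)"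
      using graph_mean_delete_edges[OF p, of "pair_edges l" n "\<lambda>E. h E l"] h0 by simp
  qed simp
  also have "\<dots> = exp (\<beta> * real K) * graph_mean n p (\<lambda>E. \<Sum>l\<in>pair_lists n K. odds p ^ length l * h E l)"
    unfolding graph_mean_sum graph_mean_cmult ..
  also have "\<dots> \<le> exp (\<beta> * real K) * graph_mean n p (\<lambda>E. (\<Sum>k\<le>K. (c * real K) ^ k) * \<eta>)"
  proof (intro mult_left_mono graph_mean_mono p)
    fix E assume E: "E \<subseteq> all_pairs n"
    show "(\<Sum>l\<in>pair_lists n K. odds p ^ length l * h E l) \<le> (\<Sum>k\<le>K. (c * real K) ^ k) * \<eta>"
    proof (cases "card (ball E u r) \<le> K")
      case True
      define g where "g ws = tavg T n (\<lambda>us. gmean n q \<beta> E (pin_err n q \<beta> E us ws))" for ws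
      have "h E l = of_bool (fst ` set l \<subseteq> ball E u r) * g (map snd l)" for l
        unfolding h_def small_ball_err_def g_def tavg_cmult using True by simp
      moreover have "(\<Sum>l\<in>pair_lists n K. odds p ^ length l * (of_bool (fst ` set l \<subseteq> ball E u r) * g (map snd l)))
          \<le> (\<Sum>k\<le>K. (c * real K) ^ k) * \<eta>"
      proof (rule sum_pair_lists_le[OF ball_subset[OF E u] True _ o0 c _ n])
        show "g ws \<ge> 0" for ws unfolding g_def by (intro tavg_nonneg gmean_nonneg pin_err_nonneg q)
        show "tmean n k g \<le> \<eta>" if "k \<le> K" for k
        proof -
          \<comment> \<open>Outer ends and pins are averaged independently, so the two means may be
            exchanged to reach the form of the pinning bound.\<close>
          have "tmean n k g = tavg T n (\<lambda>us. tmean n k (\<lambda>ws. gmean n q \<beta> E (pin_err n q \<beta> E us ws)))"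
            unfolding g_def by (rule tmean_tavg)
          then show ?thesis using pinning[OF that] by simp
        qed
      qed
      ultimately show ?thesis by simp
    next
      case False
      have "h E l = 0" for l
        unfolding h_def small_ball_err_def tavg_cmult using False by simp
      moreover have "(\<Sum>k\<le>K. (c * real K) ^ k) * \<eta> \<ge> 0" using c0 \<eta> by (intro mult_nonneg_nonneg sum_nonneg) auto
      ultimately show ?thesis by simp
    qed
  qed simp
  also have "\<dots> = exp (\<beta> * real K) * ((\<Sum>k\<le>K. (c * real K) ^ k) * \<eta>)"
    using p by (simp add: graph_mean_const)
  finally show ?thesis .
qed

section \<open>Errors at single vertices\<close>

definition amp :: "real \<Rightarrow> nat \<Rightarrow> real" where
  "amp \<beta> K = exp (\<beta> * real K) * (1 + 2 * real K * exp (\<beta> * real K))"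

lemma amp_nonneg: "amp \<beta> K \<ge> 0"
  by (simp add: amp_def)

context vertex_cut
begin

lemma \<delta>_eq: "\<delta> = pin_err n q \<beta> (E - pair_edges es) us (map snd es) \<tau>0"
proof -
  have "pair_edges es = cut_edge ` {..<k}"
    unfolding pair_edges_def cut_edge_def[abs_def] set_conv_nth by (auto simp: case_prod_unfold)
  then show ?thesis by (simp add: \<delta>_def pin_err_def W0_def E0_def)
qed

text \<open>\<open>amp\<close> is the ratio of \<open>D / m\<close> to \<delta> with m =
  exp(-\<beta> k) inserted and k then raised to K.\<close>

lemma bound_le_amp:
  assumes "k \<le> K"
  shows "D / m \<le> amp \<beta> K * \<delta>"
proof -
  define x where "x = exp (\<beta> * real k)"
  define y where "y = exp (\<beta> * real K)"
  have xy: "0 < x" "x \<le> y" using assms beta by (auto simp: x_def y_def)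
  have m: "m = 1 / x" by (simp add: m_def x_def exp_minus divide_inverse)
  have "D / m = x * (1 + 2 * real k * x) * \<delta>" by (simp add: D_def m)
  also have "\<dots> \<le> y * (1 + 2 * real K * y) * \<delta>"
    using xy assms \<delta>_nonneg by (intro mult_mono add_mono) auto
  finally show ?thesis by (simp add: amp_def y_def)
qed

end

lemma vertex_cut_ball:
  assumes "q > 0" "\<beta> > 0" "E \<subseteq> all_pairs n" "u < n" "\<tau> \<in> cfg {..<n} q" "set us \<inter> ball E u r = {}"
  shows "vertex_cut n q \<beta> E (ball E u r) (cut_list n E (ball E u r)) us \<tau>"
  using assms ball_subset[OF assms(3,4)] cut_list[OF ball_subset[OF assms(3,4)], of E r]
  by unfold_locales (auto simp: cut_pairs_def)

lemma Zw_nonneg: "Zw \<beta> E S \<ge> 0"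
  unfolding Zw_def by (intro sum_nonneg less_imp_le potts_w_pos)

lemma Zw_mono: "finite S \<Longrightarrow> A \<subseteq> S \<Longrightarrow> Zw \<beta> E A \<le> Zw \<beta> E S"
  unfolding Zw_def by (intro sum_mono2) (auto simp: potts_w_pos less_imp_le)

lemma marg1_bounds: "finite S \<Longrightarrow> 0 \<le> marg1 \<beta> E S v \<omega>" "finite S \<Longrightarrow> marg1 \<beta> E S v \<omega> \<le> 1"
proof -
  assume fin: "finite S"
  show "0 \<le> marg1 \<beta> E S v \<omega>" unfolding marg1_def by (intro divide_nonneg_nonneg Zw_nonneg)
  have "Zw \<beta> E {\<sigma> \<in> S. \<sigma> v = \<omega>} \<le> Zw \<beta> E S" using fin by (intro Zw_mono) auto
  then show "marg1 \<beta> E S v \<omega> \<le> 1"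
    unfolding marg1_def using Zw_nonneg[of \<beta> E S] by (simp add: divide_le_eq_1 less_le)
qed

lemma sum_Zw_fibres_le:
  assumes fin: "finite S" "finite T"
  shows "(\<Sum>t\<in>T. Zw \<beta> E {\<sigma>\<in>S. f \<sigma> = t}) \<le> Zw \<beta> E S"
proof -
  have "(\<Sum>t\<in>T. Zw \<beta> E {\<sigma>\<in>S. f \<sigma> = t}) = Zw \<beta> E (\<Union>t\<in>T. {\<sigma>\<in>S. f \<sigma> = t})"
    unfolding Zw_def using fin by (intro sum.UNION_disjoint[symmetric]) auto
  also have "\<dots> \<le> Zw \<beta> E S" using fin by (intro Zw_mono) auto
  finally show ?thesis .
qed

lemma fibre_ratio_sum_le_1:
  assumes fin: "finite S" "finite T"
  shows "(\<Sum>t\<in>T. Zw \<beta> E {\<sigma>\<in>S. f \<sigma> = t} / Zw \<beta> E S) \<le> 1"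
  using sum_Zw_fibres_le[OF fin, of \<beta> E f] Zw_nonneg[of \<beta> E S]
  by (simp add: sum_divide_distrib[symmetric] divide_le_eq_1 less_le)

text \<open>Crude bound for exceptional vertices. Total mass at most 1 is enough, so a vanishing
  denominator, where the quotient is 0, causes no case distinction.\<close>

lemma sum_abs_diff_le_2:
  fixes f g :: "'a \<Rightarrow> real"
  assumes "\<And>x. x \<in> X \<Longrightarrow> f x \<ge> 0" "\<And>x. x \<in> X \<Longrightarrow> g x \<ge> 0" "sum f X \<le> 1" "sum g X \<le> 1"
  shows "(\<Sum>x\<in>X. \<bar>f x - g x\<bar>) \<le> 2"
proof -
  have "(\<Sum>x\<in>X. \<bar>f x - g x\<bar>) \<le> (\<Sum>x\<in>X. f x + g x)"
  proof (rule sum_mono)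
    fix x assume "x \<in> X"
    with assms(1,2)[of x] show "\<bar>f x - g x\<bar> \<le> f x + g x" by linarith
  qed
  with assms(3,4) show ?thesis by (simp add: sum.distrib)
qed

lemma damped_msg_le_1:
  assumes "\<beta> \<ge> 0" "finite S"
  shows "(1 - exp (- \<beta>)) * msg \<beta> E S w v a \<le> 1"
  using mult_mono[of "1 - exp (- \<beta>)" 1 "msg \<beta> E S w v a" 1] marg1_bounds[OF assms(2)] assms(1)
  by (simp add: msg_def)

lemma tv_barmu_le_1:
  assumes "\<beta> \<ge> 0" "finite S" "finite (ball E u r)"
  shows "tv (cfg (ball E u r) q) (barmu \<beta> q n E S u r) (margU \<beta> E S (ball E u r)) \<le> 1"
proof -
  have "barmu_num \<beta> q n E S u r \<tau> \<ge> 0" for \<tau>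
    unfolding barmu_num_def potts_dist_def using assms
    by (intro mult_nonneg_nonneg prod_nonneg ballI divide_nonneg_nonneg Zw_nonneg)
       (auto simp: potts_w_pos less_imp_le damped_msg_le_1)
  then have "(\<Sum>\<tau>\<in>cfg (ball E u r) q. \<bar>barmu \<beta> q n E S u r \<tau> - margU \<beta> E S (ball E u r) \<tau>\<bar>) \<le> 2"
    using assms unfolding barmu_def margU_def
    by (intro sum_abs_diff_le_2 normalized_sum_le_1 fibre_ratio_sum_le_1 divide_nonneg_nonneg sum_nonneg Zw_nonneg finite_cfg) auto
  then show ?thesis by (simp add: tv_def)
qed

lemma bp_term_le_2:
  assumes "\<beta> \<ge> 0" "finite S"
  shows "(\<Sum>\<omega><q. \<bar>msg \<beta> E S v w \<omega> - bp_prod \<beta> n E S v w \<omega> / (\<Sum>\<sigma><q. bp_prod \<beta> n E S v w \<sigma>)\<bar>) \<le> 2"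
proof -
  have "bp_prod \<beta> n E S v w \<omega> \<ge> 0" for \<omega>
    unfolding bp_prod_def using assms
    by (intro prod_nonneg ballI) (auto simp: damped_msg_le_1)
  then show ?thesis
    using assms unfolding msg_def marg1_def
    by (intro sum_abs_diff_le_2 normalized_sum_le_1 fibre_ratio_sum_le_1 divide_nonneg_nonneg sum_nonneg Zw_nonneg) auto
qed

text \<open>The trivial bound 1 applies if the cut is large or a pin lies in the ball, and
  \<open>barmu_bound\<close> otherwise. The second indicator includes \<open>small_cut\<close> so
  that its mean can be estimated with ball size at most K.\<close>

definition bethe_term :: "nat \<Rightarrow> nat \<Rightarrow> nat \<Rightarrow> real \<Rightarrow> nat \<Rightarrow> nat set set \<Rightarrow> nat list \<Rightarrow> (nat \<Rightarrow> nat) \<Rightarrow> nat \<Rightarrow> real" where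
  "bethe_term K n q \<beta> r E us \<tau> u = of_bool (\<not> small_cut K n E u r)
     + of_bool (set us \<inter> ball E u r \<noteq> {} \<and> small_cut K n E u r)
     + amp \<beta> K * (of_bool (small_cut K n E u r) * local_err n q \<beta> E u r us \<tau>)"

text \<open>Each neighbour contributes at most 2 if the degree is large or v is pinned, and
  \<open>bp_bound\<close> is used otherwise. The factor K bounds the number of neighbours, except in
  the first summand, which keeps the degree itself.\<close>

definition bp_term :: "nat \<Rightarrow> nat \<Rightarrow> nat \<Rightarrow> real \<Rightarrow> nat set set \<Rightarrow> nat list \<Rightarrow> (nat \<Rightarrow> nat) \<Rightarrow> nat \<Rightarrow> real" where
  "bp_term K n q \<beta> E us \<tau> v = 2 * (real (vertex_degree n E v) * of_bool (vertex_degree n E v > K))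
     + 2 * real K * of_bool (set us \<inter> {v} \<noteq> {})
     + 2 * real K * amp \<beta> K * (of_bool (small_cut K n E v 0) * local_err n q \<beta> E v 0 us \<tau>)"

lemma tv_barmu_le_bethe_term:
  fixes us :: "nat list"
  assumes q: "q > 0" and \<beta>: "\<beta> > 0" and E: "E \<subseteq> all_pairs n" and u: "u < n" and \<tau>: "\<tau> \<in> cfg {..<n} q"
  defines "S \<equiv> pin (cfg {..<n} q) us \<tau>"
  shows "tv (cfg (ball E u r) q) (barmu \<beta> q n E S u r) (margU \<beta> E S (ball E u r)) \<le> bethe_term K n q \<beta> r E us \<tau> u"
proof -
  have B: "ball E u r \<subseteq> {..<n}" by (rule ball_subset[OF E u])
  have fin: "finite S" "finite (ball E u r)"
    unfolding S_def using finite_subset[OF pin_subset finite_cfg] finite_subset[OF B] by auto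
  note le1 = tv_barmu_le_1[OF less_imp_le[OF \<beta>] fin(1,2), of q n]
  have le0: "local_err n q \<beta> E u r us \<tau> \<ge> 0" by (rule local_err_nonneg[OF q])
  consider "\<not> small_cut K n E u r" | "small_cut K n E u r" "set us \<inter> ball E u r \<noteq> {}"
    | "small_cut K n E u r" "set us \<inter> ball E u r = {}" by blast
  then show ?thesis
  proof cases
    case 3
    interpret cut: vertex_cut n q \<beta> E "ball E u r" "cut_list n E (ball E u r)" us \<tau>
      by (rule vertex_cut_ball[OF q \<beta> E u \<tau> 3(2)])
    have "length (cut_list n E (ball E u r)) \<le> K"
      using 3(1) length_cut_list[OF B] by (simp add: small_cut_def)
    from cut.bound_le_amp[OF this] cut.barmu_bound[OF refl]
    have "tv (cfg (ball E u r) q) (barmu \<beta> q n E S u r) (margU \<beta> E S (ball E u r)) \<le> amp \<beta> K * cut.\<delta>"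
      by (simp add: cut.S_def S_def)
    also have "cut.\<delta> = local_err n q \<beta> E u r us \<tau>" by (simp add: cut.\<delta>_eq local_err_def Let_def)
    finally show ?thesis using 3 by (simp add: bethe_term_def)
  next
    case 2
    have "amp \<beta> K * local_err n q \<beta> E u r us \<tau> \<ge> 0" using amp_nonneg le0 by (intro mult_nonneg_nonneg)
    then show ?thesis using 2 le1 by (simp add: bethe_term_def)
  qed (use le1 in \<open>simp add: bethe_term_def\<close>)
qed

lemma bp_sum_le_bp_term:
  fixes us :: "nat list"
  assumes q: "q > 0" and \<beta>: "\<beta> > 0" and E: "E \<subseteq> all_pairs n" and v: "v < n" and \<tau>: "\<tau> \<in> cfg {..<n} q"
    and K: "K > 0"
  defines "S \<equiv> pin (cfg {..<n} q) us \<tau>"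
  shows "(\<Sum>w<n. if {v, w} \<in> E then
        (\<Sum>\<omega><q. \<bar>msg \<beta> E S v w \<omega> - bp_prod \<beta> n E S v w \<omega> / (\<Sum>\<sigma><q. bp_prod \<beta> n E S v w \<sigma>)\<bar>) else 0)
    \<le> bp_term K n q \<beta> E us \<tau> v"
proof -
  define X where "X w = (\<Sum>\<omega><q. \<bar>msg \<beta> E S v w \<omega> - bp_prod \<beta> n E S v w \<omega> / (\<Sum>\<sigma><q. bp_prod \<beta> n E S v w \<sigma>)\<bar>)" for w
  have B: "ball E v 0 \<subseteq> {..<n}" by (rule ball_subset[OF E v])
  have fin: "finite S" unfolding S_def using finite_subset[OF pin_subset finite_cfg] by auto
  have bound: "(\<Sum>w<n. if {v, w} \<in> E then X w else 0) \<le> real (vertex_degree n E v) * x"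
    if "\<And>w. w < n \<Longrightarrow> {v, w} \<in> E \<Longrightarrow> X w \<le> x" for x
  proof -
    have "(\<Sum>w<n. if {v, w} \<in> E then X w else 0) \<le> (\<Sum>w<n. of_bool ({v, w} \<in> E) * x)"
      using that by (intro sum_mono) auto
    then show ?thesis by (simp only: vertex_degree_eq_sum sum_distrib_right)
  qed
  have X2: "X w \<le> 2" for w unfolding X_def using \<beta> fin by (intro bp_term_le_2) auto
  \<comment> \<open>The ball of radius 0 is a single vertex, so with K > 0 only the degree remains
    to be checked.\<close>
  have sc: "small_cut K n E v 0 \<longleftrightarrow> vertex_degree n E v \<le> K"
    using vertex_degree_cut_pairs[OF E, of v] K by (auto simp: small_cut_def ball_0)
  have le0: "local_err n q \<beta> E v 0 us \<tau> \<ge> 0" by (rule local_err_nonneg[OF q])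
  consider "vertex_degree n E v > K" | "vertex_degree n E v \<le> K" "v \<in> set us"
    | "vertex_degree n E v \<le> K" "v \<notin> set us" by linarith
  then have "(\<Sum>w<n. if {v, w} \<in> E then X w else 0) \<le> bp_term K n q \<beta> E us \<tau> v"
  proof cases
    case 1
    then show ?thesis using bound[of 2, OF X2] sc by (simp add: bp_term_def)
  next
    case 2
    have "(\<Sum>w<n. if {v, w} \<in> E then X w else 0) \<le> 2 * real K"
      using bound[of 2, OF X2] 2 by simp
    also have "\<dots> \<le> bp_term K n q \<beta> E us \<tau> v"
      using 2 sc le0 amp_nonneg[of \<beta> K] by (simp add: bp_term_def)
    finally show ?thesis .
  next
    case 3
    then have disj: "set us \<inter> ball E v 0 = {}" by (simp add: ball_0)
    interpret cut: vertex_cut n q \<beta> E "ball E v 0" "cut_list n E (ball E v 0)" us \<tau>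
      by (rule vertex_cut_ball[OF q \<beta> E v \<tau> disj])
    let ?l = "cut_list n E (ball E v 0)"
    have len: "length ?l \<le> K"
      using 3(1) length_cut_list[OF B] vertex_degree_cut_pairs[OF E, of v] by simp
    have loc: "cut.\<delta> = local_err n q \<beta> E v 0 us \<tau>" by (simp add: cut.\<delta>_eq local_err_def Let_def)
    have "X w \<le> 2 * (amp \<beta> K * local_err n q \<beta> E v 0 us \<tau>)" if w: "w < n" "{v, w} \<in> E" for w
    proof -
      have "w \<noteq> v" using w E by (auto simp: all_pairs_def doubleton_eq_iff)
      then have "(v, w) \<in> set ?l" using w unfolding cut_list(2)[OF B] by (simp add: cut_pairs_def ball_0)
      then obtain j where j: "j < length ?l" "?l ! j = (v, w)" by (auto simp: in_set_conv_nth)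
      have "X w \<le> 2 * (cut.D / cut.m)"
        using cut.bp_bound[OF ball_0 j(1)] j(2) by (simp add: X_def S_def cut.S_def)
      also have "\<dots> \<le> 2 * (amp \<beta> K * cut.\<delta>)"
        using cut.bound_le_amp[OF len] by simp
      finally show ?thesis by (simp only: loc)
    qed
    then have "(\<Sum>w<n. if {v, w} \<in> E then X w else 0) \<le> real (vertex_degree n E v) * (2 * (amp \<beta> K * local_err n q \<beta> E v 0 us \<tau>))"
      by (rule bound)
    also have "\<dots> \<le> real K * (2 * (amp \<beta> K * local_err n q \<beta> E v 0 us \<tau>))"
      using 3 le0 amp_nonneg[of \<beta> K] by (intro mult_right_mono) auto
    also have "\<dots> \<le> bp_term K n q \<beta> E us \<tau> v"
      using 3 sc by (simp add: bp_term_def)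
    finally show ?thesis .
  qed
  then show ?thesis by (simp only: X_def)
qed

lemma marg1_eq_wavg: "finite S \<Longrightarrow> marg1 \<beta> E S v a = wavg (potts_w \<beta> E) S (\<lambda>\<sigma>. of_bool (\<sigma> v = a))"
  by (simp only: marg1_def Zw_Collect wavg_def) (simp add: Zw_def)

lemma marg2_eq_wavg: "finite S \<Longrightarrow> marg2 \<beta> E S v w a b = wavg (potts_w \<beta> E) S (\<lambda>\<sigma>. of_bool (\<sigma> v = a) * of_bool (\<sigma> w = b))"
  by (simp only: marg2_def Zw_Collect wavg_def of_bool_conj) (simp add: Zw_def)

text \<open>The product error of the two-element list, with indicators of the colours a and b as
  factors.\<close>

lemma pair_le_pin_err:
  fixes us :: "nat list"
  assumes q: "q > 0" and \<tau>: "\<tau> \<in> cfg {..<n} q" and vw: "v < n" "w < n"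
  defines "S \<equiv> pin (cfg {..<n} q) us \<tau>"
  shows "\<bar>marg2 \<beta> E S v w a b - marg1 \<beta> E S v a * marg1 \<beta> E S w b\<bar> \<le> pin_err n q \<beta> E us [v, w] \<tau>"
proof -
  interpret weighted_configs "cfg {..<n} q" "potts_w \<beta> E" q n by (rule weighted_configs_potts[OF q])
  have fin: "finite S" unfolding S_def by (rule finite_pin)
  define h where "h i c = (of_bool (c = (if i = 0 then a else b)) :: real)" for i c :: nat
  have two: "length [v, w] = Suc (Suc 0)" by simp
  have "\<bar>wavg (potts_w \<beta> E) S (\<lambda>\<sigma>. \<Prod>i<length [v, w]. h i (\<sigma> ([v, w] ! i)))
      - (\<Prod>i<length [v, w]. wavg (potts_w \<beta> E) S (\<lambda>\<sigma>. h i (\<sigma> ([v, w] ! i))))\<bar> \<le> pin_err n q \<beta> E us [v, w] \<tau>"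
    unfolding S_def pin_err_def by (rule wavg_product_err[OF \<tau>]) (auto simp: vw h_def)
  then show ?thesis
    unfolding two marg1_eq_wavg[OF fin] marg2_eq_wavg[OF fin]
    by (simp add: h_def lessThan_Suc mult.commute)
qed

text \<open>The pairs v < w are enlarged to all ordered pairs, whose mean is the mean over uniform
  lists of length 2; q^2 counts pairs of colours.\<close>

lemma pair_sum_le:
  fixes us :: "nat list"
  assumes q: "q > 0" and \<tau>: "\<tau> \<in> cfg {..<n} q"
  defines "S \<equiv> pin (cfg {..<n} q) us \<tau>"
  shows "(1 / (real n)^2) * (\<Sum>(v, w)\<in>{(v, w). v < w \<and> w < n}.
         tv ({..<q} \<times> {..<q}) (\<lambda>(a, b). marg2 \<beta> E S v w a b) (\<lambda>(a, b). marg1 \<beta> E S v a * marg1 \<beta> E S w b))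
    \<le> (real q)\<^sup>2 * tmean n 2 (\<lambda>ws. pin_err n q \<beta> E us ws \<tau>)"
proof -
  let ?e = "\<lambda>v w. pin_err n q \<beta> E us [v, w] \<tau>"
  have e0: "?e v w \<ge> 0" for v w by (rule pin_err_nonneg[OF q])
  have tv: "tv ({..<q} \<times> {..<q}) (\<lambda>(a, b). marg2 \<beta> E S v w a b) (\<lambda>(a, b). marg1 \<beta> E S v a * marg1 \<beta> E S w b)
      \<le> (real q)\<^sup>2 * ?e v w" if "v < n" "w < n" for v w
  proof -
    have "(\<Sum>x\<in>{..<q} \<times> {..<q}. \<bar>(case x of (a, b) \<Rightarrow> marg2 \<beta> E S v w a b) - (case x of (a, b) \<Rightarrow> marg1 \<beta> E S v a * marg1 \<beta> E S w b)\<bar>)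
      \<le> (\<Sum>x\<in>{..<q} \<times> {..<q}. ?e v w)"
    proof (rule sum_mono)
      fix x
      show "\<bar>(case x of (a, b) \<Rightarrow> marg2 \<beta> E S v w a b) - (case x of (a, b) \<Rightarrow> marg1 \<beta> E S v a * marg1 \<beta> E S w b)\<bar> \<le> ?e v w"
        using pair_le_pin_err[OF q \<tau> that] by (cases x) (simp add: S_def)
    qed
    also have "\<dots> = (real q)\<^sup>2 * ?e v w" by (simp add: power2_eq_square)
    finally have le: "(\<Sum>x\<in>{..<q} \<times> {..<q}. \<bar>(case x of (a, b) \<Rightarrow> marg2 \<beta> E S v w a b) - (case x of (a, b) \<Rightarrow> marg1 \<beta> E S v a * marg1 \<beta> E S w b)\<bar>)
      \<le> (real q)\<^sup>2 * ?e v w" .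
    have "(\<Sum>x\<in>{..<q} \<times> {..<q}. \<bar>(case x of (a, b) \<Rightarrow> marg2 \<beta> E S v w a b) - (case x of (a, b) \<Rightarrow> marg1 \<beta> E S v a * marg1 \<beta> E S w b)\<bar>) \<ge> 0"
      by (intro sum_nonneg) auto
    with le show ?thesis unfolding tv_def by linarith
  qed
  have "(\<Sum>(v, w)\<in>{(v, w). v < w \<and> w < n}.
         tv ({..<q} \<times> {..<q}) (\<lambda>(a, b). marg2 \<beta> E S v w a b) (\<lambda>(a, b). marg1 \<beta> E S v a * marg1 \<beta> E S w b))
      \<le> (\<Sum>(v, w)\<in>{(v, w). v < w \<and> w < n}. (real q)\<^sup>2 * ?e v w)"
    by (rule sum_mono) (use tv in auto)
  also have "\<dots> \<le> (\<Sum>(v, w)\<in>{..<n} \<times> {..<n}. (real q)\<^sup>2 * ?e v w)"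
    using e0 by (intro sum_mono2) auto
  also have "\<dots> = (\<Sum>v<n. \<Sum>w<n. (real q)\<^sup>2 * ?e v w)" by (rule sum.cartesian_product[symmetric])
  also have "\<dots> = (\<Sum>w<n. \<Sum>v<n. (real q)\<^sup>2 * ?e v w)" by (rule sum.swap)
  also have "\<dots> = (real q)\<^sup>2 * (\<Sum>ws\<in>tuples n 2. pin_err n q \<beta> E us ws \<tau>)"
    by (simp add: numeral_2_eq_2 sum_tuples_Suc tuples_0 sum_distrib_left)
  finally have "(1 / (real n)^2) * (\<Sum>(v, w)\<in>{(v, w). v < w \<and> w < n}.
         tv ({..<q} \<times> {..<q}) (\<lambda>(a, b). marg2 \<beta> E S v w a b) (\<lambda>(a, b). marg1 \<beta> E S v a * marg1 \<beta> E S w b))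
      \<le> (1 / (real n)^2) * ((real q)\<^sup>2 * (\<Sum>ws\<in>tuples n 2. pin_err n q \<beta> E us ws \<tau>))"
    by (rule mult_left_mono) simp
  then show ?thesis by (simp add: tmean_def)
qed

text \<open>The parts are nonnegative, so this one number below \<epsilon> certifies the Bethe
  condition, the decorrelation of pairs and the fixed point condition for the cell of
  \<tau>.\<close>

definition total_err :: "nat \<Rightarrow> nat \<Rightarrow> nat \<Rightarrow> real \<Rightarrow> nat \<Rightarrow> nat set set \<Rightarrow> nat list \<Rightarrow> (nat \<Rightarrow> nat) \<Rightarrow> real" where
  "total_err K n q \<beta> r E us \<tau> = (1 / real n) * (\<Sum>u<n. bethe_term K n q \<beta> r E us \<tau> u)
     + (real q)\<^sup>2 * tmean n 2 (\<lambda>ws. pin_err n q \<beta> E us ws \<tau>)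
     + (1 / real n) * (\<Sum>v<n. bp_term K n q \<beta> E us \<tau> v)"

lemma
  assumes q: "q > 0"
  shows bethe_term_nonneg: "bethe_term K n q \<beta> r E us \<tau> u \<ge> 0"
    and bp_term_nonneg: "bp_term K n q \<beta> E us \<tau> u \<ge> 0"
  using local_err_nonneg[OF q] amp_nonneg unfolding bethe_term_def bp_term_def
  by (intro add_nonneg_nonneg mult_nonneg_nonneg; simp)+

lemma total_err_parts:
  assumes q: "q > 0"
  shows "(1 / real n) * (\<Sum>u<n. bethe_term K n q \<beta> r E us \<tau> u) \<ge> 0"
    and "(real q)\<^sup>2 * tmean n 2 (\<lambda>ws. pin_err n q \<beta> E us ws \<tau>) \<ge> 0"
    and "(1 / real n) * (\<Sum>v<n. bp_term K n q \<beta> E us \<tau> v) \<ge> 0"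
  by (intro mult_nonneg_nonneg sum_nonneg tmean_nonneg bethe_term_nonneg bp_term_nonneg pin_err_nonneg q; simp)+

lemma bethe_state_bp_fixed_point:
  fixes us :: "nat list"
  assumes q: "q > 0" and \<beta>: "\<beta> > 0" and E: "E \<subseteq> all_pairs n" and \<tau>: "\<tau> \<in> cfg {..<n} q"
    and K: "K > 0" and small: "total_err K n q \<beta> r E us \<tau> < \<epsilon>"
  defines "S \<equiv> pin (cfg {..<n} q) us \<tau>"
  shows "bethe_state \<beta> q n E S \<epsilon> r" "bp_fixed_point \<beta> q n E S \<epsilon>"
proof -
  note parts = total_err_parts(1)[OF q, where n = n and K = K and \<beta> = \<beta> and r = r and E = E and us = us and \<tau> = \<tau>]
    total_err_parts(2)[OF q, where n = n and \<beta> = \<beta> and E = E and us = us and \<tau> = \<tau>]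
    total_err_parts(3)[OF q, where n = n and K = K and \<beta> = \<beta> and E = E and us = us and \<tau> = \<tau>]
    small[unfolded total_err_def]
  have "(1 / real n) * (\<Sum>u<n. tv (cfg (ball E u r) q) (barmu \<beta> q n E S u r) (margU \<beta> E S (ball E u r)))
      \<le> (1 / real n) * (\<Sum>u<n. bethe_term K n q \<beta> r E us \<tau> u)"
    unfolding S_def by (intro mult_left_mono sum_mono tv_barmu_le_bethe_term q \<beta> E \<tau>) auto
  moreover note pair_sum_le[OF q \<tau>, of \<beta> E us]
  ultimately show "bethe_state \<beta> q n E S \<epsilon> r"
    unfolding bethe_state_def S_def using parts by linarith
  have "(1 / real n) * (\<Sum>v<n. \<Sum>w<n. if {v, w} \<in> E then
        (\<Sum>\<omega><q. \<bar>msg \<beta> E S v w \<omega> - bp_prod \<beta> n E S v w \<omega> / (\<Sum>\<sigma><q. bp_prod \<beta> n E S v w \<sigma>)\<bar>) else 0)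
      \<le> (1 / real n) * (\<Sum>v<n. bp_term K n q \<beta> E us \<tau> v)"
    unfolding S_def by (intro mult_left_mono sum_mono bp_sum_le_bp_term q \<beta> E \<tau> K) auto
  then show "bp_fixed_point \<beta> q n E S \<epsilon>"
    unfolding bp_fixed_point_def using parts by linarith
qed

section \<open>Expected total error\<close>

lemma gmean_add: "gmean n q \<beta> E (\<lambda>\<tau>. f \<tau> + g \<tau>) = gmean n q \<beta> E f + gmean n q \<beta> E g"
  unfolding gmean_def by (rule wavg_add)

lemma gmean_cmult: "gmean n q \<beta> E (\<lambda>\<tau>. c * f \<tau>) = c * gmean n q \<beta> E f"
  unfolding gmean_def by (rule wavg_cmult)

lemma gmean_sum: "gmean n q \<beta> E (\<lambda>\<tau>. \<Sum>i\<in>I. f i \<tau>) = (\<Sum>i\<in>I. gmean n q \<beta> E (f i))"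
  unfolding gmean_def by (rule wavg_sum)

lemma gmean_const: "q > 0 \<Longrightarrow> gmean n q \<beta> E (\<lambda>_. c) = c"
  unfolding gmean_def by (rule wavg_const) (auto simp: finite_cfg cfg_nonempty potts_w_pos)

lemma gmean_tmean: "gmean n q \<beta> E (\<lambda>\<tau>. tmean m k (\<lambda>ws. f ws \<tau>)) = tmean m k (\<lambda>ws. gmean n q \<beta> E (f ws))"
proof -
  have "gmean n q \<beta> E (\<lambda>\<tau>. tmean m k (\<lambda>ws. f ws \<tau>)) = gmean n q \<beta> E (\<lambda>\<tau>. (1 / real m ^ k) * (\<Sum>ws\<in>tuples m k. f ws \<tau>))"
    by (simp add: tmean_def)
  then show ?thesis unfolding gmean_cmult gmean_sum by (simp add: tmean_def)
qed

definition bethe_mean :: "nat \<Rightarrow> nat \<Rightarrow> nat \<Rightarrow> real \<Rightarrow> nat \<Rightarrow> nat set set \<Rightarrow> nat list \<Rightarrow> nat \<Rightarrow> real" where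
  "bethe_mean K n q \<beta> r E us u = of_bool (\<not> small_cut K n E u r)
     + of_bool (set us \<inter> ball E u r \<noteq> {} \<and> small_cut K n E u r)
     + amp \<beta> K * (of_bool (small_cut K n E u r) * gmean n q \<beta> E (local_err n q \<beta> E u r us))"

definition bp_mean :: "nat \<Rightarrow> nat \<Rightarrow> nat \<Rightarrow> real \<Rightarrow> nat set set \<Rightarrow> nat list \<Rightarrow> nat \<Rightarrow> real" where
  "bp_mean K n q \<beta> E us v = 2 * (real (vertex_degree n E v) * of_bool (vertex_degree n E v > K))
     + 2 * real K * of_bool (set us \<inter> {v} \<noteq> {})
     + 2 * real K * amp \<beta> K * (of_bool (small_cut K n E v 0) * gmean n q \<beta> E (local_err n q \<beta> E v 0 us))"

lemma gmean_total_err: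
  assumes q: "q > 0"
  shows "gmean n q \<beta> E (total_err K n q \<beta> r E us) = (1 / real n) * (\<Sum>u<n. bethe_mean K n q \<beta> r E us u)
     + (real q)\<^sup>2 * tmean n 2 (\<lambda>ws. gmean n q \<beta> E (pin_err n q \<beta> E us ws))
     + (1 / real n) * (\<Sum>v<n. bp_mean K n q \<beta> E us v)"
proof -
  have "gmean n q \<beta> E (\<lambda>\<tau>. bethe_term K n q \<beta> r E us \<tau> u) = bethe_mean K n q \<beta> r E us u" for u
    unfolding bethe_term_def bethe_mean_def gmean_add gmean_cmult gmean_const[OF q] ..
  moreover have "gmean n q \<beta> E (\<lambda>\<tau>. bp_term K n q \<beta> E us \<tau> v) = bp_mean K n q \<beta> E us v" for v
    unfolding bp_term_def bp_mean_def gmean_add gmean_cmult gmean_const[OF q] ..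
  ultimately show ?thesis
    unfolding total_err_def[abs_def] gmean_add gmean_cmult gmean_sum gmean_tmean by simp
qed

text \<open>By linearity each vertex is treated separately: large cuts and degrees contribute of
  order 1/K, pins near the vertex of order 1/n, and failing factorisation a multiple of \<eta>
  depending on K.\<close>

lemma mean_total_err:
  assumes p: "0 < p" "p < 1" and c: "real n * odds p \<le> c" and \<beta>: "\<beta> \<ge> 0" and q: "q > 0" and n: "n > 0"
    and T: "T > 0" and K: "K \<ge> 2"
    and pinning: "\<And>E k. k \<le> K \<Longrightarrow> tavg T n (\<lambda>us. tmean n k (\<lambda>ws. gmean n q \<beta> E (pin_err n q \<beta> E us ws))) \<le> \<eta>"
    and \<eta>: "\<eta> \<ge> 0"
  defines "\<Lambda> \<equiv> exp (\<beta> * real K) * ((\<Sum>k\<le>K. (c * real K) ^ k) * \<eta>)"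
  shows "graph_mean n p (\<lambda>E. tavg T n (\<lambda>us. gmean n q \<beta> E (total_err K n q \<beta> r E us)))
    \<le> ((1 + c) ^ Suc r / real K + real T * real K / real n + amp \<beta> K * \<Lambda>)
      + (real q)\<^sup>2 * \<eta> + (2 * (c\<^sup>2 / real K) + 2 * real K * (real T / real n) + 2 * real K * amp \<beta> K * \<Lambda>)"
proof -
  have K0: "K > 0" using K by simp
  define Av where "Av F = graph_mean n p (\<lambda>E. tavg T n (F E))" for F
  have Av_add: "Av (\<lambda>E us. F E us + G E us) = Av F + Av G" for F G
    unfolding Av_def tavg_add graph_mean_add ..
  have Av_cmult: "Av (\<lambda>E us. a * F E us) = a * Av F" for F a
    unfolding Av_def tavg_cmult graph_mean_cmult ..
  have Av_sum: "Av (\<lambda>E us. \<Sum>i\<in>I. F i E us) = (\<Sum>i\<in>I. Av (F i))" for F and I :: "nat set"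
    unfolding Av_def tavg_sum graph_mean_sum ..
  have Av_us: "Av (\<lambda>E us. f E) = graph_mean n p f" for f
    unfolding Av_def tavg_const[OF T n] ..
  have mean_const: "(1 / real n) * (\<Sum>u<n. f u) \<le> a" if "\<And>u. u < n \<Longrightarrow> f u \<le> a" for f a
  proof -
    have "(\<Sum>u<n. f u) \<le> (\<Sum>u<n. a)" using that by (intro sum_mono) auto
    then show ?thesis using n by (simp add: field_simps)
  qed
  have hit: "tavg T n (\<lambda>us. of_bool (set us \<inter> B \<noteq> {})) \<le> real T * real k / real n"
    if "B \<subseteq> {..<n}" "card B \<le> k" for B k
  proof -
    have "real T * real (card B) / real n \<le> real T * real k / real n"
      using that by (intro divide_right_mono mult_left_mono) auto
    with tavg_hit[OF that(1) n T] show ?thesis by linarith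
  qed
  have loc: "Av (\<lambda>E us. of_bool (small_cut K n E u s) * gmean n q \<beta> E (local_err n q \<beta> E u s us)) \<le> \<Lambda>" if "u < n" for u s
    unfolding Av_def \<Lambda>_def by (rule mean_local_err[OF p c \<beta> q that T pinning \<eta>])
  have bethe: "Av (\<lambda>E us. bethe_mean K n q \<beta> r E us u) \<le> (1 + c) ^ Suc r / real K + real T * real K / real n + amp \<beta> K * \<Lambda>"
    if u: "u < n" for u
  proof -
    have "Av (\<lambda>E us. of_bool (set us \<inter> ball E u r \<noteq> {} \<and> small_cut K n E u r)) \<le> graph_mean n p (\<lambda>E. real T * real K / real n)"
      unfolding Av_def
    proof (intro graph_mean_mono p)
      fix E assume E: "E \<subseteq> all_pairs n"
      show "tavg T n (\<lambda>us. of_bool (set us \<inter> ball E u r \<noteq> {} \<and> small_cut K n E u r)) \<le> real T * real K / real n"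
      proof (cases "small_cut K n E u r")
        case True
        then have "card (ball E u r) \<le> K" by (simp add: small_cut_def)
        from hit[OF ball_subset[OF E u] this] True show ?thesis by simp
      next
        case False
        then show ?thesis using T n by (simp add: tavg_const)
      qed
    qed
    then have "Av (\<lambda>E us. of_bool (set us \<inter> ball E u r \<noteq> {} \<and> small_cut K n E u r)) \<le> real T * real K / real n"
      using p by (simp add: graph_mean_const)
    moreover have "Av (\<lambda>E us. of_bool (\<not> small_cut K n E u r)) \<le> (1 + c) ^ Suc r / real K"
      unfolding Av_us by (rule mean_not_small_cut[OF p u c K0])
    moreover have "amp \<beta> K * Av (\<lambda>E us. of_bool (small_cut K n E u r) * gmean n q \<beta> E (local_err n q \<beta> E u r us)) \<le> amp \<beta> K * \<Lambda>"
      by (intro mult_left_mono loc u amp_nonneg)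
    ultimately show ?thesis unfolding bethe_mean_def Av_add Av_cmult by linarith
  qed
  have bp: "Av (\<lambda>E us. bp_mean K n q \<beta> E us v) \<le> 2 * (c\<^sup>2 / real K) + 2 * real K * (real T / real n) + 2 * real K * amp \<beta> K * \<Lambda>"
    if v: "v < n" for v
  proof -
    have "Av (\<lambda>E us. of_bool (set us \<inter> {v} \<noteq> {})) \<le> graph_mean n p (\<lambda>E. real T / real n)"
      unfolding Av_def using hit[of "{v}" 1] v by (intro graph_mean_mono p) simp
    then have "Av (\<lambda>E us. of_bool (set us \<inter> {v} \<noteq> {})) \<le> real T / real n"
      using p by (simp add: graph_mean_const)
    then have "2 * real K * Av (\<lambda>E us. of_bool (set us \<inter> {v} \<noteq> {})) \<le> 2 * real K * (real T / real n)"
      by (rule mult_left_mono) simp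
    moreover have "Av (\<lambda>E us. real (vertex_degree n E v) * of_bool (vertex_degree n E v > K)) \<le> c\<^sup>2 / real K"
      unfolding Av_us by (rule mean_large_degree[OF p c K0])
    moreover have "2 * real K * amp \<beta> K * Av (\<lambda>E us. of_bool (small_cut K n E v 0) * gmean n q \<beta> E (local_err n q \<beta> E v 0 us))
        \<le> 2 * real K * amp \<beta> K * \<Lambda>"
      by (intro mult_left_mono loc v mult_nonneg_nonneg amp_nonneg) auto
    ultimately show ?thesis unfolding bp_mean_def Av_add Av_cmult by linarith
  qed
  have pair: "Av (\<lambda>E us. tmean n 2 (\<lambda>ws. gmean n q \<beta> E (pin_err n q \<beta> E us ws))) \<le> \<eta>"
  proof -
    have "Av (\<lambda>E us. tmean n 2 (\<lambda>ws. gmean n q \<beta> E (pin_err n q \<beta> E us ws))) \<le> graph_mean n p (\<lambda>E. \<eta>)"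
      unfolding Av_def by (intro graph_mean_mono p pinning K)
    then show ?thesis using p by (simp add: graph_mean_const)
  qed
  have "graph_mean n p (\<lambda>E. tavg T n (\<lambda>us. gmean n q \<beta> E (total_err K n q \<beta> r E us)))
    = (1 / real n) * (\<Sum>u<n. Av (\<lambda>E us. bethe_mean K n q \<beta> r E us u))
     + (real q)\<^sup>2 * Av (\<lambda>E us. tmean n 2 (\<lambda>ws. gmean n q \<beta> E (pin_err n q \<beta> E us ws)))
     + (1 / real n) * (\<Sum>v<n. Av (\<lambda>E us. bp_mean K n q \<beta> E us v))"
    unfolding gmean_total_err[OF q] Av_def[symmetric] Av_add Av_cmult Av_sum ..
  also have "\<dots> \<le> ((1 + c) ^ Suc r / real K + real T * real K / real n + amp \<beta> K * \<Lambda>)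
      + (real q)\<^sup>2 * \<eta> + (2 * (c\<^sup>2 / real K) + 2 * real K * (real T / real n) + 2 * real K * amp \<beta> K * \<Lambda>)"
    by (intro add_mono mean_const bethe bp mult_left_mono pair) auto
  finally show ?thesis .
qed

lemma mean_total_err_small:
  fixes d \<beta> \<theta> :: real and q r :: nat
  assumes d: "d > 0" and \<beta>: "\<beta> > 0" and q: "q > 0" and \<theta>: "\<theta> > 0"
  shows "\<exists>K>0. \<exists>T>0. \<forall>\<^sub>F n in sequentially.
    graph_mean n (d / real n) (\<lambda>E. tavg T n (\<lambda>us. gmean n q \<beta> E (total_err K n q \<beta> r E us))) \<le> \<theta>"
proof -
  \<comment> \<open>As soon as p \<le> 1/2, \<open>odds p\<close> is at most 2 p, so n
    \<open>odds p\<close> is at most 2 d.\<close>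
  define c where "c = 2 * d"
  have c0: "c > 0" using d by (simp add: c_def)
  \<comment> \<open>Coefficient of 1/K in \<open>mean_total_err\<close>: large balls or cuts, and
    twice the large degrees. K makes this part at most \<theta>/3.\<close>
  define a where "a = (1 + c) ^ Suc r + 2 * c\<^sup>2"
  define K where "K = nat \<lceil>3 * a / \<theta>\<rceil> + 2"
  have K: "K \<ge> 2" "K > 0" by (simp_all add: K_def)
  have "3 * a / \<theta> \<le> real K" unfolding K_def by linarith
  then have Ka: "a / real K \<le> \<theta> / 3" using \<theta> K by (simp add: field_simps)
  \<comment> \<open>Coefficient of \<eta>, depending on K but not on T, so \<eta> may be chosen now
    and T afterwards.\<close>
  define b where "b = amp \<beta> K * (exp (\<beta> * real K) * (\<Sum>k\<le>K. (c * real K) ^ k)) * (1 + 2 * real K) + (real q)\<^sup>2"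
  have b0: "b > 0" using q c0 by (simp add: b_def add_nonneg_pos amp_nonneg sum_nonneg)
  define \<eta> where "\<eta> = \<theta> / (3 * b)"
  have \<eta>: "\<eta> > 0" using \<theta> b0 by (simp add: \<eta>_def)
  obtain T where T: "T > 0" and "\<forall>n>0. \<forall>\<Omega> W k. weighted_configs \<Omega> W q n \<longrightarrow> k \<le> K \<longrightarrow>
    (\<Sum>t<T. tmean n t (\<lambda>us. tmean n k (\<lambda>ws. wavg W \<Omega> (err \<Omega> W q us ws)))) / real T \<le> \<eta>"
    using pinning[OF \<eta>, of q K] by (elim exE conjE)
  note pin = this(2)[rule_format]
  \<comment> \<open>Coefficient of 1/n, from pins hitting a ball or a vertex; it contains T, so n is
    taken large last.\<close>
  define e where "e = 3 * real T * real K"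
  have "\<forall>\<^sub>F n in sequentially. max (2 * d) (3 * e / \<theta>) + 1 \<le> real n"
    using filterlim_real_sequentially by (simp add: filterlim_at_top)
  then have "\<forall>\<^sub>F n in sequentially.
    graph_mean n (d / real n) (\<lambda>E. tavg T n (\<lambda>us. gmean n q \<beta> E (total_err K n q \<beta> r E us))) \<le> \<theta>"
  proof (rule eventually_mono)
    fix n assume big: "max (2 * d) (3 * e / \<theta>) + 1 \<le> real n"
    have n: "n > 0" using big d by (cases n) auto
    have nd: "2 * d < real n" and ne: "3 * e / \<theta> \<le> real n" using big by auto
    define p where "p = d / real n"
    have p: "0 < p" "p < 1" using d n nd by (simp_all add: p_def)
    have ph: "p \<le> 1 / 2" using nd n by (simp add: p_def field_simps)
    have "p / (1 - p) \<le> p / (1 / 2)" using ph p by (intro divide_left_mono) auto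
    then have "real n * odds p \<le> real n * (2 * p)" unfolding odds_def by (intro mult_left_mono) auto
    also have "\<dots> = c" using n by (simp add: p_def c_def)
    finally have nc: "real n * odds p \<le> c" .
    have pin': "tavg T n (\<lambda>us. tmean n k (\<lambda>ws. gmean n q \<beta> E (pin_err n q \<beta> E us ws))) \<le> \<eta>" if "k \<le> K" for E k
      using pin[OF n weighted_configs_potts[OF q] that] by (simp add: tavg_def gmean_def pin_err_def)
    define \<Lambda> where "\<Lambda> = exp (\<beta> * real K) * ((\<Sum>k\<le>K. (c * real K) ^ k) * \<eta>)"
    have "graph_mean n p (\<lambda>E. tavg T n (\<lambda>us. gmean n q \<beta> E (total_err K n q \<beta> r E us)))
      \<le> ((1 + c) ^ Suc r / real K + real T * real K / real n + amp \<beta> K * \<Lambda>)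
        + (real q)\<^sup>2 * \<eta> + (2 * (c\<^sup>2 / real K) + 2 * real K * (real T / real n) + 2 * real K * amp \<beta> K * \<Lambda>)"
      unfolding \<Lambda>_def by (rule mean_total_err[OF p nc less_imp_le[OF \<beta>] q n T K(1) pin' less_imp_le[OF \<eta>]])
    also have "\<dots> = a / real K + e / real n + b * \<eta>"
      unfolding a_def e_def b_def \<Lambda>_def by (simp add: algebra_simps add_divide_distrib)
    also have "b * \<eta> = \<theta> / 3" using b0 by (simp add: \<eta>_def)
    also have "a / real K + e / real n + \<theta> / 3 \<le> \<theta>"
    proof -
      have "e / real n \<le> \<theta> / 3" using ne n \<theta> by (simp add: field_simps)
      with Ka show ?thesis by linarith
    qed
    finally show "graph_mean n (d / real n) (\<lambda>E. tavg T n (\<lambda>us. gmean n q \<beta> E (total_err K n q \<beta> r E us))) \<le> \<theta>"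
      by (simp only: p_def)
  qed
  with K T show ?thesis by blast
qed

section \<open>Good graphs\<close>

lemma total_err_nonneg: "q > 0 \<Longrightarrow> total_err K n q \<beta> r E us \<tau> \<ge> 0"
  unfolding total_err_def by (intro add_nonneg_nonneg total_err_parts)

lemma pin_disjoint: "pin \<Omega> us \<sigma> \<noteq> pin \<Omega> us \<tau> \<Longrightarrow> pin \<Omega> us \<sigma> \<inter> pin \<Omega> us \<tau> = {}"
  by (auto simp: pin_def)

text \<open>A cell is determined by the colours of the t pinned entries.\<close>

lemma card_pins_le:
  assumes us: "us \<in> tuples n t" and X: "X \<subseteq> cfg {..<n} q"
  shows "card (pin (cfg {..<n} q) us ` X) \<le> q ^ t"
proof -
  let ?keys = "{xs. set xs \<subseteq> {..<q} \<and> length xs = t}"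
  have fin: "finite ?keys" "card ?keys = q ^ t"
    using finite_lists_length_eq[of "{..<q}" t] card_lists_length_eq[of "{..<q}" t] by auto
  have sub: "(\<lambda>\<tau>. map \<tau> us) ` X \<subseteq> ?keys"
    using us X by (fastforce simp: tuples_def cfg_def PiE_iff)
  have "pin (cfg {..<n} q) us ` X = (\<lambda>xs. {\<sigma>\<in>cfg {..<n} q. map \<sigma> us = xs}) ` ((\<lambda>\<tau>. map \<tau> us) ` X)"
    by (simp add: pin_def image_image)
  then have "card (pin (cfg {..<n} q) us ` X) \<le> card ((\<lambda>\<tau>. map \<tau> us) ` X)"
    using finite_subset[OF sub fin(1)] by (simp add: card_image_le)
  also have "\<dots> \<le> q ^ t" using card_mono[OF fin(1) sub] fin(2) by simp
  finally show ?thesis .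
qed

text \<open>Fix pins that do no worse than average and keep the cells containing some \<tau> with
  error below \<epsilon>. One such \<tau> already certifies its whole cell, and the kept cells cover
  all such \<tau>.\<close>

lemma good_graph_if_total_err_small:
  assumes q: "q > 0" and \<beta>: "\<beta> > 0" and E: "E \<subseteq> all_pairs n" and n: "n > 0" and K: "K > 0" and T: "T > 0"
    and \<epsilon>: "0 < \<epsilon>" "\<epsilon> < 1"
    and small: "tavg T n (\<lambda>us. gmean n q \<beta> E (total_err K n q \<beta> r E us)) \<le> \<epsilon>\<^sup>2 / 2"
  shows "good_graph \<beta> q r n (real (q ^ T)) \<epsilon> E"
proof -
  let ?\<Omega> = "cfg {..<n} q"
  obtain t us where t: "t < T" and us: "us \<in> tuples n t"
    and le: "gmean n q \<beta> E (total_err K n q \<beta> r E us) \<le> tavg T n (\<lambda>us. gmean n q \<beta> E (total_err K n q \<beta> r E us))"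
    using tavg_attained[OF T n, of "\<lambda>us. gmean n q \<beta> E (total_err K n q \<beta> r E us)"] by blast
  define R where "R = total_err K n q \<beta> r E us"
  define X where "X = {\<tau>\<in>?\<Omega>. R \<tau> < \<epsilon>}"
  define C where "C = pin ?\<Omega> us ` X"
  have fin\<Omega>: "finite ?\<Omega>" by (simp add: finite_cfg)
  have XO: "X \<subseteq> ?\<Omega>" and finX: "finite X" using fin\<Omega> by (auto simp: X_def)
  have finC: "finite C" unfolding C_def using finX by simp
  have Z: "Zw \<beta> E ?\<Omega> > 0"
    unfolding Zw_def using cfg_nonempty[OF q] fin\<Omega> by (intro sum_pos potts_w_pos)
  have markov: "1 - \<epsilon> < Zw \<beta> E X / Zw \<beta> E ?\<Omega>"
  proof -
    \<comment> \<open>Markov's inequality in linear form: 1 - R / \<epsilon> lies below the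
      indicator of R < \<epsilon>. The half in the hypothesis makes the loss strictly less than
      \<epsilon>.\<close>
    have "gmean n q \<beta> E (\<lambda>\<tau>. 1 - (1 / \<epsilon>) * R \<tau>) \<le> gmean n q \<beta> E (\<lambda>\<tau>. of_bool (\<tau> \<in> X))"
      unfolding gmean_def
    proof (rule wavg_mono[OF fin\<Omega> potts_w_pos])
      fix \<tau> assume \<tau>: "\<tau> \<in> ?\<Omega>"
      have "R \<tau> \<ge> 0" unfolding R_def by (rule total_err_nonneg[OF q])
      then show "1 - (1 / \<epsilon>) * R \<tau> \<le> of_bool (\<tau> \<in> X)"
        using \<tau> \<epsilon> by (cases "R \<tau> < \<epsilon>") (auto simp: X_def field_simps)
    qed
    moreover have "gmean n q \<beta> E (\<lambda>\<tau>. 1 - (1 / \<epsilon>) * R \<tau>) = 1 - (1 / \<epsilon>) * gmean n q \<beta> E R"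
    proof -
      have "gmean n q \<beta> E (\<lambda>\<tau>. 1 + (- (1 / \<epsilon>)) * R \<tau>) = 1 + (- (1 / \<epsilon>)) * gmean n q \<beta> E R"
        unfolding gmean_add gmean_cmult gmean_const[OF q] ..
      then show ?thesis by simp
    qed
    moreover have "(1 / \<epsilon>) * gmean n q \<beta> E R < \<epsilon>"
    proof -
      have "gmean n q \<beta> E R \<le> \<epsilon>\<^sup>2 / 2" using le small unfolding R_def by linarith
      also have "\<dots> < \<epsilon> * \<epsilon>" using \<epsilon> by (simp add: power2_eq_square)
      finally show ?thesis using \<epsilon> by (simp add: divide_less_eq)
    qed
    moreover have "gmean n q \<beta> E (\<lambda>\<tau>. of_bool (\<tau> \<in> X)) = Zw \<beta> E X / Zw \<beta> E ?\<Omega>"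
    proof -
      have "{\<sigma>\<in>?\<Omega>. \<sigma> \<in> X} = X" using XO by auto
      then have "Zw \<beta> E X = (\<Sum>\<tau>\<in>?\<Omega>. potts_w \<beta> E \<tau> * of_bool (\<tau> \<in> X))"
        using Zw_Collect[OF fin\<Omega>, of \<beta> E "\<lambda>\<tau>. \<tau> \<in> X"] by simp
      then show ?thesis by (simp only: gmean_def wavg_def) (simp only: Zw_def)
    qed
    ultimately show ?thesis by simp
  qed
  have disj: "\<forall>A\<in>C. \<forall>B\<in>C. A \<noteq> B \<longrightarrow> A \<inter> B = {}"
    unfolding C_def by (simp add: pin_disjoint)
  have C1: "A \<subseteq> ?\<Omega> \<and> A \<noteq> {}" if "A \<in> C" for A
    using that XO pin_self unfolding C_def by (auto simp: pin_def)
  have C2: "bethe_state \<beta> q n E A \<epsilon> r \<and> bp_fixed_point \<beta> q n E A \<epsilon>" if AC: "A \<in> C" for A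
  proof -
    obtain \<tau> where \<tau>: "\<tau> \<in> ?\<Omega>" "R \<tau> < \<epsilon>" and A: "A = pin ?\<Omega> us \<tau>" using AC unfolding C_def X_def by blast
    show ?thesis
      using bethe_state_bp_fixed_point[OF q \<beta> E \<tau>(1) K \<tau>(2)[unfolded R_def]] unfolding A by blast
  qed
  have finA: "\<forall>A\<in>C. finite A" using C1 finite_subset[OF _ fin\<Omega>] by blast
  have "(\<Sum>A\<in>C. Zw \<beta> E A) = Zw \<beta> E (\<Union>C)"
    unfolding Zw_def sum.Union_disjoint[OF finA disj] by simp
  also have "\<dots> \<ge> Zw \<beta> E X"
  proof (rule Zw_mono)
    show "finite (\<Union>C)" by (rule finite_subset[OF _ fin\<Omega>]) (use C1 in blast)
    show "X \<subseteq> \<Union>C" using XO pin_self unfolding C_def by blast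
  qed
  finally have sumC: "Zw \<beta> E X \<le> (\<Sum>A\<in>C. Zw \<beta> E A)" .
  obtain S where S: "bij_betw S {..<card C} C"
    using ex_bij_betw_nat_finite[OF finC] by (auto simp: lessThan_atLeast0)
  have SC: "S i \<in> C" if "i < card C" for i using S that by (auto simp: bij_betw_def)
  have Ssum: "(\<Sum>i<card C. potts_prob \<beta> q n E (S i)) > 1 - \<epsilon>"
  proof -
    have "(\<Sum>i<card C. potts_prob \<beta> q n E (S i)) = (\<Sum>A\<in>C. potts_prob \<beta> q n E A)"
      by (rule sum.reindex_bij_betw[OF S])
    also have "\<dots> = (\<Sum>A\<in>C. Zw \<beta> E A) / Zw \<beta> E ?\<Omega>"
      by (simp add: potts_prob_def sum_divide_distrib)
    also have "\<dots> \<ge> Zw \<beta> E X / Zw \<beta> E ?\<Omega>" using sumC Z by (intro divide_right_mono) auto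
    finally show ?thesis using markov by linarith
  qed
  \<comment> \<open>Without cells the total mass would be 0, but it exceeds 1 - \<epsilon> >
    0.\<close>
  have "card C \<noteq> 0"
  proof
    assume "card C = 0"
    then show False using Ssum \<epsilon> by simp
  qed
  moreover have "card C \<le> q ^ T"
  proof -
    have "card C \<le> q ^ t" unfolding C_def by (rule card_pins_le[OF us XO])
    also have "\<dots> \<le> q ^ T" using t q by (intro power_increasing) auto
    finally show ?thesis .
  qed
  moreover have "S i \<inter> S j = {}" if "i < card C" "j < card C" "i \<noteq> j" for i j
  proof -
    have "S i \<noteq> S j" using S that by (auto simp: bij_betw_def inj_on_def)
    then show ?thesis using disj SC that by blast
  qed
  ultimately show ?thesis
    unfolding good_graph_def using SC C1 C2 Ssum
    by (intro exI[of _ "card C"] exI[of _ S]) (auto simp del: of_nat_power)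
qed

text \<open>Serves twice: to pass from a constant bound on the number of states to L n, and to
  enlarge \<epsilon> in the diagonal argument.\<close>

lemma good_graph_mono:
  assumes "good_graph \<beta> q r n L \<epsilon> E" "L \<le> L'" "\<epsilon> \<le> \<epsilon>'"
  shows "good_graph \<beta> q r n L' \<epsilon>' E"
proof -
  have "bethe_state \<beta> q n E S \<epsilon>' r" if "bethe_state \<beta> q n E S \<epsilon> r" for S
    using that assms(3) unfolding bethe_state_def by linarith
  moreover have "bp_fixed_point \<beta> q n E S \<epsilon>'" if "bp_fixed_point \<beta> q n E S \<epsilon>" for S
    using that assms(3) unfolding bp_fixed_point_def by linarith
  moreover obtain l S where S: "1 \<le> l" "real l \<le> L" "\<forall>i<l. S i \<subseteq> cfg {..<n} q \<and> S i \<noteq> {}"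
      "\<forall>i<l. \<forall>j<l. i \<noteq> j \<longrightarrow> S i \<inter> S j = {}" "(\<Sum>i<l. potts_prob \<beta> q n E (S i)) > 1 - \<epsilon>"
      "\<forall>i<l. bethe_state \<beta> q n E (S i) \<epsilon> r" "\<forall>i<l. bp_fixed_point \<beta> q n E (S i) \<epsilon>"
    using assms(1) unfolding good_graph_def by blast
  moreover have "real l \<le> L'" "(\<Sum>i<l. potts_prob \<beta> q n E (S i)) > 1 - \<epsilon>'"
    using S(2,5) assms(2,3) by linarith+
  ultimately show ?thesis
    unfolding good_graph_def by (intro exI[of _ l] exI[of _ S]) simp
qed

text \<open>Markov's inequality over graphs: a mean of at most \<epsilon>^3 / 2 against the
  threshold \<epsilon>^2 / 2 leaves failure probability at most \<epsilon>.\<close>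

lemma prob_good_graph:
  fixes d \<beta> \<epsilon> :: real and q r :: nat
  assumes d: "d > 0" and \<beta>: "\<beta> > 0" and q: "q > 0" and \<epsilon>: "0 < \<epsilon>" "\<epsilon> < 1"
  shows "\<exists>L0. \<forall>\<^sub>F n in sequentially.
    measure_pmf.prob (Gnp n (d / real n)) {E. good_graph \<beta> q r n L0 \<epsilon> E} \<ge> 1 - \<epsilon>"
proof -
  have "\<epsilon> ^ 3 / 2 > 0" using \<epsilon> by simp
  from mean_total_err_small[OF d \<beta> q this, of r]
  obtain K T where K: "K > 0" and T: "T > 0" and ev: "\<forall>\<^sub>F n in sequentially.
    graph_mean n (d / real n) (\<lambda>E. tavg T n (\<lambda>us. gmean n q \<beta> E (total_err K n q \<beta> r E us))) \<le> \<epsilon> ^ 3 / 2"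
    by blast
  \<comment> \<open>Guarantees d / n < 1, so that the formula for the law of the graph
    applies.\<close>
  have "\<forall>\<^sub>F n in sequentially. d + 1 \<le> real n"
    using filterlim_real_sequentially by (simp add: filterlim_at_top)
  with ev have "\<forall>\<^sub>F n in sequentially.
    measure_pmf.prob (Gnp n (d / real n)) {E. good_graph \<beta> q r n (real (q ^ T)) \<epsilon> E} \<ge> 1 - \<epsilon>"
  proof eventually_elim
    case (elim n)
    define p where "p = d / real n"
    have n: "n > 0" using elim(2) d by (cases n) auto
    have p: "0 < p" "p < 1" using d n elim(2) by (simp_all add: p_def)
    define Y where "Y E = tavg T n (\<lambda>us. gmean n q \<beta> E (total_err K n q \<beta> r E us))" for E
    have Y0: "Y E \<ge> 0" for E unfolding Y_def by (intro tavg_nonneg gmean_nonneg total_err_nonneg q)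
    have "graph_mean n p (\<lambda>E. 1 + (- (2 / \<epsilon>\<^sup>2)) * Y E) \<le> graph_mean n p (\<lambda>E. of_bool (E \<in> {E. good_graph \<beta> q r n (real (q ^ T)) \<epsilon> E}))"
    proof (intro graph_mean_mono p)
      fix E assume E: "E \<subseteq> all_pairs n"
      show "1 + (- (2 / \<epsilon>\<^sup>2)) * Y E \<le> of_bool (E \<in> {E. good_graph \<beta> q r n (real (q ^ T)) \<epsilon> E})"
      proof (cases "Y E \<le> \<epsilon>\<^sup>2 / 2")
        case True
        have "good_graph \<beta> q r n (real (q ^ T)) \<epsilon> E"
          by (rule good_graph_if_total_err_small[OF q \<beta> E n K T \<epsilon> True[unfolded Y_def]])
        moreover have "2 / \<epsilon>\<^sup>2 * Y E \<ge> 0" using Y0[of E] by simp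
        ultimately show ?thesis by simp
      next
        case False
        then have "1 \<le> 2 / \<epsilon>\<^sup>2 * Y E" using \<epsilon> by (simp add: field_simps)
        then show ?thesis by simp
      qed
    qed
    moreover have "graph_mean n p (\<lambda>E. 1 + (- (2 / \<epsilon>\<^sup>2)) * Y E) = 1 + (- (2 / \<epsilon>\<^sup>2)) * graph_mean n p Y"
      unfolding graph_mean_add graph_mean_cmult graph_mean_const[OF p] ..
    moreover have "2 / \<epsilon>\<^sup>2 * graph_mean n p Y \<le> 2 / \<epsilon>\<^sup>2 * (\<epsilon> ^ 3 / 2)"
      using elim(1) unfolding p_def Y_def by (intro mult_left_mono) auto
    moreover have "2 / \<epsilon>\<^sup>2 * (\<epsilon> ^ 3 / 2) = \<epsilon>" using \<epsilon> by (simp add: power2_eq_square power3_eq_cube)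
    ultimately show ?case
      unfolding p_def[symmetric] prob_Gnp[OF p] by linarith
  qed
  then show ?thesis by blast
qed

theorem theorem1p1:
  fixes q r :: nat and d \<beta> :: real and L :: "nat \<Rightarrow> real"
  assumes "q \<ge> 2" and "d > 0" and "\<beta> > 0" and "r > 0"
    and "filterlim L at_top sequentially"
  shows "\<exists>\<epsilon> :: nat \<Rightarrow> real. \<epsilon> \<longlonglongrightarrow> 0 \<and>
           (\<lambda>n. measure_pmf.prob (Gnp n (d / real n)) {E. good_graph \<beta> q r n (L n) (\<epsilon> n) E})
             \<longlonglongrightarrow> 1"
proof -
  define P where "P n x = measure_pmf.prob (Gnp n (d / real n)) {E. good_graph \<beta> q r n (L n) x E}" for n x
  define A where "A n = {x. 0 < x \<and> P n x \<ge> 1 - x}" for n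
  \<comment> \<open>The infimum of the admissible tolerances at n need not be admissible itself; the
    extra term leaves room for an admissible one strictly below \<open>\<epsilon> n\<close>, and
    monotonicity carries its bound over.\<close>
  define \<epsilon> where "\<epsilon> n = Inf (A n) + 1 / real (Suc n)" for n
  have P_mono: "P n x \<le> P n y" if "x \<le> y" for n x y
    unfolding P_def using that by (intro measure_pmf.finite_measure_mono) (auto intro: good_graph_mono)
  \<comment> \<open>At tolerance 1 the condition only asks for a nonnegative probability; hence the
    infimum is over a nonempty set for every n.\<close>
  have A1: "1 \<in> A n" for n by (simp add: A_def P_def)
  have bdd: "bdd_below (A n)" for n by (rule bdd_belowI[of _ 0]) (auto simp: A_def)
  have Inf0: "Inf (A n) \<ge> 0" for n
  proof (rule cInf_greatest)
    show "A n \<noteq> {}" using A1 by blast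
  qed (simp add: A_def)
  have ev: "\<forall>\<^sub>F n in sequentially. x \<in> A n" if x: "0 < x" "x < 1" for x
  proof -
    obtain L0 where L0: "\<forall>\<^sub>F n in sequentially.
        measure_pmf.prob (Gnp n (d / real n)) {E. good_graph \<beta> q r n L0 x E} \<ge> 1 - x"
      using prob_good_graph[of d \<beta> q x r] assms x by auto
    \<comment> \<open>\<open>L0\<close> depends on x but not on n, so L overtakes it however slowly
      it grows.\<close>
    have "\<forall>\<^sub>F n in sequentially. L0 \<le> L n"
      using assms(5) by (simp add: filterlim_at_top)
    with L0 show ?thesis
    proof eventually_elim
      case (elim n)
      have "measure_pmf.prob (Gnp n (d / real n)) {E. good_graph \<beta> q r n L0 x E} \<le> P n x"
        unfolding P_def using elim(2) by (intro measure_pmf.finite_measure_mono) (auto intro: good_graph_mono)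
      then show ?case using elim(1) x by (simp add: A_def)
    qed
  qed
  have Inf_lim: "(\<lambda>n. Inf (A n)) \<longlonglongrightarrow> 0"
  proof (rule LIMSEQ_I)
    fix e :: real assume e: "e > 0"
    define x where "x = min (e / 2) (1 / 2)"
    have x: "0 < x" "x < 1" "x < e" using e by (auto simp: x_def)
    have "\<forall>\<^sub>F n in sequentially. norm (Inf (A n) - 0) < e"
      using ev[OF x(1,2)]
    proof eventually_elim
      case (elim n)
      then have "Inf (A n) \<le> x" by (rule cInf_lower[OF _ bdd])
      then show ?case using Inf0[of n] x by simp
    qed
    then show "\<exists>no. \<forall>n\<ge>no. norm (Inf (A n) - 0) < e" by (simp add: eventually_sequentially)
  qed
  have \<epsilon>_lim: "\<epsilon> \<longlonglongrightarrow> 0"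
    unfolding \<epsilon>_def[abs_def] using tendsto_add[OF Inf_lim LIMSEQ_inverse_real_of_nat] by (simp add: inverse_eq_divide)
  have lower: "1 - \<epsilon> n \<le> P n (\<epsilon> n)" for n
  proof -
    have "Inf (A n) < \<epsilon> n" by (simp add: \<epsilon>_def)
    then obtain x where x: "x \<in> A n" "x < \<epsilon> n" using cInf_lessD[of "A n" "\<epsilon> n"] A1 by blast
    then have "1 - x \<le> P n x" by (simp add: A_def)
    also have "\<dots> \<le> P n (\<epsilon> n)" using x by (intro P_mono) simp
    finally show ?thesis using x by linarith
  qed
  have upper: "P n (\<epsilon> n) \<le> 1" for n by (simp add: P_def)
  have "(\<lambda>n. P n (\<epsilon> n)) \<longlonglongrightarrow> 1"
  proof (rule tendsto_sandwich[of "\<lambda>n. 1 - \<epsilon> n" _ _ "\<lambda>_. 1"])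
    show "(\<lambda>n. 1 - \<epsilon> n) \<longlonglongrightarrow> 1" using tendsto_diff[OF tendsto_const \<epsilon>_lim, of 1] by simp
  qed (auto simp: lower upper)
  then show ?thesis using \<epsilon>_lim unfolding P_def by blast
qed

end
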